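(* Let $N\ge 1$, $0<\theta\le 2$ and $p\ge p_\theta:=1+\theta/N$. Consider the Cauchy problem (P): $\partial_t u+(-\Delta)^{\theta/2}u=u^p$ in $\mathbf{R}^N\times(0,\infty)$, $u(0)=\mu$. Then there exists $\gamma_*>0$ with the following properties: (i) If $p=p_\theta$ and $$\mu(x)=\gamma|x|^{-N}\left[\log\left(e+\frac{1}{|x|}\right)\right]^{-\frac N\theta-1}+C$$ for some $\gamma\ge 0$ and $C\ge 0$, then problem (P) possesses a local-in-time solution if $0\le\gamma<\gamma_*$, and problem (P) possesses no local-in-time solutions if $\gamma>\gamma_*$. (ii) If $p>p_\theta$ and $$\mu(x)=\gamma|x|^{-\frac{\theta}{p-1}}+C$$ for some $\gamma\ge 0$ and $C\ge 0$, then problem (P) possesses a local-in-time solution if $0\le\gamma<\gamma_*$, and problem (P) possesses no local-in-time solutions if $\gamma>\gamma_*$. Furthermore, if $C=0$ and $\gamma$ is small enough, then problem (P) possesses a global-in-time solution.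
   Context: A nonnegative locally integrable function $\mu$ is identified with the Radon measure $\mu\,dx$. $G=G(x,t)$ denotes the fundamental solution of $\partial_t u+(-\Delta)^{\theta/2}u=0$ in $\mathbf{R}^N\times(0,\infty)$, i.e. the positive smooth kernel with $\int_{\mathbf{R}^N}G(x,t)e^{-i\xi\cdot x}\,dx=e^{-t|\xi|^\theta}$ (the Gauss kernel $(4\pi t)^{-N/2}e^{-|x|^2/4t}$ when $\theta=2$). For a Radon measure $\mu$ in $\mathbf{R}^N$ and $0<T\le\infty$, a nonnegative measurable function $u$ in $\mathbf{R}^N\times(0,T)$ is a solution of (P) in $\mathbf{R}^N\times[0,T)$ if $$\infty>u(x,t)=\int_{\mathbf{R}^N}G(x-y,t)\,d\mu(y)+\int_0^t\int_{\mathbf{R}^N}G(x-y,t-s)u(y,s)^p\,dy\,ds$$ for almost all $x\in\mathbf{R}^N$ and $0<t<T$. A local-in-time solution is a solution in $\mathbf{R}^N\times[0,T)$ for some $T>0$; a global-in-time solution is a solution in $\mathbf{R}^N\times[0,\infty)$. *)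

theory Defs
  imports "HOL-Analysis.Analysis"
begin

text \<open>
  On an open set \<open>S\<close> of a finite-dimensional space, \<open>C_k k f S\<close> is the usual
  \<open>C^k\<close> regularity, phrased through iterated directional derivatives.
\<close>

fun C_k :: "nat \<Rightarrow> ('a::euclidean_space \<Rightarrow> real) \<Rightarrow> 'a set \<Rightarrow> bool" where
  "C_k 0 f S \<longleftrightarrow> continuous_on S f"
| "C_k (Suc k) f S \<longleftrightarrow>
     f differentiable_on S \<and> (\<forall>v. C_k k (\<lambda>x. frechet_derivative f (at x) v) S)"

definition smooth_on :: "('a::euclidean_space \<Rightarrow> real) \<Rightarrow> 'a set \<Rightarrow> bool" where
  "smooth_on f S \<longleftrightarrow> (\<forall>k. C_k k f S)"

definition is_frac_heat_kernel :: "real \<Rightarrow> ((real ^ 'n) \<Rightarrow> real \<Rightarrow> real) \<Rightarrow> bool" where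
  "is_frac_heat_kernel \<theta> G \<longleftrightarrow>
     smooth_on (\<lambda>(x, t). G x t) (UNIV \<times> {0<..}) \<and>
     (\<forall>x. \<forall>t>0. G x t > 0) \<and>
     (\<forall>\<xi>. \<forall>t>0. has_bochner_integral lborel
        (\<lambda>x. complex_of_real (G x t) * exp (- (\<i> * complex_of_real (\<xi> \<bullet> x))))
        (complex_of_real (exp (- t * norm \<xi> powr \<theta>))))"

text \<open>
  The Fourier transform determines the (continuous) kernel at all times \<open>t > 0\<close>; the
  choice operator leaves only its values at \<open>t \<le> 0\<close> unspecified, and these are never used.
\<close>

definition frac_heat_kernel :: "real \<Rightarrow> (real ^ 'n) \<Rightarrow> real \<Rightarrow> real" where
  "frac_heat_kernel \<theta> = (SOME G. is_frac_heat_kernel \<theta> G)"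

text \<open>
  Integral solutions of \<open>\<partial>\<^sub>t u + (-\<Delta>)\<^bsup>\<theta>/2\<^esup> u = u\<^sup>p\<close>, \<open>u(0) = \<mu>\<close>, on \<open>[0, T)\<close> with
  \<open>0 < T \<le> \<infinity>\<close>, for a Radon measure \<open>\<mu>\<close> (a Borel measure that is finite on compact sets).
  The right-hand side of the equation is computed in \<open>[0, \<infinity>]\<close>; since \<open>u\<close> is real-valued, the
  equation contains the requirement that the right-hand side is finite almost everywhere.
\<close>

definition is_solution ::
  "real \<Rightarrow> real \<Rightarrow> (real ^ 'n) measure \<Rightarrow> ereal \<Rightarrow> ((real ^ 'n) \<Rightarrow> real \<Rightarrow> real) \<Rightarrow> bool" where
  "is_solution \<theta> p \<mu> T u \<longleftrightarrow>
     (\<lambda>(x, t). u x t) \<in> borel_measurable (restrict_space borel (UNIV \<times> {t. 0 < t \<and> ereal t < T})) \<and>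
     (\<forall>x t. 0 < t \<and> ereal t < T \<longrightarrow> 0 \<le> u x t) \<and>
     (AE (x, t) in lborel. 0 < t \<and> ereal t < T \<longrightarrow>
        ennreal (u x t) =
          (\<integral>\<^sup>+y. ennreal (frac_heat_kernel \<theta> (x - y) t) \<partial>\<mu>) +
          (\<integral>\<^sup>+s\<in>{0<..<t}.
             (\<integral>\<^sup>+y. ennreal (frac_heat_kernel \<theta> (x - y) (t - s) * u y s powr p) \<partial>lborel)
           \<partial>lborel))"

definition has_local_solution :: "real \<Rightarrow> real \<Rightarrow> (real ^ 'n) measure \<Rightarrow> bool" where
  "has_local_solution \<theta> p \<mu> \<longleftrightarrow> (\<exists>T>0. \<exists>u. is_solution \<theta> p \<mu> T u)"

definition has_global_solution :: "real \<Rightarrow> real \<Rightarrow> (real ^ 'n) measure \<Rightarrow> bool" where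
  "has_global_solution \<theta> p \<mu> \<longleftrightarrow> (\<exists>u. is_solution \<theta> p \<mu> \<infinity> u)"

definition fun_measure :: "((real ^ 'n) \<Rightarrow> real) \<Rightarrow> (real ^ 'n) measure" where
  "fun_measure f = density lborel (\<lambda>x. ennreal (f x))"

text \<open>
  The initial data below are singular at the origin; the value that Isabelle's division and
  \<open>powr\<close> conventions give them there does not affect the associated measures.
\<close>

definition critical_data :: "real \<Rightarrow> real \<Rightarrow> real \<Rightarrow> (real ^ 'n) \<Rightarrow> real" where
  "critical_data \<theta> \<gamma> C x =
     \<gamma> * norm x powr (- real CARD('n))
       * ln (exp 1 + 1 / norm x) powr (- (real CARD('n) / \<theta>) - 1) + C"

definition supercritical_data :: "real \<Rightarrow> real \<Rightarrow> real \<Rightarrow> real \<Rightarrow> (real ^ 'n) \<Rightarrow> real" where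
  "supercritical_data \<theta> p \<gamma> C x = \<gamma> * norm x powr (- (\<theta> / (p - 1))) + C"

end

theory Submission
  imports Defs "HOL-Probability.Probability"
begin

text \<open>
  The kernel is the inverse Fourier transform of \<open>exp (- t \<bar>\<xi>\<bar>\<^sup>\<theta>)\<close>. Its sign and radial monotonicity
  are inherited from the Gauss kernel: \<open>u\<^sup>a\<close> with \<open>0 < a < 1\<close> is a mixture of the functions
  \<open>1 - exp (- u r)\<close>, so a linear functional that is nonnegative on all Gaussians
  \<open>exp (- \<delta> \<bar>\<xi>\<bar>\<^sup>2)\<close> is nonnegative on \<open>exp (- t \<bar>\<xi>\<bar>\<^sup>\<theta>)\<close>.

  By monotone iteration, solvability is the existence of a supersolution. Convexity of \<open>z\<^sup>p\<close>
  shows that solvability for \<open>\<gamma>' g\<close> implies local solvability for \<open>\<gamma> g + C\<close> whenever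
  \<open>\<gamma> < \<gamma>'\<close>; hence the threshold is the supremum of the \<open>\<gamma>\<close> for which \<open>\<gamma> g\<close> is solvable, and it
  remains to see that this set contains a positive number and is bounded.

  For small \<open>\<gamma>\<close> and \<open>p > p\<^sub>\<theta>\<close> a multiple of \<open>(S(t) g\<^sup>\<alpha>)\<^bsup>1/\<alpha>\<^esup>\<close> with \<open>\<alpha>\<close> slightly above 1 is a supersolution.
  For \<open>p = p\<^sub>\<theta>\<close> one uses \<open>2 S(t) g + L(t)\<^bsup>-q/2\<^esup> S(t) \<nu>\<close>, where \<open>q = N/\<theta>\<close>, \<open>L(t) = - ln t / \<theta>\<close> and
  \<open>\<nu>\<close> is \<open>g\<close> times \<open>(- ln \<bar>x\<bar>)\<^bsup>q/2\<^esup>\<close> near the origin.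

  For large \<open>\<gamma>\<close>, the function \<open>W(t) = t\<^sup>q (S(t) u(t))(x\<^sub>0)\<close>, with \<open>x\<^sub>0\<close> near the origin, satisfies
  \<open>W(t) \<ge> c m + c \<integral>\<^bsub>\<rho>\<^esub>\<^sup>t s\<^bsup>- q (p - 1)\<^esup> W(s)\<^sup>p ds\<close>, where \<open>m\<close> is the mass of the data in the ball of radius
  \<open>\<rho>\<^bsup>1/\<theta>\<^esup>\<close>. This blows up too early unless \<open>m\<close> is small.
\<close>

section \<open>Affine changes of variables and the Gaussian Fourier transform\<close>

text \<open>\<open>frac_heat_kernel\<close> is a choice: all that is known of it are the properties
  it was chosen for, so existence and uniqueness of such a kernel come first. Afterwards only mass,
  semigroup law, self-similarity and radial monotonicity are used.

  Two supersolutions are needed because at \<open>p = 1 + 1 / q\<close> the data are integrable at 0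
  only thanks to the logarithm, so no power \<alpha> > 1 of them is. A multiple of S(t) g fails as
  well: near x = 0, (S(s) g)^(p-1) is of order 1 / (s L(s)), and its integral down to s = 0 diverges
  like log log. The part of g inside |x| < s^(1/\<theta>) causes this; \<nu>, with its heavier
  logarithm, pays for it, and the rest of g gains one more factor 1 / L in its uniform bound, which
  makes the time integral converge.

  In the inequality for W the critical exponent gives the scale-invariant measure ds / s, so m^(p-1)
  log(R / \<rho>) must stay bounded for a fixed R. Critical data have mass of order \<gamma> (-log
  r)^(-q) in the ball of radius r, and q (p - 1) = 1: the logarithms cancel, and a bound on \<gamma>
  remains.\<close>

lemma nn_integral_lborel_affine:
  fixes t :: "'a::euclidean_space"
  assumes [measurable]: "f \<in> borel_measurable borel" and c: "c \<noteq> 0"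
  shows "(\<integral>\<^sup>+x. f x \<partial>lborel) = ennreal (\<bar>c\<bar> ^ DIM('a)) * (\<integral>\<^sup>+x. f (t + c *\<^sub>R x) \<partial>lborel)"
  by (subst lborel_affine[OF c, of t])
     (simp add: nn_integral_density nn_integral_distr nn_integral_cmult)

lemma integral_lborel_affine:
  fixes t :: "'a::euclidean_space" and f :: "'a \<Rightarrow> 'b::{banach, second_countable_topology}"
  assumes [measurable]: "f \<in> borel_measurable borel" and c: "c \<noteq> 0"
  shows "(LBINT x. f x) = (\<bar>c\<bar> ^ DIM('a)) *\<^sub>R (LBINT x. f (t + c *\<^sub>R x))"
  by (subst lborel_affine[OF c, of t])
     (simp add: integral_density integral_distr)

lemma integrable_lborel_affine:
  fixes t :: "'a::euclidean_space" and f :: "'a \<Rightarrow> 'b::{banach, second_countable_topology}"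
  assumes c: "c \<noteq> 0" and f: "integrable lborel f"
  shows "integrable lborel (\<lambda>x. f (t + c *\<^sub>R x))"
proof -
  have [measurable]: "f \<in> borel_measurable borel"
    using f by auto
  have "integrable (density (distr lborel borel (\<lambda>x. t + c *\<^sub>R x)) (\<lambda>_. ennreal (\<bar>c\<bar> ^ DIM('a)))) f"
    using f lborel_affine[OF c, of t] by simp
  then have "integrable lborel (\<lambda>x. (\<bar>c\<bar> ^ DIM('a)) *\<^sub>R f (t + c *\<^sub>R x))"
    by (simp add: integrable_density integrable_distr_eq)
  then have "integrable lborel (\<lambda>x. inverse (\<bar>c\<bar> ^ DIM('a)) *\<^sub>R (\<bar>c\<bar> ^ DIM('a)) *\<^sub>R f (t + c *\<^sub>R x))"
    by (rule integrable_scaleR_right)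
  then show ?thesis
    using c by simp
qed

lemma nn_integral_lborel_reflect:
  fixes z :: "'a::euclidean_space"
  assumes "f \<in> borel_measurable borel"
  shows "(\<integral>\<^sup>+x. f (z - x) \<partial>lborel) = (\<integral>\<^sup>+x. f x \<partial>lborel)"
  using nn_integral_lborel_affine[OF assms, of "-1" z] by simp

lemma nn_integral_lborel_shift:
  fixes z :: "'a::euclidean_space"
  assumes "f \<in> borel_measurable borel"
  shows "(\<integral>\<^sup>+x. f (x - z) \<partial>lborel) = (\<integral>\<^sup>+x. f x \<partial>lborel)"
  using nn_integral_lborel_affine[OF assms, of "1" "-z"] by simp

lemma gauss_fourier_real:
  fixes x \<delta> :: real
  assumes \<delta>: "\<delta> > 0"
  shows "has_bochner_integral lborel (\<lambda>\<xi>. iexp (x * \<xi>) * of_real (exp (- \<delta> * \<xi>\<^sup>2)))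
           (complex_of_real (sqrt (pi / \<delta>) * exp (- x\<^sup>2 / (4 * \<delta>))))"
proof -
  \<comment> \<open>This \<open>c\<close> turns the standard normal density at
    \<open>c * \<xi>\<close> into a multiple of \<open>exp (- \<delta> * \<xi>\<^sup>2)\<close>, so
    the formula is the characteristic function of the normal law, rescaled.\<close>
  define c where "c = sqrt (2 * \<delta>)"
  have c: "c > 0" "c\<^sup>2 = 2 * \<delta>" using \<delta> by (auto simp: c_def)
  have int: "integrable lborel (\<lambda>y. of_real (std_normal_density y) * iexp (t * y))" for t
    by (rule Bochner_Integration.integrable_bound[of lborel "std_normal_density"])
       (auto simp: integrable_normal_density norm_mult normal_density_nonneg)
  have "(CLBINT y. of_real (std_normal_density y) * iexp (t * y)) = char std_normal_distribution t" for t
    unfolding char_def by (subst integral_density) (auto simp: scaleR_conv_of_real normal_density_nonneg)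
  then have hb: "has_bochner_integral lborel (\<lambda>y. of_real (std_normal_density y) * iexp (t * y))
      (complex_of_real (exp (- (t^2) / 2)))" for t
    using int by (simp add: has_bochner_integral_iff char_std_normal_distribution)
  have "has_bochner_integral lborel (\<lambda>\<xi>. of_real (std_normal_density (c * \<xi>)) * iexp (x / c * (c * \<xi>)))
      (complex_of_real (exp (- ((x/c)^2) / 2)) /\<^sub>R c)"
    using hb[of "x/c"] lborel_has_bochner_integral_real_affine_iff[of c "\<lambda>y. of_real (std_normal_density y) * iexp (x / c * y)" _ 0] c
    by simp
  from has_bochner_integral_mult_right[OF this, of "complex_of_real (sqrt (2 * pi))"]
  have "has_bochner_integral lborel
     (\<lambda>\<xi>. complex_of_real (sqrt (2 * pi)) * (of_real (std_normal_density (c * \<xi>)) * iexp (x / c * (c * \<xi>))))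
     (complex_of_real (sqrt (2 * pi)) * (complex_of_real (exp (- ((x/c)^2) / 2)) /\<^sub>R c))"
    by simp
  moreover have "complex_of_real (sqrt (2 * pi)) * (of_real (std_normal_density (c * \<xi>)) * iexp (x / c * (c * \<xi>)))
      = iexp (x * \<xi>) * of_real (exp (- \<delta> * \<xi>\<^sup>2))" for \<xi>
  proof -
    have "sqrt (2 * pi) * std_normal_density (c * \<xi>) = exp (- \<delta> * \<xi>\<^sup>2)"
      using c by (simp add: std_normal_density_def power_mult_distrib)
    then have "complex_of_real (sqrt (2 * pi)) * of_real (std_normal_density (c * \<xi>)) = of_real (exp (- \<delta> * \<xi>\<^sup>2))"
      by (metis of_real_mult)
    moreover have "x / c * (c * \<xi>) = x * \<xi>" using c by simp
    ultimately show ?thesis by (metis mult.assoc mult.commute)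
  qed
  moreover have "complex_of_real (sqrt (2 * pi)) * (complex_of_real (exp (- ((x/c)^2) / 2)) /\<^sub>R c)
     = complex_of_real (sqrt (pi / \<delta>) * exp (- x\<^sup>2 / (4 * \<delta>)))"
  proof -
    have "sqrt (2 * pi) / c = sqrt (pi / \<delta>)"
      unfolding c_def by (simp add: real_sqrt_mult real_sqrt_divide)
    moreover have "(x/c)^2 / 2 = x\<^sup>2 / (4 * \<delta>)"
      using c by (simp add: power_divide)
    ultimately have "sqrt (2 * pi) * (exp (- ((x/c)^2) / 2) / c) = sqrt (pi / \<delta>) * exp (- x\<^sup>2 / (4 * \<delta>))"
      by (metis times_divide_eq_left times_divide_eq_right divide_divide_eq_left mult.commute minus_divide_left)
    moreover have "complex_of_real (sqrt (2 * pi)) * (complex_of_real (exp (- ((x/c)^2) / 2)) /\<^sub>R c) =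
      complex_of_real (sqrt (2 * pi) * (exp (- ((x/c)^2) / 2) / c))"
      unfolding scaleR_conv_of_real of_real_mult divide_inverse by (simp only: mult.assoc mult.commute mult.left_commute)
    ultimately show ?thesis by simp
  qed
  ultimately show ?thesis by simp
qed

text \<open>In orthonormal coordinates phase and Gaussian both factorize, and Lebesgue measure is
  the image of a product measure; the integral is the product of the one-dimensional ones over
  \<open>Basis\<close>.\<close>

lemma gauss_fourier:
  fixes x :: "'a::euclidean_space"
  assumes \<delta>: "\<delta> > 0"
  shows "has_bochner_integral lborel (\<lambda>\<xi>. iexp (x \<bullet> \<xi>) * of_real (exp (- \<delta> * (norm \<xi>)\<^sup>2)))
           (complex_of_real ((pi / \<delta>) powr (DIM('a) / 2) * exp (- (norm x)\<^sup>2 / (4 * \<delta>))))"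
proof -
  interpret product_sigma_finite "\<lambda>_::'a. lborel :: real measure" by standard
  define g where "g b y = iexp ((x \<bullet> b) * y) * of_real (exp (- \<delta> * y\<^sup>2))" for b :: 'a and y :: real
  have g: "has_bochner_integral lborel (g b) (complex_of_real (sqrt (pi / \<delta>) * exp (- (x \<bullet> b)\<^sup>2 / (4 * \<delta>))))" for b
    unfolding g_def by (rule gauss_fourier_real[OF \<delta>])
  have gi: "integrable lborel (g b)" and gv: "integral\<^sup>L lborel (g b) = complex_of_real (sqrt (pi / \<delta>) * exp (- (x \<bullet> b)\<^sup>2 / (4 * \<delta>)))" for b
    using g[of b] by (auto simp: has_bochner_integral_iff)
  let ?T = "\<lambda>f. \<Sum>b\<in>Basis. f b *\<^sub>R (b::'a)"
  have eq: "iexp (x \<bullet> \<xi>) * of_real (exp (- \<delta> * (norm \<xi>)\<^sup>2)) = (\<Prod>b\<in>Basis. g b (\<xi> \<bullet> b))" for \<xi> :: 'a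
  proof -
    have "(norm \<xi>)\<^sup>2 = (\<Sum>b\<in>Basis. (\<xi> \<bullet> b)\<^sup>2)"
      unfolding power2_norm_eq_inner by (subst euclidean_inner) (simp add: power2_eq_square)
    moreover have "x \<bullet> \<xi> = (\<Sum>b\<in>Basis. (x \<bullet> b) * (\<xi> \<bullet> b))" by (rule euclidean_inner)
    moreover have "(\<Prod>b\<in>Basis. iexp ((x \<bullet> b) * (\<xi> \<bullet> b))) = iexp (\<Sum>b\<in>Basis. (x \<bullet> b) * (\<xi> \<bullet> b))"
      by (simp only: exp_sum[symmetric] finite_Basis of_real_sum sum_distrib_left)
    moreover have "(\<Prod>b\<in>Basis. complex_of_real (exp (- \<delta> * (\<xi> \<bullet> b)\<^sup>2))) = of_real (exp (- \<delta> * (\<Sum>b\<in>Basis. (\<xi> \<bullet> b)\<^sup>2)))"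
      by (simp only: exp_sum[symmetric] finite_Basis of_real_prod[symmetric] sum_distrib_left)
    ultimately show ?thesis
      unfolding g_def prod.distrib by simp
  qed
  have Tm[measurable]: "?T \<in> measurable (\<Pi>\<^sub>M b\<in>Basis. lborel) borel"
    by measurable
  have m[measurable]: "(\<lambda>\<xi>. \<Prod>b\<in>Basis. g b (\<xi> \<bullet> b)) \<in> borel_measurable (borel :: 'a measure)"
    unfolding g_def by measurable
  have pe: "(\<Prod>b\<in>Basis. g b (?T f \<bullet> b)) = (\<Prod>b\<in>Basis. g b (f b))" for f
    by (intro prod.cong) auto
  have "integrable (\<Pi>\<^sub>M b\<in>Basis. lborel) (\<lambda>f. \<Prod>b\<in>(Basis::'a set). g b (f b))"
    by (rule product_integrable_prod) (auto simp: gi)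
  moreover have "(\<integral>f. (\<Prod>b\<in>(Basis::'a set). g b (f b)) \<partial>(\<Pi>\<^sub>M b\<in>Basis. lborel)) = (\<Prod>b\<in>Basis. integral\<^sup>L lborel (g b))"
    by (rule product_integral_prod) (auto simp: gi)
  ultimately have "has_bochner_integral lborel (\<lambda>\<xi>. \<Prod>b\<in>Basis. g b (\<xi> \<bullet> b)) (\<Prod>b\<in>(Basis::'a set). integral\<^sup>L lborel (g b))"
    unfolding has_bochner_integral_iff
    by (subst (1 2) lborel_eq) (simp add: integrable_distr_eq integral_distr pe)
  moreover have "(\<Prod>b\<in>(Basis::'a set). integral\<^sup>L lborel (g b)) =
      complex_of_real ((pi / \<delta>) powr (DIM('a) / 2) * exp (- (norm x)\<^sup>2 / (4 * \<delta>)))"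
  proof -
    have "(\<Prod>b\<in>(Basis::'a set). sqrt (pi / \<delta>)) = (pi / \<delta>) powr (DIM('a) / 2)"
    proof -
      have "sqrt (pi / \<delta>) ^ n = ((pi / \<delta>) powr (1/2)) powr real n" for n
        using \<delta> by (subst powr_realpow) (simp_all add: powr_half_sqrt)
      then show ?thesis by (simp add: powr_powr)
    qed
    moreover have "(\<Prod>b\<in>(Basis::'a set). exp (- (x \<bullet> b)\<^sup>2 / (4 * \<delta>))) = exp (- (norm x)\<^sup>2 / (4 * \<delta>))"
    proof -
      have "(norm x)\<^sup>2 = (\<Sum>b\<in>Basis. (x \<bullet> b)\<^sup>2)"
        unfolding power2_norm_eq_inner by (subst euclidean_inner) (simp add: power2_eq_square)
      then show ?thesis
        by (simp only: exp_sum[symmetric] finite_Basis sum_negf sum_divide_distrib minus_divide_left[symmetric])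
    qed
    ultimately show ?thesis
      unfolding gv of_real_prod[symmetric] prod.distrib by simp
  qed
  ultimately show ?thesis by (simp only: eq)
qed

lemma Re_iexp_mult_of_real: "Re (iexp s * of_real r) = cos s * r"
  by (simp add: cis_conv_exp[symmetric])

lemma gauss_cos:
  fixes x :: "'a::euclidean_space"
  assumes \<delta>: "\<delta> > 0"
  shows "has_bochner_integral lborel (\<lambda>\<xi>. cos (x \<bullet> \<xi>) * exp (- \<delta> * (norm \<xi>)\<^sup>2))
           ((pi / \<delta>) powr (DIM('a) / 2) * exp (- (norm x)\<^sup>2 / (4 * \<delta>)))"
  using has_bochner_integral_Re[OF gauss_fourier[OF \<delta>, of x]]
  by (simp only: Re_iexp_mult_of_real Re_complex_of_real)

lemma gauss_integrable:
  assumes \<delta>: "\<delta> > 0"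
  shows "integrable lborel (\<lambda>\<xi>::'a::euclidean_space. exp (- \<delta> * (norm \<xi>)\<^sup>2))"
  using gauss_cos[OF \<delta>, of "0::'a"] by (simp add: has_bochner_integral_iff)

section \<open>Radial integrals and integrability of the symbol\<close>

text \<open>\<open>f\<close> may be unbounded at 0, so the fundamental theorem is applied on
  \<open>{c i..R}\<close> with \<open>c i\<close> decreasing to 0, and monotone convergence gives
  the rest.\<close>

lemma nn_integral_FTC_at_0:
  fixes f F :: "real \<Rightarrow> real"
  assumes R: "0 < R" and f_borel: "f \<in> borel_measurable borel"
    and f: "\<And>r. 0 < r \<Longrightarrow> r \<le> R \<Longrightarrow> (F has_real_derivative f r) (at r)"
    and nonneg: "\<And>r. 0 < r \<Longrightarrow> r \<le> R \<Longrightarrow> 0 \<le> f r"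
    and lim: "(F \<longlongrightarrow> L) (at_right 0)"
  shows "(\<integral>\<^sup>+r. ennreal (f r) * indicator {0<..R} r \<partial>lborel) = ennreal (F R - L)"
proof -
  define c where "c i = R / (real i + 1)" for i :: nat
  have c: "0 < c i" "c i \<le> R" for i
    using R by (auto simp: c_def field_simps)
  have c_lim: "c \<longlonglongrightarrow> 0"
    unfolding c_def using LIMSEQ_Suc[OF lim_const_over_n[of R]] by (simp add: add.commute)
  have c_mono: "c j \<le> c i" if "i \<le> j" for i j
    using R that by (auto simp: c_def intro!: divide_left_mono)
  have c_lim': "filterlim c (at_right 0) sequentially"
    unfolding filterlim_at using c_lim c by (auto intro!: always_eventually simp: less_imp_neq[OF c(1), symmetric])
  let ?g = "\<lambda>i r. ennreal (f r) * indicator {c i..R} r"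
  let ?G = "\<lambda>r. ennreal (f r) * indicator {0<..R} r"
  have inc: "incseq ?g"
  proof (intro incseq_SucI le_funI)
    fix i r show "?g i r \<le> ?g (Suc i) r"
      using c_mono[of i "Suc i"] by (auto split: split_indicator)
  qed
  have "(SUP i. ?g i r) = ?G r" for r
  proof (rule LIMSEQ_unique[OF LIMSEQ_SUP])
    show "incseq (\<lambda>i. ?g i r)" using inc by (auto simp: incseq_def le_fun_def)
    have "eventually (\<lambda>i. ?g i r = ?G r) sequentially"
    proof (cases "0 < r")
      case True
      have "eventually (\<lambda>i. c i < r) sequentially"
        using order_tendstoD(2)[OF c_lim True] .
      then show ?thesis by eventually_elim (use True in \<open>auto split: split_indicator\<close>)
    next
      case False
      have "\<not> c i \<le> r" for i using False c(1)[of i] by linarith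
      then show ?thesis using False by simp
    qed
    then show "(\<lambda>i. ?g i r) \<longlonglongrightarrow> ?G r" by (rule tendsto_eventually)
  qed
  then have "(\<integral>\<^sup>+r. ?G r \<partial>lborel) = (\<integral>\<^sup>+r. (SUP i. ?g i r) \<partial>lborel)" by simp
  also have "\<dots> = (SUP i. \<integral>\<^sup>+r. ?g i r \<partial>lborel)"
    using inc f_borel by (intro nn_integral_monotone_convergence_SUP) auto
  also have "\<dots> = (SUP i. ennreal (F R - F (c i)))"
  proof (intro SUP_cong refl)
    fix i show "(\<integral>\<^sup>+r. ?g i r \<partial>lborel) = ennreal (F R - F (c i))"
      using c[of i] by (intro nn_integral_FTC_Icc f_borel f nonneg) auto
  qed
  also have "\<dots> = ennreal (F R - L)"
  proof (rule LIMSEQ_unique[OF LIMSEQ_SUP])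
    have mono: "F x \<le> F y" if "0 < x" "x \<le> y" "y \<le> R" for x y
    proof (rule DERIV_nonneg_imp_nondecreasing[of x y F])
      fix z assume "x \<le> z" "z \<le> y"
      then have "0 < z" "z \<le> R" using that by auto
      then show "\<exists>d. (F has_real_derivative d) (at z) \<and> d \<ge> 0" using f nonneg by blast
    qed (use that in auto)
    show "incseq (\<lambda>i. ennreal (F R - F (c i)))"
      using c c_mono mono by (auto simp: incseq_def intro!: ennreal_leI)
    show "(\<lambda>i. ennreal (F R - F (c i))) \<longlonglongrightarrow> ennreal (F R - L)"
      by (intro tendsto_ennrealI tendsto_diff tendsto_const filterlim_compose[OF lim c_lim'])
  qed
  finally show ?thesis .
qed

lemma nn_integral_powr_at_0:
  assumes "0 < R" "e > -1"
  shows "(\<integral>\<^sup>+r. ennreal (r powr e) * indicator {0<..R} r \<partial>lborel) = ennreal (R powr (e + 1) / (e + 1))"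
proof -
  have "(\<integral>\<^sup>+r. ennreal (r powr e) * indicator {0<..R} r \<partial>lborel) = ennreal (R powr (e + 1) / (e + 1) - 0)"
  proof (rule nn_integral_FTC_at_0)
    show "((\<lambda>r. r powr (e + 1) / (e + 1)) has_real_derivative r powr e) (at r)" if "0 < r" for r
      using that assms by (auto intro!: derivative_eq_intros)
    have "((\<lambda>r. r powr (e + 1) / (e + 1)) \<longlongrightarrow> 0 powr (e + 1) / (e + 1)) (at_right 0)"
      using assms by (intro tendsto_intros tendsto_powr2) (auto simp: eventually_at_filter)
    then show "((\<lambda>r. r powr (e + 1) / (e + 1)) \<longlongrightarrow> 0) (at_right 0)" using assms by simp
  qed (use assms in auto)
  then show ?thesis by simp
qed

lemma nn_integral_powr_at_top:
  assumes "0 < R" "e < -1"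
  shows "(\<integral>\<^sup>+r. ennreal (r powr e) * indicator {R..} r \<partial>lborel) = ennreal (R powr (e + 1) / (- e - 1))"
proof -
  have "(\<integral>\<^sup>+r. ennreal (r powr e) * indicator {R..} r \<partial>lborel) = ennreal (0 - R powr (e + 1) / (e + 1))"
  proof (rule nn_integral_FTC_atLeast)
    show "((\<lambda>r. r powr (e + 1) / (e + 1)) has_real_derivative r powr e) (at r)" if "R \<le> r" for r
      using that assms by (auto intro!: derivative_eq_intros)
    have "((\<lambda>r. r powr (e + 1)) \<longlongrightarrow> 0) at_top"
      using assms by (intro tendsto_neg_powr filterlim_ident) auto
    then show "((\<lambda>r. r powr (e + 1) / (e + 1)) \<longlongrightarrow> 0) at_top"
      using tendsto_divide_zero by blast
  qed (use assms in auto)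
  then show ?thesis using assms by (simp add: minus_divide_right)
qed

text \<open>Both measures give \<open>{..r}\<close> the volume of the ball of radius
  \<open>r\<close>, and half-lines form an intersection-stable generator. Polar coordinates for
  radial functions follow at once.\<close>

lemma distr_norm_lborel:
  "distr (lborel :: 'a::euclidean_space measure) borel norm =
     density lborel (\<lambda>r. ennreal (DIM('a) * unit_ball_vol DIM('a) * r ^ (DIM('a) - 1)) * indicator {0<..} r)"
  (is "?M = ?N")
proof (rule measure_eqI_generator_eq)
  show "Int_stable (range (\<lambda>a::real. {..a}))"
    by (auto simp: Int_stable_def)
  show "range (\<lambda>a::real. {..a}) \<subseteq> Pow UNIV" by auto
  show "sets ?M = sigma_sets UNIV (range (\<lambda>a::real. {..a}))" "sets ?N = sigma_sets UNIV (range (\<lambda>a::real. {..a}))"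
    by (simp_all add: borel_eq_atMost)
  show "range (\<lambda>i::nat. {..real i}) \<subseteq> range (\<lambda>a::real. {..a})" by auto
  show "(\<Union>i::nat. {..real i}) = UNIV" using real_arch_simple by auto
  have M: "emeasure ?M {..r} = ennreal (unit_ball_vol DIM('a) * r ^ DIM('a))" if "0 < r" for r
  proof -
    have "norm -` {..r} = cball (0::'a) r" by auto
    then show ?thesis using that by (simp add: emeasure_distr emeasure_cball)
  qed
  have M0: "emeasure ?M {..r} = 0" if "r \<le> 0" for r
  proof -
    have "norm -` {..r} \<subseteq> {0::'a}" using that order_trans[OF norm_ge_zero] by (force dest: order_trans)
    then have "emeasure lborel (norm -` {..r} :: 'a set) \<le> emeasure lborel {0::'a}"
      by (intro emeasure_mono) auto
    then show ?thesis by (simp add: emeasure_distr)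
  qed
  have N: "emeasure ?N {..r} = (\<integral>\<^sup>+x. ennreal (DIM('a) * unit_ball_vol DIM('a) * x ^ (DIM('a) - 1)) * indicator {0<..r} x \<partial>lborel)" for r
    by (subst emeasure_density) (auto intro!: nn_integral_cong split: split_indicator)
  have N1: "emeasure ?N {..r} = ennreal (unit_ball_vol DIM('a) * r ^ DIM('a))" if "0 < r" for r
  proof -
    have "emeasure ?N {..r} = ennreal (unit_ball_vol DIM('a) * r ^ DIM('a) - 0)"
      unfolding N
    proof (rule nn_integral_FTC_at_0[OF that])
      show "((\<lambda>r. unit_ball_vol DIM('a) * r ^ DIM('a)) has_real_derivative
          (real DIM('a) * unit_ball_vol DIM('a) * x ^ (DIM('a) - 1))) (at x)" for x
        by (auto intro!: derivative_eq_intros)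
      have "((\<lambda>r::real. unit_ball_vol DIM('a) * r ^ DIM('a)) \<longlongrightarrow> unit_ball_vol DIM('a) * 0 ^ DIM('a)) (at_right 0)"
        by (intro tendsto_intros)
      then show "((\<lambda>r::real. unit_ball_vol DIM('a) * r ^ DIM('a)) \<longlongrightarrow> 0) (at_right 0)"
        by (simp add: zero_power)
    qed auto
    then show ?thesis by simp
  qed
  show "emeasure ?M X = emeasure ?N X" if "X \<in> range (\<lambda>a::real. {..a})" for X
  proof -
    from that obtain r where X: "X = {..r}" by auto
    show ?thesis
    proof (cases "0 < r")
      case True then show ?thesis by (simp only: X M N1)
    next
      case False then show ?thesis by (simp only: X M0 N not_less) simp
    qed
  qed
  show "emeasure ?M {..real i} \<noteq> \<infinity>" for i
    by (cases "i = 0") (simp_all add: M M0)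
qed

lemma nn_integral_radial:
  assumes [measurable]: "f \<in> borel_measurable borel"
  shows "(\<integral>\<^sup>+(x::'a::euclidean_space). f (norm x) \<partial>lborel) =
     (\<integral>\<^sup>+r. ennreal (DIM('a) * unit_ball_vol DIM('a) * r ^ (DIM('a) - 1)) * indicator {0<..} r * f r \<partial>lborel)"
proof -
  have "(\<integral>\<^sup>+(x::'a). f (norm x) \<partial>lborel) = (\<integral>\<^sup>+r. f r \<partial>distr (lborel :: 'a measure) borel norm)"
    by (simp add: nn_integral_distr)
  also have "\<dots> = (\<integral>\<^sup>+r. ennreal (DIM('a) * unit_ball_vol DIM('a) * r ^ (DIM('a) - 1)) * indicator {0<..} r * f r \<partial>lborel)"
    unfolding distr_norm_lborel by (subst nn_integral_density) auto
  finally show ?thesis .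
qed

text \<open>In polar coordinates the integrand is at most a multiple of (1 + r)^(-2). This is the
  dominating function for the symbol times a polynomial.\<close>

lemma integrable_inverse_power:
  "integrable lborel (\<lambda>x::'a::euclidean_space. 1 / (1 + norm x) ^ (DIM('a) + 1))"
proof (rule integrableI_nonneg)
  let ?c = "DIM('a) * unit_ball_vol DIM('a)"
  have "(\<integral>\<^sup>+(x::'a). ennreal (1 / (1 + norm x) ^ (DIM('a) + 1)) \<partial>lborel) =
     (\<integral>\<^sup>+r. ennreal (?c * r ^ (DIM('a) - 1)) * indicator {0<..} r * ennreal (1 / (1 + r) ^ (DIM('a) + 1)) \<partial>lborel)"
    by (rule nn_integral_radial) auto
  also have "\<dots> \<le> (\<integral>\<^sup>+r. ennreal ?c * (ennreal (inverse ((1 + r)\<^sup>2)) * indicator {0..} r) \<partial>lborel)"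
  proof (intro nn_integral_mono)
    fix r :: real
    show "ennreal (?c * r ^ (DIM('a) - 1)) * indicator {0<..} r * ennreal (1 / (1 + r) ^ (DIM('a) + 1))
      \<le> ennreal ?c * (ennreal (inverse ((1 + r)\<^sup>2)) * indicator {0..} r)"
    proof (cases "r > 0")
      case True
      have "DIM('a) + 1 = (DIM('a) - 1) + 2" by (metis DIM_positive One_nat_def Suc_pred add.commute add_2_eq_Suc' add_Suc_right plus_1_eq_Suc)
      then have e: "(1 + r) ^ (DIM('a) + 1) = (1 + r) ^ (DIM('a) - 1) * (1 + r)\<^sup>2" by (metis power_add)
      have "r ^ (DIM('a) - 1) / (1 + r) ^ (DIM('a) - 1) \<le> 1"
        using True by (simp add: power_mono)
      then have "?c * (r ^ (DIM('a) - 1) / (1 + r) ^ (DIM('a) - 1)) * inverse ((1 + r)\<^sup>2) \<le> ?c * 1 * inverse ((1 + r)\<^sup>2)"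
        by (intro mult_right_mono mult_left_mono) auto
      moreover have "?c * r ^ (DIM('a) - 1) * (1 / (1 + r) ^ (DIM('a) + 1)) = ?c * (r ^ (DIM('a) - 1) / (1 + r) ^ (DIM('a) - 1)) * inverse ((1 + r)\<^sup>2)"
        unfolding e using True by (simp add: divide_inverse)
      ultimately have "ennreal (?c * r ^ (DIM('a) - 1) * (1 / (1 + r) ^ (DIM('a) + 1))) \<le> ennreal (?c * inverse ((1 + r)\<^sup>2))"
        by (intro ennreal_leI) simp
      then show ?thesis using True
        by (simp add: ennreal_mult[symmetric])
    qed auto
  qed
  also have "\<dots> = ennreal ?c * ennreal (0 - (- 1 / (1 + 0)))"
    using tendsto_minus[OF tendsto_inverse_0_at_top[OF filterlim_tendsto_add_at_top[OF tendsto_const[of "1::real"] filterlim_ident]]]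
    by (subst nn_integral_cmult, simp, subst nn_integral_FTC_atLeast[where F="\<lambda>r. - 1 / (1 + r)" and T=0])
       (auto intro!: derivative_eq_intros simp: power2_eq_square divide_inverse)
  also have "\<dots> < \<infinity>" by (simp add: ennreal_mult_less_top)
  finally show "(\<integral>\<^sup>+(x::'a). ennreal (1 / (1 + norm x) ^ (DIM('a) + 1)) \<partial>lborel) < \<infinity>" .
qed auto

lemma exp_powr_le_power:
  fixes \<theta> t :: real
  assumes "\<theta> > 0" "t > 0"
  obtains C where "C > 0" "\<And>r. 0 \<le> r \<Longrightarrow> (1 + r) ^ M * exp (- t * r powr \<theta>) \<le> C"
proof -
  \<comment> \<open>With \<open>u = r powr \<theta> \<ge> 1\<close> this gives
    \<open>r ^ M \<le> u ^ k\<close>, and \<open>u ^ k\<close> is controlled by a single term of the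
    series of \<open>exp (t * u)\<close>.\<close>
  obtain k :: nat where k: "real M / \<theta> \<le> real k" using real_arch_simple by blast
  define C where "C = 2 ^ M * (1 + fact k / t ^ k)"
  have "C > 0" using assms by (auto simp: C_def intro!: mult_pos_pos add_pos_nonneg)
  moreover have "(1 + r) ^ M * exp (- t * r powr \<theta>) \<le> C" if r: "0 \<le> r" for r
  proof (cases "r \<le> 1")
    case True
    have "(1 + r) ^ M * exp (- t * r powr \<theta>) \<le> 2 ^ M * 1"
      using r True assms by (intro mult_mono power_mono) auto
    also have "\<dots> \<le> C" using assms by (simp add: C_def)
    finally show ?thesis .
  next
    case False
    define u where "u = r powr \<theta>"
    have u: "u \<ge> 1" using False assms by (auto simp: u_def intro: ge_one_powr_ge_zero)
    have "r ^ M = r powr (\<theta> * (M / \<theta>))" using False assms by (simp add: powr_realpow)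
    also have "\<dots> = u powr (M / \<theta>)" by (simp add: u_def powr_powr)
    also have "\<dots> \<le> u powr (real k)" using u k by (intro powr_mono) auto
    also have "\<dots> = u ^ k" using u by (simp add: powr_realpow)
    finally have a: "r ^ M \<le> u ^ k" .
    have "(t * u) ^ k / fact k \<le> exp (t * u)"
    proof -
      have "(\<Sum>n\<in>{k}. (t * u) ^ n /\<^sub>R fact n) \<le> (\<Sum>n. (t * u) ^ n /\<^sub>R fact n)"
        using u assms exp_converges[of "t * u"] by (intro sum_le_suminf) (auto simp: sums_iff)
      then show ?thesis
        using exp_converges[of "t * u"] by (simp add: sums_iff divide_inverse mult.commute)
    qed
    then have b: "u ^ k * exp (- t * u) \<le> fact k / t ^ k"
      using assms by (simp add: exp_minus field_simps power_mult_distrib)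
    have "(1 + r) ^ M * exp (- t * r powr \<theta>) \<le> (2 * r) ^ M * exp (- t * u)"
      unfolding u_def using r False by (intro mult_right_mono power_mono) auto
    also have "\<dots> \<le> 2 ^ M * (u ^ k * exp (- t * u))"
      using a by (simp add: power_mult_distrib mult.assoc)
    also have "\<dots> \<le> 2 ^ M * (fact k / t ^ k)"
      using b by (intro mult_left_mono) auto
    also have "\<dots> \<le> C" unfolding C_def by (intro mult_left_mono) auto
    finally show ?thesis .
  qed
  ultimately show ?thesis using that by blast
qed

lemma integrable_exp_powr:
  fixes c :: "'a::euclidean_space \<Rightarrow> 'b::{banach, second_countable_topology}"
  assumes "\<theta> > 0" "t > 0" and [measurable]: "c \<in> borel_measurable borel"
    and c: "\<And>\<xi>. norm (c \<xi>) \<le> A * (1 + norm \<xi>) ^ M"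
  shows "integrable lborel (\<lambda>\<xi>. exp (- t * norm \<xi> powr \<theta>) *\<^sub>R c \<xi>)"
proof -
  obtain C where C: "C > 0" "\<And>r. 0 \<le> r \<Longrightarrow> (1 + r) ^ (M + (DIM('a) + 1)) * exp (- t * r powr \<theta>) \<le> C"
    using exp_powr_le_power[OF assms(1,2)] by blast
  have A: "A \<ge> 0" using order_trans[OF norm_ge_zero c[of 0]] by simp
  show ?thesis
  proof (rule Bochner_Integration.integrable_bound)
    show "integrable lborel (\<lambda>x::'a. A * C * (1 / (1 + norm x) ^ (DIM('a) + 1)))"
      by (intro integrable_mult_right integrable_inverse_power)
    show "AE x in lborel. norm (exp (- t * norm x powr \<theta>) *\<^sub>R c x) \<le> norm (A * C * (1 / (1 + norm x) ^ (DIM('a) + 1)))"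
    proof (intro always_eventually allI)
      fix x :: 'a
      let ?r = "1 + norm x"
      have pos: "?r ^ n > 0" for n by (intro zero_less_power add_pos_nonneg) auto
      have "exp (- t * norm x powr \<theta>) * norm (c x) \<le> exp (- t * norm x powr \<theta>) * (A * ?r ^ M)"
        using c by (intro mult_left_mono) auto
      also have "\<dots> = A * (?r ^ (M + (DIM('a) + 1)) * exp (- t * norm x powr \<theta>)) / ?r ^ (DIM('a) + 1)"
        using pos[of 1] by (simp add: power_add)
      also have "\<dots> \<le> A * C / ?r ^ (DIM('a) + 1)"
        using C(2)[of "norm x"] A pos[of "DIM('a) + 1"] by (intro divide_right_mono mult_left_mono) auto
      finally show "norm (exp (- t * norm x powr \<theta>) *\<^sub>R c x) \<le> norm (A * C * (1 / ?r ^ (DIM('a) + 1)))"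
        using A C(1) by (simp add: abs_mult)
    qed
  qed auto
qed

lemma integrable_pair_bound:
  fixes F :: "'a::euclidean_space \<times> 'b::euclidean_space \<Rightarrow> 'c::{banach, second_countable_topology}"
  assumes [measurable]: "F \<in> borel_measurable borel"
    and g: "integrable lborel g" and h: "integrable lborel h"
    and le: "\<And>x y. norm (F (x, y)) \<le> g x * h y"
  shows "integrable (lborel \<Otimes>\<^sub>M lborel) F"
proof (rule Bochner_Integration.integrable_bound)
  have [measurable]: "g \<in> borel_measurable borel" "h \<in> borel_measurable borel" using g h by auto
  show "integrable (lborel \<Otimes>\<^sub>M lborel) (\<lambda>(x, y). g x * h y)"
    using g h by (intro lborel_pair.Fubini_integrable) (auto simp: abs_mult)
  show "F \<in> borel_measurable (lborel \<Otimes>\<^sub>M lborel)" by (simp add: lborel_prod)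
  show "AE p in lborel \<Otimes>\<^sub>M lborel. norm (F p) \<le> norm (case p of (x, y) \<Rightarrow> g x * h y)"
    using le by (intro always_eventually) (auto intro: order_trans[OF _ abs_ge_self])
qed

section \<open>Bochner subordination\<close>

lemma tendsto_inverse_nat_plus_1: "(\<lambda>n. 1 / (real n + 1)) \<longlonglongrightarrow> 0"
  using LIMSEQ_inverse_real_of_nat by (simp add: inverse_eq_divide add.commute)

text \<open>Fourier integrals below are first computed with a Gaussian factor, in whose presence
  Fubini applies; this removes the factor again.\<close>

lemma gauss_regularization_lim:
  fixes f :: "'a::euclidean_space \<Rightarrow> real"
  assumes f: "integrable lborel f"
  shows "(\<lambda>n. \<integral>x. f x * exp (- (1 / (real n + 1)) * (norm x)\<^sup>2) \<partial>lborel) \<longlonglongrightarrow> (LBINT x. f x)"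
proof (rule integral_dominated_convergence)
  have [measurable]: "f \<in> borel_measurable borel" using f by auto
  show "(\<lambda>x. f x * exp (- (1 / (real n + 1)) * (norm x)\<^sup>2)) \<in> borel_measurable lborel" for n by measurable
  show "integrable lborel (\<lambda>x. \<bar>f x\<bar>)" using f by simp
  show "AE x in lborel. (\<lambda>n. f x * exp (- (1 / (real n + 1)) * (norm x)\<^sup>2)) \<longlonglongrightarrow> f x"
  proof (intro always_eventually allI)
    fix x :: 'a
    have "(\<lambda>n. f x * exp (- (1 / (real n + 1)) * (norm x)\<^sup>2)) \<longlonglongrightarrow> f x * exp (- 0 * (norm x)\<^sup>2)"
      by (intro tendsto_mult tendsto_const tendsto_exp tendsto_minus tendsto_inverse_nat_plus_1)
    then show "(\<lambda>n. f x * exp (- (1 / (real n + 1)) * (norm x)\<^sup>2)) \<longlonglongrightarrow> f x" by simp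
  qed
  show "AE x in lborel. norm (f x * exp (- (1 / (real n + 1)) * (norm x)\<^sup>2)) \<le> \<bar>f x\<bar>" for n
    by (intro always_eventually allI) (simp add: abs_mult mult_left_le)
qed (use f in auto)

text \<open>The Bernstein (Levy-Khintchine) representation of the power. Since
  \<open>1 - exp (- r)\<close> is at most \<open>r\<close> and at most 1, the integral converges at
  both ends for \<open>0 < a < 1\<close>. Substituting \<open>u * r\<close> for \<open>r\<close>
  shows that it is homogeneous of degree \<open>a\<close> in \<open>u\<close>, and \<open>c\<close>
  is its value at \<open>u = 1\<close>.\<close>

lemma bernstein_powr:
  fixes a :: real
  assumes a: "0 < a" "a < 1"
  obtains c where "c > 0"
    "\<And>u. u \<ge> 0 \<Longrightarrow> has_bochner_integral lborel (\<lambda>r. (1 - exp (- u * r)) * (indicator {0<..} r * r powr (- 1 - a))) (c * u powr a)"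
proof -
  define h where "h r = (1 - exp (- r)) * (indicator {0<..} r * r powr (- 1 - a))" for r :: real
  have [measurable]: "h \<in> borel_measurable borel" unfolding h_def by measurable
  have h0: "h r \<ge> 0" for r unfolding h_def by (auto split: split_indicator)
  have le: "ennreal (h r) \<le> ennreal (r powr (- a)) * indicator {0<..1} r + ennreal (r powr (- 1 - a)) * indicator {1..} r" for r
  proof (cases "0 < r")
    case True
    have "1 - exp (- r) \<le> r" using exp_ge_add_one_self[of "-r"] by simp
    then have "(1 - exp (- r)) * r powr (- 1 - a) \<le> r * r powr (- 1 - a)" by (intro mult_right_mono) auto
    also have "r * r powr (- 1 - a) = r powr (1 + (- 1 - a))" using True by (subst powr_mult_base) auto
    finally have 1: "h r \<le> r powr (- a)" using True by (simp add: h_def)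
    have "(1 - exp (- r)) * r powr (- 1 - a) \<le> 1 * r powr (- 1 - a)" by (intro mult_right_mono) auto
    then have 2: "h r \<le> r powr (- 1 - a)" using True by (simp add: h_def)
    show ?thesis
    proof (cases "r \<le> 1")
      case le: True
      have "ennreal (h r) \<le> ennreal (r powr (- a)) * indicator {0<..1} r" using 1 True le by (simp add: ennreal_leI)
      then show ?thesis by (rule order_trans) simp
    next
      case False
      then show ?thesis using 2 True by (simp add: ennreal_leI)
    qed
  qed (simp add: h_def)
  have "(\<integral>\<^sup>+r. ennreal (h r) \<partial>lborel) \<le> (\<integral>\<^sup>+r. ennreal (r powr (- a)) * indicator {0<..1} r + ennreal (r powr (- 1 - a)) * indicator {1..} r \<partial>lborel)"
    by (intro nn_integral_mono le)
  also have "\<dots> = ennreal (1 powr (- a + 1) / (- a + 1)) + ennreal (1 powr (- 1 - a + 1) / (- (- 1 - a) - 1))"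
    using a by (subst nn_integral_add, simp, simp, subst nn_integral_powr_at_0, simp, simp, subst nn_integral_powr_at_top) auto
  also have "\<dots> < \<infinity>" by simp
  finally have hi: "integrable lborel h"
    using h0 by (intro integrableI_nonneg) auto
  define c where "c = (LBINT r. h r)"
  have "c \<ge> 0" unfolding c_def using h0 by simp
  moreover have "c \<noteq> 0"
  proof
    assume "c = 0"
    then have "AE r in lborel. h r = 0"
      using integral_nonneg_eq_0_iff_AE[OF hi] h0 by (simp add: c_def)
    then have "AE r in lborel. r \<notin> {0<..<1::real}"
      by eventually_elim (auto simp: h_def)
    then have "emeasure lborel {0<..<1::real} = 0"
      using AE_iff_null_sets[of "{0<..<1::real}" lborel] by auto
    then show False by simp
  qed
  ultimately have "c > 0" by simp
  moreover have "has_bochner_integral lborel (\<lambda>r. (1 - exp (- u * r)) * (indicator {0<..} r * r powr (- 1 - a))) (c * u powr a)" if "u \<ge> 0" for u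
  proof (cases "u = 0")
    case True
    then show ?thesis by (simp add: has_bochner_integral_zero)
  next
    case False
    then have u: "u > 0" using that by simp
    have "has_bochner_integral lborel (\<lambda>r. h (0 + u * r)) (c /\<^sub>R \<bar>u\<bar>)"
      using hi u by (subst lborel_has_bochner_integral_real_affine_iff[symmetric]) (auto simp: c_def has_bochner_integral_iff)
    then have "has_bochner_integral lborel (\<lambda>r. u powr (1 + a) * h (u * r)) (u powr (1 + a) * (c / u))"
      using u by (intro has_bochner_integral_mult_right) (simp add: divide_inverse mult.commute)
    moreover have "u powr (1 + a) * h (u * r) = (1 - exp (- u * r)) * (indicator {0<..} r * r powr (- 1 - a))" for r
    proof (cases "r > 0")
      case True
      have "u powr (1 + a) * (u * r) powr (- 1 - a) = r powr (- 1 - a)"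
        using u True by (simp add: powr_mult powr_add[symmetric] mult.assoc[symmetric])
      then show ?thesis using True u by (simp add: h_def zero_less_mult_iff)
    qed (use u in \<open>auto simp: h_def zero_less_mult_iff\<close>)
    moreover have "u powr (1 + a) * (c / u) = c * u powr a" using u by (simp add: powr_add)
    ultimately show ?thesis by simp
  qed
  ultimately show ?thesis using that by blast
qed

text \<open>For \<theta> < 2 the symbol is a limit of compound Poisson symbols. Truncating the Levy
  density to \<open>r > 1 / (n + 1)\<close> makes its mass finite, so that
  \<open>exp (- s * (m n 0 - m n u))\<close> is a positive constant times the power series of
  \<open>exp (s * m n u)\<close>, and \<open>m n ((norm \<xi>)\<^sup>2)\<close> is a positive
  mixture of Gaussians. Hence it is enough that products with such mixtures, positive combinations
  and bounded limits preserve the sign.\<close>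

lemma subordination_nonneg:
  fixes k :: "'a::euclidean_space \<Rightarrow> real"
  assumes k[measurable]: "k \<in> borel_measurable borel" and kB: "\<And>\<xi>. \<bar>k \<xi>\<bar> \<le> B"
    and \<theta>: "0 < \<theta>" "\<theta> \<le> 2" and t: "0 < t"
    and pos: "\<And>\<delta>. \<delta> > 0 \<Longrightarrow> 0 \<le> (LBINT \<xi>. k \<xi> * exp (- \<delta> * (norm \<xi>)\<^sup>2))"
  shows "0 \<le> (LBINT \<xi>. k \<xi> * exp (- t * norm \<xi> powr \<theta>))"
proof (cases "\<theta> = 2")
  case True
  then show ?thesis using pos[OF t] by simp
next
  case False
  define a where "a = \<theta> / 2"
  have a: "0 < a" "a < 1" using \<theta> False by (auto simp: a_def)
  obtain c where c: "c > 0"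
    and bern: "\<And>u. u \<ge> 0 \<Longrightarrow> has_bochner_integral lborel (\<lambda>r. (1 - exp (- u * r)) * (indicator {0<..} r * r powr (- 1 - a))) (c * u powr a)"
    using bernstein_powr[OF a] by blast
  \<comment> \<open>The mixture represents \<open>c * u powr a\<close> instead of
    \<open>u powr a\<close>; this factor corrects for \<open>c\<close>.\<close>
  define s where "s = t / c"
  have s: "s > 0" using t c by (simp add: s_def)
  define w where "w n r = indicator {1 / (real n + 1)<..} r * r powr (- 1 - a)" for n :: nat and r :: real
  have wm[measurable]: "w n \<in> borel_measurable borel" for n unfolding w_def by measurable
  have w0: "w n r \<ge> 0" for n r by (simp add: w_def)
  have wneg: "w n r = 0" if "r \<le> 0" for n r
  proof -
    have "1 / (real n + 1) > 0" by simp
    then have "\<not> 1 / (real n + 1) < r" using that by linarith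
    then show ?thesis by (simp add: w_def)
  qed
  have wi: "integrable lborel (w n)" for n
  proof (rule integrableI_nonneg)
    have "(\<integral>\<^sup>+r. ennreal (w n r) \<partial>lborel) \<le> (\<integral>\<^sup>+r. ennreal (r powr (- 1 - a)) * indicator {1 / (real n + 1)..} r \<partial>lborel)"
      by (intro nn_integral_mono) (auto simp: w_def split: split_indicator)
    also have "\<dots> < \<infinity>" using a by (subst nn_integral_powr_at_top) auto
    finally show "(\<integral>\<^sup>+r. ennreal (w n r) \<partial>lborel) < \<infinity>" .
  qed (use w0 in auto)
  define m where "m n u = (LBINT r. exp (- u * r) * w n r)" for n u
  have mi: "integrable lborel (\<lambda>r. exp (- u * r) * w n r)" if "u \<ge> 0" for n u
  proof (rule Bochner_Integration.integrable_bound[OF wi[of n]])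
    show "AE r in lborel. norm (exp (- u * r) * w n r) \<le> norm (w n r)"
    proof (intro always_eventually allI)
      fix r show "norm (exp (- u * r) * w n r) \<le> norm (w n r)"
        using w0[of n r] that wneg[of r n] by (cases "r \<le> 0") (auto intro!: mult_left_le_one_le)
    qed
  qed measurable
  have m0: "m n u \<ge> 0" for n u unfolding m_def using w0 by simp
  have m_le: "m n u \<le> m n 0" if "u \<ge> 0" for n u
    unfolding m_def
  proof (rule integral_mono[OF mi[OF that] mi])
    fix r show "exp (- u * r) * w n r \<le> exp (- 0 * r) * w n r"
      using w0[of n r] that wneg[of r n] by (cases "r \<le> 0") (auto intro!: mult_left_le_one_le)
  qed simp
  have mm[measurable]: "(\<lambda>u. m n u) \<in> borel_measurable borel" for n
    unfolding m_def by measurable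
  have gi: "integrable lborel (\<lambda>\<xi>::'a. exp (- \<delta> * (norm \<xi>)\<^sup>2))" if "\<delta> > 0" for \<delta>
    by (rule gauss_integrable[OF that])
  have B: "B \<ge> 0" using kB[of 0] by simp
  \<comment> \<open>Testing against all \<delta> at once makes the class closed under multiplication
    by Gaussian mixtures, because a factor \<open>exp (- r * (norm \<xi>)\<^sup>2)\<close> only
    turns \<delta> into \<open>\<delta> + r\<close>. The Gaussian also makes the integrals converge
    for merely bounded \<open>f\<close> and \<open>k\<close>.\<close>
  define P where "P f \<longleftrightarrow> f \<in> borel_measurable borel \<and> (\<exists>C. \<forall>\<xi>. \<bar>f \<xi>\<bar> \<le> C) \<and>
     (\<forall>\<delta>>0. 0 \<le> (LBINT \<xi>. k \<xi> * f \<xi> * exp (- \<delta> * (norm \<xi>)\<^sup>2)))" for f :: "'a \<Rightarrow> real"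
  have Pi: "integrable lborel (\<lambda>\<xi>. k \<xi> * f \<xi> * exp (- \<delta> * (norm \<xi>)\<^sup>2))" if f[measurable]: "f \<in> borel_measurable borel"
    and C: "\<And>\<xi>. \<bar>f \<xi>\<bar> \<le> C" and "\<delta> > 0" for f \<delta> C
  proof (rule Bochner_Integration.integrable_bound)
    show "integrable lborel (\<lambda>\<xi>::'a. (B * C) * exp (- \<delta> * (norm \<xi>)\<^sup>2))"
      by (intro integrable_mult_right gi that)
    show "AE \<xi> in lborel. norm (k \<xi> * f \<xi> * exp (- \<delta> * (norm \<xi>)\<^sup>2)) \<le> norm ((B * C) * exp (- \<delta> * (norm \<xi>)\<^sup>2))"
    proof (intro always_eventually allI)
      fix \<xi> :: 'a
      have "\<bar>k \<xi>\<bar> * \<bar>f \<xi>\<bar> \<le> B * C" using kB C B by (intro mult_mono) auto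
      moreover have "B * C \<ge> 0" using B order_trans[OF abs_ge_zero C[of 0]] by simp
      ultimately show "norm (k \<xi> * f \<xi> * exp (- \<delta> * (norm \<xi>)\<^sup>2)) \<le> norm ((B * C) * exp (- \<delta> * (norm \<xi>)\<^sup>2))"
        by (simp add: abs_mult mult_right_mono del: abs_mult_self_eq) (simp add: abs_mult[symmetric])
    qed
  qed measurable
  have P1: "P (\<lambda>_. 1)" using pos by (auto simp: P_def)
  have Pmult: "P (\<lambda>\<xi>. f \<xi> * m n ((norm \<xi>)\<^sup>2))" if "P f" for f n
  proof -
    from that obtain C where f[measurable]: "f \<in> borel_measurable borel" and C: "\<And>\<xi>. \<bar>f \<xi>\<bar> \<le> C"
      and fp: "\<And>\<delta>. \<delta> > 0 \<Longrightarrow> 0 \<le> (LBINT \<xi>. k \<xi> * f \<xi> * exp (- \<delta> * (norm \<xi>)\<^sup>2))"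
      by (auto simp: P_def)
    have C0: "C \<ge> 0" using C[of 0] by simp
    have "\<bar>f \<xi> * m n ((norm \<xi>)\<^sup>2)\<bar> \<le> C * m n 0" for \<xi>
      using C[of \<xi>] C0 m0[of n "(norm \<xi>)\<^sup>2"] m_le[of "(norm \<xi>)\<^sup>2" n] by (auto simp: abs_mult intro!: mult_mono)
    moreover have "0 \<le> (LBINT \<xi>. k \<xi> * (f \<xi> * m n ((norm \<xi>)\<^sup>2)) * exp (- \<delta> * (norm \<xi>)\<^sup>2))" if \<delta>: "\<delta> > 0" for \<delta>
    proof -
      define F where "F \<xi> r = (k \<xi> * f \<xi>) * (exp (- \<delta> * (norm \<xi>)\<^sup>2) * (exp (- (norm \<xi>)\<^sup>2 * r) * w n r))" for \<xi> r
      have [measurable]: "case_prod F \<in> borel_measurable borel"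
        unfolding F_def borel_prod[symmetric] by measurable
      have Fi: "integrable (lborel \<Otimes>\<^sub>M lborel) (case_prod F)"
      proof (rule integrable_pair_bound)
        show "integrable lborel (\<lambda>\<xi>::'a. (B * C) * exp (- \<delta> * (norm \<xi>)\<^sup>2))"
          by (intro integrable_mult_right gi \<delta>)
        show "norm (case (x, y) of (x, xa) \<Rightarrow> F x xa) \<le> (B * C) * exp (- \<delta> * (norm x)\<^sup>2) * w n y" for x y
        proof -
          have 1: "exp (- (norm x)\<^sup>2 * y) * w n y \<le> w n y"
            using w0[of n y] wneg[of y n] by (cases "y \<le> 0") (auto intro!: mult_left_le_one_le)
          have "\<bar>k x * f x\<bar> \<le> B * C" unfolding abs_mult using kB C B by (intro mult_mono) auto
          then have "\<bar>k x * f x\<bar> * (exp (- \<delta> * (norm x)\<^sup>2) * (exp (- (norm x)\<^sup>2 * y) * w n y))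
            \<le> (B * C) * (exp (- \<delta> * (norm x)\<^sup>2) * w n y)"
            using 1 w0[of n y] B C0 by (intro mult_mono mult_left_mono) auto
          then show ?thesis using w0[of n y] by (simp add: F_def abs_mult mult.assoc)
        qed
      qed (use wi in simp_all)
      have "(LBINT \<xi>. k \<xi> * (f \<xi> * m n ((norm \<xi>)\<^sup>2)) * exp (- \<delta> * (norm \<xi>)\<^sup>2)) = (LBINT \<xi>. (LBINT r. F \<xi> r))"
        unfolding F_def m_def by (intro Bochner_Integration.integral_cong refl) (simp only: integral_mult_right_zero, simp only: mult_ac)
      also have "\<dots> = (LBINT r. (LBINT \<xi>. F \<xi> r))"
        by (rule lborel_pair.Fubini_integral[OF Fi, symmetric])
      also have "\<dots> \<ge> 0"
      proof (rule integral_nonneg_AE, intro always_eventually allI)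
        fix r
        have "(LBINT \<xi>. F \<xi> r) = w n r * (LBINT \<xi>. k \<xi> * f \<xi> * exp (- (\<delta> + r) * (norm \<xi>)\<^sup>2))"
          unfolding F_def integral_mult_right_zero[symmetric]
          by (intro Bochner_Integration.integral_cong refl) (simp add: exp_add[symmetric] algebra_simps)
        then show "(LBINT \<xi>. F \<xi> r) \<ge> 0"
          using fp[of "\<delta> + r"] w0[of n r] wneg[of r n] \<delta> by (cases "r \<le> 0") auto
      qed
      finally show ?thesis .
    qed
    ultimately show ?thesis unfolding P_def by auto
  qed
  have Padd: "P (\<lambda>\<xi>. f \<xi> + g \<xi>)" if "P f" "P g" for f g
  proof -
    from that obtain C D where f[measurable]: "f \<in> borel_measurable borel" and C: "\<And>\<xi>. \<bar>f \<xi>\<bar> \<le> C"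
      and fp: "\<And>\<delta>. \<delta> > 0 \<Longrightarrow> 0 \<le> (LBINT \<xi>. k \<xi> * f \<xi> * exp (- \<delta> * (norm \<xi>)\<^sup>2))"
      and g[measurable]: "g \<in> borel_measurable borel" and D: "\<And>\<xi>. \<bar>g \<xi>\<bar> \<le> D"
      and gp: "\<And>\<delta>. \<delta> > 0 \<Longrightarrow> 0 \<le> (LBINT \<xi>. k \<xi> * g \<xi> * exp (- \<delta> * (norm \<xi>)\<^sup>2))"
      by (auto simp: P_def)
    have "\<bar>f \<xi> + g \<xi>\<bar> \<le> C + D" for \<xi> using C[of \<xi>] D[of \<xi>] by linarith
    moreover have "0 \<le> (LBINT \<xi>. k \<xi> * (f \<xi> + g \<xi>) * exp (- \<delta> * (norm \<xi>)\<^sup>2))" if \<delta>: "\<delta> > 0" for \<delta>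
      using Bochner_Integration.integral_add[OF Pi[OF f C \<delta>] Pi[OF g D \<delta>]] fp[OF \<delta>] gp[OF \<delta>]
      by (simp add: algebra_simps)
    ultimately show ?thesis unfolding P_def by auto
  qed
  have Pscale: "P (\<lambda>\<xi>. b * f \<xi>)" if "P f" "b \<ge> 0" for f b
  proof -
    from that obtain C where f[measurable]: "f \<in> borel_measurable borel" and C: "\<And>\<xi>. \<bar>f \<xi>\<bar> \<le> C"
      and fp: "\<And>\<delta>. \<delta> > 0 \<Longrightarrow> 0 \<le> (LBINT \<xi>. k \<xi> * f \<xi> * exp (- \<delta> * (norm \<xi>)\<^sup>2))"
      by (auto simp: P_def)
    have "\<bar>b * f \<xi>\<bar> \<le> b * C" for \<xi> using C[of \<xi>] that by (simp add: abs_mult mult_left_mono)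
    moreover have "0 \<le> (LBINT \<xi>. k \<xi> * (b * f \<xi>) * exp (- \<delta> * (norm \<xi>)\<^sup>2))" if \<delta>: "\<delta> > 0" for \<delta>
    proof -
      have "(LBINT \<xi>. k \<xi> * (b * f \<xi>) * exp (- \<delta> * (norm \<xi>)\<^sup>2)) = b * (LBINT \<xi>. k \<xi> * f \<xi> * exp (- \<delta> * (norm \<xi>)\<^sup>2))"
        unfolding integral_mult_right_zero[symmetric] by (intro Bochner_Integration.integral_cong refl) (simp add: mult_ac)
      then show ?thesis using fp[OF \<delta>] \<open>b \<ge> 0\<close> by simp
    qed
    ultimately show ?thesis unfolding P_def by auto
  qed
  have Plim: "P f" if PF: "\<And>j::nat. P (F j)" and C: "\<And>j \<xi>. \<bar>F j \<xi>\<bar> \<le> C" and lim: "\<And>\<xi>. (\<lambda>j. F j \<xi>) \<longlonglongrightarrow> f \<xi>" for F f C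
  proof -
    have F[measurable]: "F j \<in> borel_measurable borel" for j using PF by (simp add: P_def)
    have f[measurable]: "f \<in> borel_measurable borel" using lim F by (rule borel_measurable_LIMSEQ_real)
    have fC: "\<bar>f \<xi>\<bar> \<le> C" for \<xi>
      using C lim by (intro tendsto_upperbound[OF tendsto_rabs[OF lim]]) auto
    moreover have "0 \<le> (LBINT \<xi>. k \<xi> * f \<xi> * exp (- \<delta> * (norm \<xi>)\<^sup>2))" if \<delta>: "\<delta> > 0" for \<delta>
    proof (rule tendsto_lowerbound)
      show "(\<lambda>j. \<integral>\<xi>. k \<xi> * F j \<xi> * exp (- \<delta> * (norm \<xi>)\<^sup>2) \<partial>lborel) \<longlonglongrightarrow> (LBINT \<xi>. k \<xi> * f \<xi> * exp (- \<delta> * (norm \<xi>)\<^sup>2))"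
      proof (rule integral_dominated_convergence)
        show "integrable lborel (\<lambda>\<xi>::'a. (B * C) * exp (- \<delta> * (norm \<xi>)\<^sup>2))"
          by (intro integrable_mult_right gi \<delta>)
        show "AE \<xi> in lborel. (\<lambda>j. k \<xi> * F j \<xi> * exp (- \<delta> * (norm \<xi>)\<^sup>2)) \<longlonglongrightarrow> k \<xi> * f \<xi> * exp (- \<delta> * (norm \<xi>)\<^sup>2)"
          by (intro always_eventually allI tendsto_intros lim)
        show "AE \<xi> in lborel. norm (k \<xi> * F j \<xi> * exp (- \<delta> * (norm \<xi>)\<^sup>2)) \<le> (B * C) * exp (- \<delta> * (norm \<xi>)\<^sup>2)" for j
        proof (intro always_eventually allI)
          fix \<xi> :: 'a
          have "\<bar>k \<xi>\<bar> * \<bar>F j \<xi>\<bar> \<le> B * C" using kB C B by (intro mult_mono) auto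
          then show "norm (k \<xi> * F j \<xi> * exp (- \<delta> * (norm \<xi>)\<^sup>2)) \<le> (B * C) * exp (- \<delta> * (norm \<xi>)\<^sup>2)"
            by (simp add: abs_mult mult_right_mono)
        qed
      qed measurable
      show "\<forall>\<^sub>F j in sequentially. 0 \<le> (LBINT \<xi>. k \<xi> * F j \<xi> * exp (- \<delta> * (norm \<xi>)\<^sup>2))"
        using PF \<delta> by (auto simp: P_def)
    qed simp
    ultimately show ?thesis using f unfolding P_def by auto
  qed
  have Ppow: "P (\<lambda>\<xi>. (s * m n ((norm \<xi>)\<^sup>2)) ^ j)" for n j
  proof (induction j)
    case 0 show ?case using P1 by simp
  next
    case (Suc j)
    from Pscale[OF Pmult[OF Suc, of n], of s] s show ?case by (simp add: mult_ac)
  qed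
  have Psum: "P (\<lambda>\<xi>. \<Sum>j\<le>J. (s * m n ((norm \<xi>)\<^sup>2)) ^ j /\<^sub>R fact j)" for n J
  proof (induction J)
    case 0
    from P1 show ?case by simp
  next
    case (Suc J)
    have "P (\<lambda>\<xi>. (s * m n ((norm \<xi>)\<^sup>2)) ^ Suc J /\<^sub>R fact (Suc J))"
      using Pscale[OF Ppow[of n "Suc J"], of "inverse (fact (Suc J))"] by simp
    from Padd[OF Suc this] show ?case by simp
  qed
  have Pexp: "P (\<lambda>\<xi>. exp (s * m n ((norm \<xi>)\<^sup>2)))" for n
  proof (rule Plim[OF Psum])
    fix \<xi> :: 'a
    let ?z = "s * m n ((norm \<xi>)\<^sup>2)"
    have z0: "?z \<ge> 0" using s m0 by simp
    have sums: "(\<lambda>j. ?z ^ j /\<^sub>R fact j) sums exp ?z" by (rule exp_converges)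
    show "(\<lambda>J. \<Sum>j\<le>J. ?z ^ j /\<^sub>R fact j) \<longlonglongrightarrow> exp ?z"
      using sums by (simp add: sums_def_le)
    fix J
    have "0 \<le> (\<Sum>j\<le>J. ?z ^ j /\<^sub>R fact j)" using z0 by (intro sum_nonneg) auto
    moreover have "(\<Sum>j\<le>J. ?z ^ j /\<^sub>R fact j) \<le> exp ?z"
      using sums z0 by (subst sums_unique[OF sums], intro sum_le_suminf) (auto simp: sums_iff)
    moreover have "exp ?z \<le> exp (s * m n 0)" using s m_le[of "(norm \<xi>)\<^sup>2" n] by simp
    ultimately show "\<bar>\<Sum>j\<le>J. ?z ^ j /\<^sub>R fact j\<bar> \<le> exp (s * m n 0)" by linarith
  qed
  have Pexp': "P (\<lambda>\<xi>. exp (- s * (m n 0 - m n ((norm \<xi>)\<^sup>2))))" for n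
    using Pscale[OF Pexp[of n], of "exp (- s * m n 0)"] by (simp add: exp_add[symmetric] algebra_simps)
  have mlim: "(\<lambda>n. m n 0 - m n u) \<longlonglongrightarrow> c * u powr a" if u: "u \<ge> 0" for u
  proof -
    let ?h = "\<lambda>r. (1 - exp (- u * r)) * (indicator {0<..} r * r powr (- 1 - a))"
    have hi: "integrable lborel ?h" and hv: "integral\<^sup>L lborel ?h = c * u powr a"
      using bern[OF u] by (auto simp: has_bochner_integral_iff)
    have "m n 0 - m n u = (LBINT r. (1 - exp (- u * r)) * w n r)" for n
      unfolding m_def by (subst Bochner_Integration.integral_diff[OF mi mi[OF u], symmetric]) (auto simp: algebra_simps)
    moreover have "(\<lambda>n. \<integral>r. (1 - exp (- u * r)) * w n r \<partial>lborel) \<longlonglongrightarrow> integral\<^sup>L lborel ?h"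
    proof (rule integral_dominated_convergence[OF _ _ hi])
      show "AE r in lborel. (\<lambda>n. (1 - exp (- u * r)) * w n r) \<longlonglongrightarrow> ?h r"
      proof (intro always_eventually allI)
        fix r :: real
        show "(\<lambda>n. (1 - exp (- u * r)) * w n r) \<longlonglongrightarrow> ?h r"
        proof (cases "0 < r")
          case True
          from tendsto_inverse_nat_plus_1 have "\<forall>\<^sub>F n in sequentially. 1 / (real n + 1) < r" using True by (rule order_tendstoD(2))
          then have "\<forall>\<^sub>F n in sequentially. (1 - exp (- u * r)) * w n r = ?h r"
            by eventually_elim (use True in \<open>simp add: w_def\<close>)
          then show ?thesis by (rule tendsto_eventually)
        qed (simp add: wneg)
      qed
      show "AE r in lborel. norm ((1 - exp (- u * r)) * w n r) \<le> ?h r" for n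
      proof (intro always_eventually allI)
        fix r :: real
        show "norm ((1 - exp (- u * r)) * w n r) \<le> ?h r"
        proof (cases "0 < r")
          case True
          then have "1 - exp (- u * r) \<ge> 0" using u by simp
          then show ?thesis using True by (auto simp: w_def abs_mult split: split_indicator)
        qed (simp add: wneg)
      qed
    qed measurable
    ultimately show ?thesis by (simp only: hv)
  qed
  have Pfin: "P (\<lambda>\<xi>. exp (- t * norm \<xi> powr \<theta>))"
  proof (rule Plim[OF Pexp'])
    show "\<bar>exp (- s * (m n 0 - m n ((norm \<xi>)\<^sup>2)))\<bar> \<le> 1" for n \<xi>
      using s m_le[of "(norm \<xi>)\<^sup>2" n] by simp
    fix \<xi> :: 'a
    have "((norm \<xi>)\<^sup>2) powr a = norm \<xi> powr \<theta>"
      by (simp add: a_def powr_powr flip: powr_numeral)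
    then have "- t * norm \<xi> powr \<theta> = - s * (c * ((norm \<xi>)\<^sup>2) powr a)"
      using c by (simp add: s_def)
    then show "(\<lambda>n. exp (- s * (m n 0 - m n ((norm \<xi>)\<^sup>2)))) \<longlonglongrightarrow> exp (- t * norm \<xi> powr \<theta>)"
      by (auto intro!: tendsto_intros mlim)
  qed
  \<comment> \<open>\<open>P\<close> yields the sign only in the presence of a Gaussian, whose
    exponent now tends to 0.\<close>
  show ?thesis
  proof (rule tendsto_lowerbound)
    show "(\<lambda>n. \<integral>\<xi>. k \<xi> * exp (- t * norm \<xi> powr \<theta>) * exp (- (1 / (real n + 1)) * (norm \<xi>)\<^sup>2) \<partial>lborel)
       \<longlonglongrightarrow> (LBINT \<xi>. k \<xi> * exp (- t * norm \<xi> powr \<theta>))"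
    proof (rule gauss_regularization_lim, rule Bochner_Integration.integrable_bound)
      show "integrable lborel (\<lambda>\<xi>::'a. B * exp (- t * norm \<xi> powr \<theta>))"
        using integrable_exp_powr[OF \<theta>(1) t, of "\<lambda>_::'a. B" B 0] B by (simp add: mult.commute)
      show "AE \<xi> in lborel. norm (k \<xi> * exp (- t * norm \<xi> powr \<theta>)) \<le> norm (B * exp (- t * norm \<xi> powr \<theta>))"
        using kB B by (intro always_eventually allI) (simp add: abs_mult)
    qed measurable
    have nn: "0 \<le> (LBINT \<xi>. k \<xi> * exp (- t * norm \<xi> powr \<theta>) * exp (- \<delta> * (norm \<xi>)\<^sup>2))" if "\<delta> > 0" for \<delta>
      using Pfin that unfolding P_def by blast
    show "\<forall>\<^sub>F n in sequentially. 0 \<le> (LBINT \<xi>. k \<xi> * exp (- t * norm \<xi> powr \<theta>) * exp (- (1 / (real n + 1)) * (norm \<xi>)\<^sup>2))"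
      by (intro always_eventually allI nn) (simp add: add_pos_nonneg)
  qed simp
qed

section \<open>The stable density\<close>

definition gauss_kernel :: "real \<Rightarrow> 'a::euclidean_space \<Rightarrow> real" where
  "gauss_kernel \<delta> z = (4 * pi * \<delta>) powr (- real DIM('a) / 2) * exp (- (norm z)\<^sup>2 / (4 * \<delta>))"

lemma gauss_kernel_measurable [measurable]: "gauss_kernel \<delta> \<in> borel_measurable borel"
  unfolding gauss_kernel_def by measurable

lemma gauss_kernel_nonneg: "gauss_kernel \<delta> z \<ge> 0"
  by (simp add: gauss_kernel_def)

lemma gauss_kernel_pos: "\<delta> > 0 \<Longrightarrow> gauss_kernel \<delta> z > 0"
  by (simp add: gauss_kernel_def)

lemma has_bochner_integral_gauss_kernel:
  assumes "\<delta> > 0"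
  shows "has_bochner_integral lborel (gauss_kernel \<delta> :: 'a::euclidean_space \<Rightarrow> real) 1"
proof -
  have "has_bochner_integral lborel (\<lambda>\<xi>::'a. (4 * pi * \<delta>) powr (- real DIM('a) / 2) * (cos (0 \<bullet> \<xi>) * exp (- (1 / (4 * \<delta>)) * (norm \<xi>)\<^sup>2)))
    ((4 * pi * \<delta>) powr (- real DIM('a) / 2) * ((pi / (1 / (4 * \<delta>))) powr (DIM('a) / 2) * exp (- (norm (0::'a))\<^sup>2 / (4 * (1 / (4 * \<delta>))))))"
    using assms by (intro has_bochner_integral_mult_right gauss_cos) auto
  moreover have "(4 * pi * \<delta>) powr (- real DIM('a) / 2) * (pi * (4 * \<delta>)) powr (DIM('a) / 2) = 1"
  proof -
    have "pi * (4 * \<delta>) = 4 * pi * \<delta>" "4 * pi * \<delta> > 0" using assms by simp_all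
    then show ?thesis using assms by (simp only: powr_add[symmetric]) simp
  qed
  ultimately show ?thesis by (simp add: gauss_kernel_def[abs_def])
qed

lemma gauss_kernel_fourier:
  assumes "\<delta> > 0"
  shows "has_bochner_integral lborel (\<lambda>\<xi>. 1 / (2 * pi) ^ DIM('a) * (cos (z \<bullet> \<xi>) * exp (- \<delta> * (norm \<xi>)\<^sup>2))) (gauss_kernel \<delta> (z::'a::euclidean_space))"
proof -
  have "(2 * pi) ^ n = ((2 * pi)\<^sup>2) powr (n / 2)" for n
  proof -
    have "((2 * pi)\<^sup>2) powr (n / 2) = ((2 * pi) powr 2) powr (n / 2)" by (subst powr_numeral) auto
    also have "\<dots> = (2 * pi) powr n" by (simp only: powr_powr) simp
    also have "\<dots> = (2 * pi) ^ n" by (rule powr_realpow) simp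
    finally show ?thesis by simp
  qed
  then have "1 / (2 * pi) ^ DIM('a) * (pi / \<delta>) powr (DIM('a) / 2) = (pi / \<delta> / ((2 * pi)\<^sup>2)) powr (DIM('a) / 2)"
    using assms by (simp add: powr_divide powr_mult)
  also have "pi / \<delta> / ((2 * pi)\<^sup>2) = inverse (4 * pi * \<delta>)"
    using assms by (simp add: field_simps power2_eq_square)
  also have "inverse (4 * pi * \<delta>) powr (DIM('a) / 2) = (4 * pi * \<delta>) powr (- real DIM('a) / 2)"
  proof -
    have "inverse z powr e = z powr - e" if "z > 0" for z e :: real
      using that by (simp add: powr_minus inverse_powr)
    from this[of "4 * pi * \<delta>" "DIM('a) / 2"] show ?thesis using assms by simp
  qed
  finally have "1 / (2 * pi) ^ DIM('a) * ((pi / \<delta>) powr (DIM('a) / 2) * exp (- (norm z)\<^sup>2 / (4 * \<delta>))) = gauss_kernel \<delta> z"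
    by (simp add: gauss_kernel_def flip: mult.assoc)
  then show ?thesis
    using has_bochner_integral_mult_right[OF gauss_cos[OF assms, of z], of "1 / (2 * pi) ^ DIM('a)"] by simp
qed

lemma gauss_kernel_approx_identity_eq:
  fixes f :: "'a::euclidean_space \<Rightarrow> real"
  assumes [measurable]: "f \<in> borel_measurable borel" and \<delta>: "\<delta> > 0"
  shows "(LBINT y. gauss_kernel \<delta> (y - x) * f y) = (LBINT w. gauss_kernel 1 w * f (x + sqrt \<delta> *\<^sub>R w))"
proof -
  have "sqrt \<delta> ^ DIM('a) * gauss_kernel \<delta> (sqrt \<delta> *\<^sub>R w) = gauss_kernel 1 w" for w :: 'a
  proof -
    have "sqrt \<delta> ^ DIM('a) = \<delta> powr (DIM('a) / 2)"
    proof -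
      have "sqrt \<delta> ^ n = (\<delta> powr (1/2)) powr real n" for n
        using \<delta> by (subst powr_realpow) (simp_all add: powr_half_sqrt)
      then show ?thesis by (simp add: powr_powr)
    qed
    moreover have "(4 * pi * \<delta>) powr (- real DIM('a) / 2) = (4 * pi) powr (- real DIM('a) / 2) * \<delta> powr (- real DIM('a) / 2)"
      using \<delta> by (simp add: powr_mult)
    moreover have "(norm (sqrt \<delta> *\<^sub>R w))\<^sup>2 / (4 * \<delta>) = (norm w)\<^sup>2 / 4" using \<delta> by (simp add: power_mult_distrib)
    ultimately have "sqrt \<delta> ^ DIM('a) * gauss_kernel \<delta> (sqrt \<delta> *\<^sub>R w) = (\<delta> powr (DIM('a) / 2) * \<delta> powr (- real DIM('a) / 2)) * ((4 * pi) powr (- real DIM('a) / 2) * exp (- ((norm w)\<^sup>2 / 4)))"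
      unfolding gauss_kernel_def minus_divide_left[symmetric] by (simp only: mult_ac)
    moreover have "\<delta> powr (DIM('a) / 2) * \<delta> powr (- real DIM('a) / 2) = 1"
      using \<delta> by (simp flip: powr_add)
    ultimately show ?thesis by (simp add: gauss_kernel_def)
  qed
  then have eq: "sqrt \<delta> ^ DIM('a) * (gauss_kernel \<delta> (sqrt \<delta> *\<^sub>R w) * g) = gauss_kernel 1 w * g" for w :: 'a and g :: real
    by (simp flip: mult.assoc)
  have "(LBINT y. gauss_kernel \<delta> (y - x) * f y) =
     (\<bar>sqrt \<delta>\<bar> ^ DIM('a)) *\<^sub>R (LBINT w. gauss_kernel \<delta> (x + sqrt \<delta> *\<^sub>R w - x) * f (x + sqrt \<delta> *\<^sub>R w))"
    using \<delta> by (intro integral_lborel_affine) auto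
  also have "\<dots> = (LBINT w. sqrt \<delta> ^ DIM('a) * (gauss_kernel \<delta> (sqrt \<delta> *\<^sub>R w) * f (x + sqrt \<delta> *\<^sub>R w)))"
    using \<delta> by (simp flip: integral_mult_right_zero)
  finally show ?thesis by (simp only: eq)
qed

text \<open>The scaled form moves \<delta> into the argument of \<open>f\<close> and leaves a fixed
  weight of mass 1, so boundedness of \<open>f\<close> suffices for dominated convergence.\<close>

lemma gauss_kernel_approx_identity:
  fixes f :: "'a::euclidean_space \<Rightarrow> real"
  assumes f[measurable]: "f \<in> borel_measurable borel" and B: "\<And>y. \<bar>f y\<bar> \<le> B" and cont: "isCont f x"
  shows "(\<lambda>n. \<integral>y. gauss_kernel (1 / (real n + 1)) (y - x) * f y \<partial>lborel) \<longlonglongrightarrow> f x"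
proof -
  have hb: "has_bochner_integral lborel (gauss_kernel 1 :: 'a \<Rightarrow> real) 1"
    by (rule has_bochner_integral_gauss_kernel) simp
  have B0: "B \<ge> 0" using B[of 0] by simp
  have "(\<lambda>n. \<integral>w. gauss_kernel 1 w * f (x + sqrt (1 / (real n + 1)) *\<^sub>R w) \<partial>lborel) \<longlonglongrightarrow> (LBINT (w::'a). gauss_kernel 1 w * f x)"
  proof (rule integral_dominated_convergence)
    show "integrable lborel (\<lambda>w::'a. gauss_kernel 1 w * B)"
      using hb by (auto simp: has_bochner_integral_iff)
    show "AE w in lborel. (\<lambda>n. gauss_kernel 1 w * f (x + sqrt (1 / (real n + 1)) *\<^sub>R w)) \<longlonglongrightarrow> gauss_kernel 1 w * f x"
    proof (intro always_eventually allI)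
      fix w :: 'a
      from tendsto_inverse_nat_plus_1 have "(\<lambda>n. x + sqrt (1 / (real n + 1)) *\<^sub>R w) \<longlonglongrightarrow> x + sqrt 0 *\<^sub>R w"
        by (intro tendsto_intros)
      then have "(\<lambda>n. f (x + sqrt (1 / (real n + 1)) *\<^sub>R w)) \<longlonglongrightarrow> f x"
        using isCont_tendsto_compose[OF cont] by simp
      then show "(\<lambda>n. gauss_kernel 1 w * f (x + sqrt (1 / (real n + 1)) *\<^sub>R w)) \<longlonglongrightarrow> gauss_kernel 1 w * f x"
        by (intro tendsto_intros)
    qed
    show "AE w in lborel. norm (gauss_kernel 1 w * f (x + sqrt (1 / (real n + 1)) *\<^sub>R w)) \<le> gauss_kernel 1 w * B" for n
      using B by (intro always_eventually allI) (auto simp: abs_mult gauss_kernel_nonneg intro!: mult_left_mono)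
  qed measurable
  then show ?thesis
    using hb by (simp add: has_bochner_integral_iff gauss_kernel_approx_identity_eq)
qed

text \<open>The inverse Fourier integral of the symbol, which is even, so that only the cosine
  remains. The value 0 at nonpositive times makes the kernel Borel on all of space-time.\<close>

definition stable_density :: "real \<Rightarrow> 'a::euclidean_space \<Rightarrow> real \<Rightarrow> real" where
  "stable_density \<theta> x t =
     (if 0 < t then (LBINT \<xi>. 1 / (2 * pi) ^ DIM('a) * (cos (x \<bullet> \<xi>) * exp (- t * norm \<xi> powr \<theta>))) else 0)"

lemma stable_symbol_integrable:
  assumes "0 < \<theta>" "0 < t"
  shows "integrable lborel (\<lambda>\<xi>::'a::euclidean_space. exp (- t * norm \<xi> powr \<theta>))"
  using integrable_exp_powr[OF assms, of "\<lambda>_::'a. 1::real" 1 0] by simp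

lemma stable_cos_integrable:
  assumes "0 < \<theta>" "0 < t"
  shows "integrable lborel (\<lambda>\<xi>. cos (x \<bullet> \<xi>) * exp (- t * norm \<xi> powr \<theta>))"
  by (rule Bochner_Integration.integrable_bound[OF stable_symbol_integrable[OF assms]])
     (auto simp: abs_mult mult_left_le_one_le)

lemma stable_density_nonneg:
  assumes "0 < \<theta>" "\<theta> \<le> 2"
  shows "0 \<le> stable_density \<theta> (x::'a::euclidean_space) t"
proof (cases "0 < t")
  case True
  have "0 \<le> (LBINT \<xi>. cos (x \<bullet> \<xi>) * exp (- t * norm \<xi> powr \<theta>))"
  proof (rule subordination_nonneg[where B=1])
    show "0 \<le> (LBINT \<xi>. cos (x \<bullet> \<xi>) * exp (- \<delta> * (norm \<xi>)\<^sup>2))" if "0 < \<delta>" for \<delta>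
      using gauss_cos[OF that, of x] by (simp add: has_bochner_integral_iff)
  qed (use assms True in auto)
  then show ?thesis by (simp add: stable_density_def)
qed (simp add: stable_density_def)

text \<open>Subordination with
  \<open>k \<xi> = cos (x \<bullet> \<xi>) - cos (y \<bullet> \<xi>)\<close>: integrated against a
  Gaussian it becomes a difference of two Gaussian values, and Gaussians decrease radially. In
  particular the density is radial and bounded by its value at 0.\<close>

lemma stable_density_antimono:
  fixes x y :: "'a::euclidean_space"
  assumes "0 < \<theta>" "\<theta> \<le> 2" and le: "norm x \<le> norm y"
  shows "stable_density \<theta> y t \<le> stable_density \<theta> x t"
proof (cases "0 < t")
  case True
  have "0 \<le> (LBINT \<xi>. (cos (x \<bullet> \<xi>) - cos (y \<bullet> \<xi>)) * exp (- t * norm \<xi> powr \<theta>))"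
  proof (rule subordination_nonneg[where B=2])
    show "\<bar>cos (x \<bullet> \<xi>) - cos (y \<bullet> \<xi>)\<bar> \<le> 2" for \<xi>
      using abs_cos_le_one[of "x \<bullet> \<xi>"] abs_cos_le_one[of "y \<bullet> \<xi>"] by linarith
    show "0 \<le> (LBINT \<xi>. (cos (x \<bullet> \<xi>) - cos (y \<bullet> \<xi>)) * exp (- \<delta> * (norm \<xi>)\<^sup>2))" if \<delta>: "0 < \<delta>" for \<delta>
    proof -
      have "has_bochner_integral lborel (\<lambda>\<xi>. (cos (x \<bullet> \<xi>) - cos (y \<bullet> \<xi>)) * exp (- \<delta> * (norm \<xi>)\<^sup>2))
        ((pi / \<delta>) powr (DIM('a) / 2) * exp (- (norm x)\<^sup>2 / (4 * \<delta>)) - (pi / \<delta>) powr (DIM('a) / 2) * exp (- (norm y)\<^sup>2 / (4 * \<delta>)))"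
        unfolding left_diff_distrib by (intro has_bochner_integral_diff gauss_cos \<delta>)
      moreover have "(norm x)\<^sup>2 / (4 * \<delta>) \<le> (norm y)\<^sup>2 / (4 * \<delta>)"
        using le \<delta> by (intro divide_right_mono power_mono) auto
      ultimately show ?thesis by (simp add: has_bochner_integral_iff mult_left_mono)
    qed
  qed (use assms True in auto)
  then have "(LBINT \<xi>. cos (y \<bullet> \<xi>) * exp (- t * norm \<xi> powr \<theta>)) \<le> (LBINT \<xi>. cos (x \<bullet> \<xi>) * exp (- t * norm \<xi> powr \<theta>))"
    using Bochner_Integration.integral_diff[OF stable_cos_integrable[OF assms(1) True, of x] stable_cos_integrable[OF assms(1) True, of y]]
    by (simp only: left_diff_distrib)
  then show ?thesis using True by (simp add: stable_density_def divide_right_mono)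
qed (simp add: stable_density_def)

section \<open>Fourier inversion: uniqueness of the kernel, mass and transform of the stable
  density\<close>

lemma fourier_symbol_smoothing:
  fixes G :: "'a::euclidean_space \<Rightarrow> real"
  assumes G: "integrable lborel G"
    and C: "\<And>\<xi>. (LBINT y. G y * cos (y \<bullet> \<xi>)) = h \<xi>"
    and S: "\<And>\<xi>. (LBINT y. G y * sin (y \<bullet> \<xi>)) = 0"
    and \<delta>: "\<delta> > 0"
  shows "(LBINT y. gauss_kernel \<delta> (y - x) * G y) = (LBINT \<xi>. 1 / (2 * pi) ^ DIM('a) * (cos (x \<bullet> \<xi>) * h \<xi> * exp (- \<delta> * (norm \<xi>)\<^sup>2)))"
proof -
  have [measurable]: "G \<in> borel_measurable borel" using G by auto
  let ?c = "1 / (2 * pi) ^ DIM('a)"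
  define F where "F y \<xi> = G y * (?c * (cos ((y - x) \<bullet> \<xi>) * exp (- \<delta> * (norm \<xi>)\<^sup>2)))" for y \<xi>
  have [measurable]: "case_prod F \<in> borel_measurable borel"
    unfolding F_def borel_prod[symmetric] by measurable
  have Fi: "integrable (lborel \<Otimes>\<^sub>M lborel) (case_prod F)"
  proof (rule integrable_pair_bound[where g="\<lambda>y. \<bar>G y\<bar>" and h="\<lambda>\<xi>. ?c * exp (- \<delta> * (norm \<xi>)\<^sup>2)"])
    show "integrable lborel (\<lambda>\<xi>::'a. ?c * exp (- \<delta> * (norm \<xi>)\<^sup>2))"
      by (intro integrable_mult_right gauss_integrable \<delta>)
    show "norm (case (y, \<xi>) of (y, \<xi>) \<Rightarrow> F y \<xi>) \<le> \<bar>G y\<bar> * (?c * exp (- \<delta> * (norm \<xi>)\<^sup>2))" for y \<xi>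
      by (auto simp: F_def abs_mult intro!: mult_left_mono divide_right_mono mult_left_le_one_le)
  qed (use G in simp_all)
  have Gc: "integrable lborel (\<lambda>y. G y * cos (y \<bullet> \<xi>))" "integrable lborel (\<lambda>y. G y * sin (y \<bullet> \<xi>))" for \<xi>
    by (rule Bochner_Integration.integrable_bound[OF G]; auto simp: abs_mult mult_left_le)+
  have "(LBINT y. gauss_kernel \<delta> (y - x) * G y) = (LBINT y. (LBINT \<xi>. F y \<xi>))"
  proof (intro Bochner_Integration.integral_cong refl)
    fix y
    have "(LBINT \<xi>. F y \<xi>) = G y * (LBINT \<xi>. ?c * (cos ((y - x) \<bullet> \<xi>) * exp (- \<delta> * (norm \<xi>)\<^sup>2)))"
      unfolding F_def by (rule integral_mult_right_zero)
    then show "gauss_kernel \<delta> (y - x) * G y = (LBINT \<xi>. F y \<xi>)"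
      using gauss_kernel_fourier[OF \<delta>, of "y - x"] unfolding has_bochner_integral_iff by (simp only: mult.commute)
  qed
  also have "\<dots> = (LBINT \<xi>. (LBINT y. F y \<xi>))"
    by (rule lborel_pair.Fubini_integral[OF Fi, symmetric])
  also have "\<dots> = (LBINT \<xi>. ?c * (cos (x \<bullet> \<xi>) * h \<xi> * exp (- \<delta> * (norm \<xi>)\<^sup>2)))"
  proof (intro Bochner_Integration.integral_cong refl)
    fix \<xi> :: 'a
    have "(LBINT y. F y \<xi>) = (LBINT y. ?c * exp (- \<delta> * (norm \<xi>)\<^sup>2) * (cos (x \<bullet> \<xi>) * (G y * cos (y \<bullet> \<xi>)) + sin (x \<bullet> \<xi>) * (G y * sin (y \<bullet> \<xi>))))"
      unfolding F_def inner_diff_left cos_diff by (intro Bochner_Integration.integral_cong refl) (simp add: algebra_simps)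
    also have "\<dots> = ?c * exp (- \<delta> * (norm \<xi>)\<^sup>2) * (cos (x \<bullet> \<xi>) * h \<xi>)"
      unfolding integral_mult_right_zero
      by (subst Bochner_Integration.integral_add) (use Gc C S in simp_all)
    finally show "(LBINT y. F y \<xi>) = ?c * (cos (x \<bullet> \<xi>) * h \<xi> * exp (- \<delta> * (norm \<xi>)\<^sup>2))" by simp
  qed
  finally show ?thesis .
qed

lemma stable_smoothing_lim:
  assumes "0 < \<theta>" "0 < t"
  shows "(\<lambda>n. \<integral>\<xi>. 1 / (2 * pi) ^ DIM('a) * (cos (x \<bullet> \<xi>) * exp (- t * norm \<xi> powr \<theta>) * exp (- (1 / (real n + 1)) * (norm \<xi>)\<^sup>2)) \<partial>lborel)
     \<longlonglongrightarrow> stable_density \<theta> (x::'a::euclidean_space) t"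
  using gauss_regularization_lim[OF integrable_mult_right[OF stable_cos_integrable[OF assms, of x]], of "1 / (2 * pi) ^ DIM('a)"] assms
  by (simp add: stable_density_def mult.assoc)

text \<open>Smoothing \<open>G\<close> with a Gauss kernel gives a regularized Fourier integral,
  which tends to the stable density. It should also tend to \<open>G\<close>, but \<open>G\<close>
  is not known to be bounded. So Fatou's lemma first gives
  \<open>G x \<le> stable_density \<theta> x t\<close>; this bounds \<open>G\<close> by the value of
  the density at 0, and then the approximate identity applies.\<close>

lemma fourier_uniqueness:
  fixes G :: "'a::euclidean_space \<Rightarrow> real"
  assumes \<theta>: "0 < \<theta>" "\<theta> \<le> 2" and t: "0 < t"
    and cont: "continuous_on UNIV G" and G0: "\<And>x. G x \<ge> 0"
    and G: "integrable lborel G"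
    and C: "\<And>\<xi>. (LBINT y. G y * cos (y \<bullet> \<xi>)) = exp (- t * norm \<xi> powr \<theta>)"
    and S: "\<And>\<xi>. (LBINT y. G y * sin (y \<bullet> \<xi>)) = 0"
  shows "G x = stable_density \<theta> x t"
proof -
  have Gm[measurable]: "G \<in> borel_measurable borel" using G by auto
  have lim: "(\<lambda>n. \<integral>y. gauss_kernel (1 / (real n + 1)) (y - x) * G y \<partial>lborel) \<longlonglongrightarrow> stable_density \<theta> x t" for x
    using stable_smoothing_lim[OF \<theta>(1) t, of x] by (subst fourier_symbol_smoothing[OF G C S]) auto
  have hb: "has_bochner_integral lborel (gauss_kernel 1 :: 'a \<Rightarrow> real) 1"
    by (rule has_bochner_integral_gauss_kernel) simp
  have isc: "isCont G x" for x using cont by (simp add: continuous_on_eq_continuous_at)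
  have le: "G x \<le> stable_density \<theta> x t" for x
  proof -
    have int: "integrable lborel (\<lambda>w. gauss_kernel 1 w * G (x + sqrt (1 / (real n + 1)) *\<^sub>R w))" for n
    proof (rule Bochner_Integration.integrable_bound)
      show "integrable lborel (\<lambda>w. (4 * pi * 1) powr (- real DIM('a) / 2) * G (x + sqrt (1 / (real n + 1)) *\<^sub>R w))"
        by (intro integrable_mult_right integrable_lborel_affine G) (simp add: add_nonneg_eq_0_iff)
      show "AE w in lborel. norm (gauss_kernel 1 w * G (x + sqrt (1 / (real n + 1)) *\<^sub>R w)) \<le> norm ((4 * pi * 1) powr (- real DIM('a) / 2) * G (x + sqrt (1 / (real n + 1)) *\<^sub>R w))"
        using G0 by (intro always_eventually allI) (auto simp: gauss_kernel_def abs_mult mult_left_le_one_le intro!: mult_left_mono)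
    qed measurable
    have "ennreal (G x) = (\<integral>\<^sup>+(w::'a). ennreal (gauss_kernel 1 w * G x) \<partial>lborel)"
      using hb G0[of x] by (subst nn_integral_eq_integral) (auto simp: has_bochner_integral_iff gauss_kernel_nonneg)
    also have "\<dots> = (\<integral>\<^sup>+w. liminf (\<lambda>n. ennreal (gauss_kernel 1 w * G (x + sqrt (1 / (real n + 1)) *\<^sub>R w))) \<partial>lborel)"
    proof (intro nn_integral_cong)
      fix w :: 'a
      from tendsto_inverse_nat_plus_1 have "(\<lambda>n. x + sqrt (1 / (real n + 1)) *\<^sub>R w) \<longlonglongrightarrow> x + sqrt 0 *\<^sub>R w"
        by (intro tendsto_intros)
      then have "(\<lambda>n. G (x + sqrt (1 / (real n + 1)) *\<^sub>R w)) \<longlonglongrightarrow> G x"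
        using isCont_tendsto_compose[OF isc] by simp
      then have "(\<lambda>n. ennreal (gauss_kernel 1 w * G (x + sqrt (1 / (real n + 1)) *\<^sub>R w))) \<longlonglongrightarrow> ennreal (gauss_kernel 1 w * G x)"
        by (intro tendsto_ennrealI tendsto_intros)
      from lim_imp_Liminf[OF _ this] show "ennreal (gauss_kernel 1 w * G x) = liminf (\<lambda>n. ennreal (gauss_kernel 1 w * G (x + sqrt (1 / (real n + 1)) *\<^sub>R w)))" by simp
    qed
    also have "\<dots> \<le> liminf (\<lambda>n. \<integral>\<^sup>+w. ennreal (gauss_kernel 1 w * G (x + sqrt (1 / (real n + 1)) *\<^sub>R w)) \<partial>lborel)"
      by (intro nn_integral_liminf) measurable
    also have "\<dots> = liminf (\<lambda>n. ennreal (LBINT y. gauss_kernel (1 / (real n + 1)) (y - x) * G y))"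
      using int by (subst nn_integral_eq_integral) (auto simp: gauss_kernel_nonneg G0 gauss_kernel_approx_identity_eq)
    also have "\<dots> = ennreal (stable_density \<theta> x t)"
      by (intro lim_imp_Liminf tendsto_ennrealI lim) simp
    finally show ?thesis using stable_density_nonneg[OF \<theta>, of x t] by simp
  qed
  have "stable_density \<theta> y t \<le> stable_density \<theta> (0::'a) t" for y :: 'a
    by (rule stable_density_antimono[OF \<theta>]) simp
  then have "\<bar>G y\<bar> \<le> stable_density \<theta> (0::'a) t" for y
    using G0[of y] order_trans[OF le[of y]] by simp
  from gauss_kernel_approx_identity[OF Gm this isc[of x]] lim[of x] show ?thesis
    by (rule LIMSEQ_unique)
qed

lemma stable_density_measurable [measurable]: "(\<lambda>x. stable_density \<theta> x t) \<in> borel_measurable borel"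
  unfolding stable_density_def by (cases "0 < t") auto

lemma isCont_stable_symbol:
  assumes "0 < \<theta>"
  shows "isCont (\<lambda>\<xi>::'a::euclidean_space. exp (- t * norm \<xi> powr \<theta>)) \<xi>"
proof -
  have "((\<lambda>\<xi>. norm \<xi> powr \<theta>) \<longlongrightarrow> norm \<xi> powr \<theta>) (at \<xi>)"
    using assms by (intro tendsto_powr2 tendsto_norm tendsto_ident_at tendsto_const) auto
  then show ?thesis unfolding isCont_def by (intro tendsto_exp tendsto_mult tendsto_const)
qed

lemma stable_density_gauss_integral:
  fixes \<eta> :: "'a::euclidean_space"
  assumes \<theta>: "0 < \<theta>" "\<theta> \<le> 2" and t: "0 < t" and \<delta>: "\<delta> > 0"
  shows "integrable lborel (\<lambda>x. stable_density \<theta> x t * (exp (- \<delta> * (norm x)\<^sup>2) * cos (x \<bullet> \<eta>)))"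
    and "(LBINT x. stable_density \<theta> x t * (exp (- \<delta> * (norm x)\<^sup>2) * cos (x \<bullet> \<eta>))) =
      ((LBINT \<xi>. gauss_kernel \<delta> (\<xi> - \<eta>) * exp (- t * norm \<xi> powr \<theta>)) +
       (LBINT \<xi>. gauss_kernel \<delta> (\<xi> - - \<eta>) * exp (- t * norm \<xi> powr \<theta>))) / 2"
proof -
  let ?h = "\<lambda>\<xi>::'a. exp (- t * norm \<xi> powr \<theta>)"
  let ?c = "1 / (2 * pi) ^ DIM('a)"
  show "integrable lborel (\<lambda>x. stable_density \<theta> x t * (exp (- \<delta> * (norm x)\<^sup>2) * cos (x \<bullet> \<eta>)))"
  proof (rule Bochner_Integration.integrable_bound)
    show "integrable lborel (\<lambda>x. stable_density \<theta> (0::'a) t * exp (- \<delta> * (norm (x::'a))\<^sup>2))"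
      by (intro integrable_mult_right gauss_integrable \<delta>)
    show "AE x in lborel. norm (stable_density \<theta> x t * (exp (- \<delta> * (norm x)\<^sup>2) * cos (x \<bullet> \<eta>))) \<le> norm (stable_density \<theta> (0::'a) t * exp (- \<delta> * (norm x)\<^sup>2))"
    proof (intro always_eventually allI)
      fix x :: 'a
      have "stable_density \<theta> x t * (exp (- \<delta> * (norm x)\<^sup>2) * \<bar>cos (x \<bullet> \<eta>)\<bar>) \<le> stable_density \<theta> (0::'a) t * (exp (- \<delta> * (norm x)\<^sup>2) * 1)"
        using stable_density_antimono[OF \<theta>, of 0 x t] stable_density_nonneg[OF \<theta>]
        by (intro mult_mono) auto
      then show "norm (stable_density \<theta> x t * (exp (- \<delta> * (norm x)\<^sup>2) * cos (x \<bullet> \<eta>))) \<le> norm (stable_density \<theta> (0::'a) t * exp (- \<delta> * (norm x)\<^sup>2))"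
        by (simp add: abs_mult stable_density_nonneg[OF \<theta>])
    qed
  qed measurable
  define F where "F x \<xi> = ?c * (cos (x \<bullet> \<xi>) * ?h \<xi>) * (exp (- \<delta> * (norm x)\<^sup>2) * cos (x \<bullet> \<eta>))" for x \<xi>
  have [measurable]: "case_prod F \<in> borel_measurable borel"
    unfolding F_def borel_prod[symmetric] by measurable
  have Fi: "integrable (lborel \<Otimes>\<^sub>M lborel) (case_prod F)"
  proof (rule integrable_pair_bound)
    show "integrable lborel (\<lambda>x::'a. ?c * exp (- \<delta> * (norm x)\<^sup>2))"
      by (intro integrable_mult_right gauss_integrable \<delta>)
    show "integrable lborel ?h" by (rule stable_symbol_integrable[OF \<theta>(1) t])
    show "norm (case (x, \<xi>) of (x, \<xi>) \<Rightarrow> F x \<xi>) \<le> ?c * exp (- \<delta> * (norm x)\<^sup>2) * ?h \<xi>" for x \<xi>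
    proof -
      have "\<bar>cos (x \<bullet> \<xi>)\<bar> * ?h \<xi> * (exp (- \<delta> * (norm x)\<^sup>2) * \<bar>cos (x \<bullet> \<eta>)\<bar>) \<le> 1 * ?h \<xi> * (exp (- \<delta> * (norm x)\<^sup>2) * 1)"
        by (intro mult_mono) auto
      from mult_left_mono[OF this, of ?c] show ?thesis
        by (simp add: F_def abs_mult mult_ac)
    qed
  qed simp
  have gk: "integrable lborel (\<lambda>\<xi>. gauss_kernel \<delta> (\<xi> - z) * ?h \<xi>)" for z
  proof (rule Bochner_Integration.integrable_bound)
    show "integrable lborel (\<lambda>\<xi>. (4 * pi * \<delta>) powr (- real DIM('a) / 2) * ?h \<xi>)"
      by (intro integrable_mult_right stable_symbol_integrable \<theta> t)
    show "AE \<xi> in lborel. norm (gauss_kernel \<delta> (\<xi> - z) * ?h \<xi>) \<le> norm ((4 * pi * \<delta>) powr (- real DIM('a) / 2) * ?h \<xi>)"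
      using \<delta> by (intro always_eventually allI) (auto simp: gauss_kernel_def abs_mult intro!: mult_right_mono mult_right_le_one_le)
  qed measurable
  have "(LBINT x. stable_density \<theta> x t * (exp (- \<delta> * (norm x)\<^sup>2) * cos (x \<bullet> \<eta>))) = (LBINT x. (LBINT \<xi>. F x \<xi>))"
    unfolding F_def stable_density_def using t by (simp only: integral_mult_left_zero if_True)
  also have "\<dots> = (LBINT \<xi>. (LBINT x. F x \<xi>))"
    by (rule lborel_pair.Fubini_integral[OF Fi, symmetric])
  also have "\<dots> = (LBINT \<xi>. (gauss_kernel \<delta> (\<xi> - \<eta>) * ?h \<xi> + gauss_kernel \<delta> (\<xi> - - \<eta>) * ?h \<xi>) / 2)"
  proof (intro Bochner_Integration.integral_cong refl)
    fix \<xi> :: 'a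
    have "(LBINT x. F x \<xi>) = (LBINT x. ?h \<xi> / 2 * (?c * (cos ((\<xi> - \<eta>) \<bullet> x) * exp (- \<delta> * (norm x)\<^sup>2)) + ?c * (cos ((\<xi> - - \<eta>) \<bullet> x) * exp (- \<delta> * (norm x)\<^sup>2))))"
      unfolding F_def by (intro Bochner_Integration.integral_cong refl)
       (simp add: inner_diff_left inner_add_left cos_diff cos_add inner_commute algebra_simps)
    also have "\<dots> = ?h \<xi> / 2 * (gauss_kernel \<delta> (\<xi> - \<eta>) + gauss_kernel \<delta> (\<xi> - - \<eta>))"
      unfolding integral_mult_right_zero
      using gauss_kernel_fourier[OF \<delta>, of "\<xi> - \<eta>"] gauss_kernel_fourier[OF \<delta>, of "\<xi> - - \<eta>"]
      unfolding has_bochner_integral_iff by (subst Bochner_Integration.integral_add) auto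
    finally show "(LBINT x. F x \<xi>) = (gauss_kernel \<delta> (\<xi> - \<eta>) * ?h \<xi> + gauss_kernel \<delta> (\<xi> - - \<eta>) * ?h \<xi>) / 2"
      by (simp add: algebra_simps)
  qed
  also have "\<dots> = ((LBINT \<xi>. gauss_kernel \<delta> (\<xi> - \<eta>) * ?h \<xi>) + (LBINT \<xi>. gauss_kernel \<delta> (\<xi> - - \<eta>) * ?h \<xi>)) / 2"
    unfolding integral_divide_zero by (subst Bochner_Integration.integral_add[OF gk gk]) simp
  finally show "(LBINT x. stable_density \<theta> x t * (exp (- \<delta> * (norm x)\<^sup>2) * cos (x \<bullet> \<eta>))) =
      ((LBINT \<xi>. gauss_kernel \<delta> (\<xi> - \<eta>) * ?h \<xi>) + (LBINT \<xi>. gauss_kernel \<delta> (\<xi> - - \<eta>) * ?h \<xi>)) / 2" .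
qed

lemma stable_density_gauss_lim:
  fixes \<eta> :: "'a::euclidean_space"
  assumes \<theta>: "0 < \<theta>" "\<theta> \<le> 2" and t: "0 < t"
  shows "(\<lambda>n. \<integral>x. stable_density \<theta> x t * (exp (- (1 / (real n + 1)) * (norm x)\<^sup>2) * cos (x \<bullet> \<eta>)) \<partial>lborel)
     \<longlonglongrightarrow> exp (- t * norm \<eta> powr \<theta>)"
proof -
  have "(\<lambda>n. \<integral>\<xi>. gauss_kernel (1 / (real n + 1)) (\<xi> - z) * exp (- t * norm \<xi> powr \<theta>) \<partial>lborel) \<longlonglongrightarrow> exp (- t * norm z powr \<theta>)" for z :: 'a
    using t by (intro gauss_kernel_approx_identity[where B=1] isCont_stable_symbol \<theta>) auto
  from tendsto_divide[OF tendsto_add[OF this[of \<eta>] this[of "-\<eta>"]] tendsto_const[of 2]]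
  have "(\<lambda>n. ((LBINT \<xi>. gauss_kernel (1 / (real n + 1)) (\<xi> - \<eta>) * exp (- t * norm \<xi> powr \<theta>)) +
       (LBINT \<xi>. gauss_kernel (1 / (real n + 1)) (\<xi> - - \<eta>) * exp (- t * norm \<xi> powr \<theta>))) / 2) \<longlonglongrightarrow> exp (- t * norm \<eta> powr \<theta>)"
    by simp
  moreover have "(LBINT x. stable_density \<theta> x t * (exp (- (1 / (real n + 1)) * (norm x)\<^sup>2) * cos (x \<bullet> \<eta>))) =
      ((LBINT \<xi>. gauss_kernel (1 / (real n + 1)) (\<xi> - \<eta>) * exp (- t * norm \<xi> powr \<theta>)) +
       (LBINT \<xi>. gauss_kernel (1 / (real n + 1)) (\<xi> - - \<eta>) * exp (- t * norm \<xi> powr \<theta>))) / 2" for n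
    by (rule stable_density_gauss_integral(2)[OF \<theta> t]) simp
  ultimately show ?thesis by (simp only:)
qed

text \<open>Nonnegativity lets the damping be removed by monotone convergence, which yields
  integrability together with the mass, the value 1 of the symbol at 0.\<close>

lemma has_bochner_integral_stable_density:
  assumes \<theta>: "0 < \<theta>" "\<theta> \<le> 2" and t: "0 < t"
  shows "has_bochner_integral lborel (\<lambda>x::'a::euclidean_space. stable_density \<theta> x t) 1"
proof (rule has_bochner_integral_monotone_convergence[where f="\<lambda>n x. stable_density \<theta> x t * exp (- (1 / (real n + 1)) * (norm x)\<^sup>2)"])
  show "integrable lborel (\<lambda>x::'a. stable_density \<theta> x t * exp (- (1 / (real n + 1)) * (norm x)\<^sup>2))" for n
    using stable_density_gauss_integral(1)[OF \<theta> t, of "1 / (real n + 1)" "0::'a"] by simp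
  show "AE x::'a in lborel. mono (\<lambda>n. stable_density \<theta> x t * exp (- (1 / (real n + 1)) * (norm x)\<^sup>2))"
  proof (intro always_eventually allI monoI)
    fix x :: 'a and m n :: nat assume "m \<le> n"
    then have "1 / (real n + 1) * (norm x)\<^sup>2 \<le> 1 / (real m + 1) * (norm x)\<^sup>2"
      by (intro mult_right_mono divide_left_mono) auto
    then show "stable_density \<theta> x t * exp (- (1 / (real m + 1)) * (norm x)\<^sup>2) \<le> stable_density \<theta> x t * exp (- (1 / (real n + 1)) * (norm x)\<^sup>2)"
      using stable_density_nonneg[OF \<theta>, of x t] by (intro mult_left_mono) auto
  qed
  show "AE x::'a in lborel. (\<lambda>n. stable_density \<theta> x t * exp (- (1 / (real n + 1)) * (norm x)\<^sup>2)) \<longlonglongrightarrow> stable_density \<theta> x t"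
  proof (intro always_eventually allI)
    fix x :: 'a
    from tendsto_inverse_nat_plus_1 have "(\<lambda>n. stable_density \<theta> x t * exp (- (1 / (real n + 1)) * (norm x)\<^sup>2)) \<longlonglongrightarrow> stable_density \<theta> x t * exp (- 0 * (norm x)\<^sup>2)"
      by (intro tendsto_mult tendsto_const tendsto_exp tendsto_minus)
    then show "(\<lambda>n. stable_density \<theta> x t * exp (- (1 / (real n + 1)) * (norm x)\<^sup>2)) \<longlonglongrightarrow> stable_density \<theta> x t" by simp
  qed
  show "(\<lambda>n. \<integral>(x::'a). stable_density \<theta> x t * exp (- (1 / (real n + 1)) * (norm x)\<^sup>2) \<partial>lborel) \<longlonglongrightarrow> 1"
    using stable_density_gauss_lim[OF \<theta> t, of "0::'a"] \<theta> by simp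
qed simp

lemma stable_density_integrable:
  assumes \<theta>: "0 < \<theta>" "\<theta> \<le> 2"
  shows "integrable lborel (\<lambda>x::'a::euclidean_space. stable_density \<theta> x t)"
  using has_bochner_integral_stable_density[OF \<theta>] by (cases "0 < t") (auto simp: has_bochner_integral_iff stable_density_def)

lemma stable_density_cos:
  fixes \<eta> :: "'a::euclidean_space"
  assumes \<theta>: "0 < \<theta>" "\<theta> \<le> 2" and t: "0 < t"
  shows "has_bochner_integral lborel (\<lambda>x. stable_density \<theta> x t * cos (x \<bullet> \<eta>)) (exp (- t * norm \<eta> powr \<theta>))"
proof -
  have i: "integrable lborel (\<lambda>x. stable_density \<theta> x t * cos (x \<bullet> \<eta>))"
    by (rule Bochner_Integration.integrable_bound[OF stable_density_integrable[OF \<theta>, of t]]) (auto simp: abs_mult mult_left_le stable_density_nonneg[OF \<theta>])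
  have "(\<lambda>n. \<integral>x. stable_density \<theta> x t * (exp (- (1 / (real n + 1)) * (norm x)\<^sup>2) * cos (x \<bullet> \<eta>)) \<partial>lborel) \<longlonglongrightarrow> (LBINT x. stable_density \<theta> x t * cos (x \<bullet> \<eta>))"
    using gauss_regularization_lim[OF i] by (simp only: mult_ac)
  from LIMSEQ_unique[OF this stable_density_gauss_lim[OF \<theta> t]] i show ?thesis
    by (simp add: has_bochner_integral_iff)
qed

lemma stable_density_uminus: "stable_density \<theta> (- x) t = stable_density \<theta> x t"
  by (simp add: stable_density_def)

lemma stable_density_sin:
  fixes \<eta> :: "'a::euclidean_space"
  assumes \<theta>: "0 < \<theta>" "\<theta> \<le> 2"
  shows "has_bochner_integral lborel (\<lambda>x. stable_density \<theta> x t * sin (x \<bullet> \<eta>)) 0"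
proof -
  have i: "integrable lborel (\<lambda>x. stable_density \<theta> x t * sin (x \<bullet> \<eta>))"
    by (rule Bochner_Integration.integrable_bound[OF stable_density_integrable[OF \<theta>, of t]]) (auto simp: abs_mult mult_left_le stable_density_nonneg[OF \<theta>])
  have "(LBINT x. stable_density \<theta> x t * sin (x \<bullet> \<eta>)) = - (LBINT x. stable_density \<theta> x t * sin (x \<bullet> \<eta>))"
    by (subst integral_lborel_affine[where c="-1" and t=0]) (simp_all add: stable_density_uminus)
  with i show ?thesis by (simp add: has_bochner_integral_iff)
qed

section \<open>Scaling, semigroup property, positivity and smoothness\<close>

lemma stable_density_scale:
  fixes x :: "'a::euclidean_space"
  assumes \<theta>: "0 < \<theta>" and t: "0 < t"
  shows "stable_density \<theta> x t = t powr (- (real DIM('a) / \<theta>)) * stable_density \<theta> (t powr (- (1 / \<theta>)) *\<^sub>R x) 1"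
proof -
  define c where "c = t powr (- (1 / \<theta>))"
  have c: "c > 0" using t by (simp add: c_def)
  have cN: "c ^ DIM('a) = t powr (- (real DIM('a) / \<theta>))"
    using c by (simp add: c_def powr_powr flip: powr_realpow)
  have e: "t * norm (c *\<^sub>R \<xi>) powr \<theta> = norm \<xi> powr \<theta>" for \<xi> :: 'a
  proof -
    have "c powr \<theta> = t powr (- 1)" unfolding c_def powr_powr using \<theta> by simp
    then have "c powr \<theta> = inverse t" using t by (simp add: powr_minus)
    moreover have "norm (c *\<^sub>R \<xi>) powr \<theta> = c powr \<theta> * norm \<xi> powr \<theta>" using c by (simp add: powr_mult)
    ultimately show ?thesis using t by simp
  qed
  let ?C = "1 / (2 * pi) ^ DIM('a)"
  have "(LBINT \<xi>. ?C * (cos (x \<bullet> \<xi>) * exp (- (t * norm \<xi> powr \<theta>)))) =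
     (\<bar>c\<bar> ^ DIM('a)) *\<^sub>R (LBINT \<xi>. ?C * (cos (x \<bullet> (0 + c *\<^sub>R \<xi>)) * exp (- (t * norm (0 + c *\<^sub>R \<xi>) powr \<theta>))))"
    using c by (intro integral_lborel_affine) auto
  also have "\<dots> = c ^ DIM('a) * (LBINT \<xi>. ?C * (cos ((c *\<^sub>R x) \<bullet> \<xi>) * exp (- (1 * norm \<xi> powr \<theta>))))"
    using c by (simp only: add_0 e) simp
  finally show ?thesis
    using t by (simp add: stable_density_def c_def[symmetric] cN)
qed

text \<open>Only the kernel at time \<open>t\<close> is expanded into its Fourier integral.
  Integrating over \<open>y\<close> first then turns the density at time \<open>s\<close> into its
  own symbol, and the two symbols multiply to the one at \<open>t + s\<close>.\<close>

lemma stable_density_semigroup: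
  fixes x :: "'a::euclidean_space"
  assumes \<theta>: "0 < \<theta>" "\<theta> \<le> 2" and t: "0 < t" and s: "0 < s"
  shows "(\<integral>\<^sup>+y. ennreal (stable_density \<theta> (x - y) t) * ennreal (stable_density \<theta> y s) \<partial>lborel) = ennreal (stable_density \<theta> x (t + s))"
proof -
  let ?c = "1 / (2 * pi) ^ DIM('a)"
  let ?E = "\<lambda>t \<xi>::'a. exp (- t * norm \<xi> powr \<theta>)"
  have ints: "integrable lborel (\<lambda>y::'a. stable_density \<theta> y s)"
    by (rule stable_density_integrable[OF \<theta>])
  define F where "F y \<xi> = stable_density \<theta> y s * (?c * (cos ((x - y) \<bullet> \<xi>) * ?E t \<xi>))" for y \<xi>
  have [measurable]: "case_prod F \<in> borel_measurable borel"
    unfolding F_def borel_prod[symmetric] by measurable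
  have Fi: "integrable (lborel \<Otimes>\<^sub>M lborel) (case_prod F)"
  proof (rule integrable_pair_bound[where g="\<lambda>y. stable_density \<theta> y s" and h="\<lambda>\<xi>. ?c * ?E t \<xi>"])
    show "integrable lborel (\<lambda>\<xi>::'a. ?c * ?E t \<xi>)"
      by (intro integrable_mult_right stable_symbol_integrable \<theta> t)
    show "norm (case (y, \<xi>) of (y, \<xi>) \<Rightarrow> F y \<xi>) \<le> stable_density \<theta> y s * (?c * ?E t \<xi>)" for y \<xi>
      by (auto simp: F_def abs_mult stable_density_nonneg[OF \<theta>] intro!: mult_left_mono divide_right_mono mult_left_le_one_le)
  qed (use ints in simp_all)
  have i: "integrable lborel (\<lambda>y. stable_density \<theta> (x - y) t * stable_density \<theta> y s)"
  proof (rule Bochner_Integration.integrable_bound)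
    show "integrable lborel (\<lambda>y::'a. stable_density \<theta> (0::'a) t * stable_density \<theta> y s)"
      by (intro integrable_mult_right ints)
    show "AE y in lborel. norm (stable_density \<theta> (x - y) t * stable_density \<theta> y s) \<le> norm (stable_density \<theta> (0::'a) t * stable_density \<theta> y s)"
      by (intro always_eventually allI) (auto simp: abs_mult stable_density_nonneg[OF \<theta>] intro!: mult_right_mono stable_density_antimono[OF \<theta>])
  qed measurable
  have "(LBINT y. stable_density \<theta> (x - y) t * stable_density \<theta> y s) = (LBINT y. (LBINT \<xi>. F y \<xi>))"
    unfolding F_def integral_mult_right_zero[of lborel "stable_density \<theta> y s" for y]
    using t by (intro Bochner_Integration.integral_cong refl) (simp add: stable_density_def[of \<theta> "x - y" t for y])
  also have "\<dots> = (LBINT \<xi>. (LBINT y. F y \<xi>))"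
    by (rule lborel_pair.Fubini_integral[OF Fi, symmetric])
  also have "\<dots> = (LBINT \<xi>. ?c * (cos (x \<bullet> \<xi>) * ?E (t + s) \<xi>))"
  proof (intro Bochner_Integration.integral_cong refl)
    fix \<xi> :: 'a
    have C: "integrable lborel (\<lambda>y. stable_density \<theta> y s * cos (y \<bullet> \<xi>))" "(LBINT y. stable_density \<theta> y s * cos (y \<bullet> \<xi>)) = ?E s \<xi>"
      using stable_density_cos[OF \<theta> s, of \<xi>] by (auto simp: has_bochner_integral_iff)
    have S: "integrable lborel (\<lambda>y. stable_density \<theta> y s * sin (y \<bullet> \<xi>))" "(LBINT y. stable_density \<theta> y s * sin (y \<bullet> \<xi>)) = 0"
      using stable_density_sin[OF \<theta>, of s \<xi>] by (auto simp: has_bochner_integral_iff)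
    have "(LBINT y. F y \<xi>) = (LBINT y. ?c * ?E t \<xi> * (cos (x \<bullet> \<xi>) * (stable_density \<theta> y s * cos (y \<bullet> \<xi>)) + sin (x \<bullet> \<xi>) * (stable_density \<theta> y s * sin (y \<bullet> \<xi>))))"
      unfolding F_def inner_diff_left cos_diff by (intro Bochner_Integration.integral_cong refl) (simp add: algebra_simps)
    also have "\<dots> = ?c * ?E t \<xi> * (cos (x \<bullet> \<xi>) * ?E s \<xi>)"
      unfolding integral_mult_right_zero
      by (subst Bochner_Integration.integral_add) (use C S in simp_all)
    also have "\<dots> = ?c * (cos (x \<bullet> \<xi>) * (?E t \<xi> * ?E s \<xi>))" by (simp only: mult_ac)
    also have "?E t \<xi> * ?E s \<xi> = ?E (t + s) \<xi>"
      by (simp add: exp_add[symmetric] algebra_simps)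
    finally show "(LBINT y. F y \<xi>) = ?c * (cos (x \<bullet> \<xi>) * ?E (t + s) \<xi>)" .
  qed
  finally have "(LBINT y. stable_density \<theta> (x - y) t * stable_density \<theta> y s) = stable_density \<theta> x (t + s)"
    using t s by (simp add: stable_density_def[of \<theta> x])
  then show ?thesis
    using i by (subst (asm) eq_commute) (simp add: ennreal_mult[symmetric] stable_density_nonneg[OF \<theta>] nn_integral_eq_integral)
qed

text \<open>A zero at \<open>x\<close> would, by radial monotonicity, confine the density to the
  ball of radius \<open>norm x\<close>. A law of bounded support has a finite second moment, so its
  characteristic function would differ from 1 by at most a multiple of r^2, whereas here the
  difference is of order \<open>r powr \<theta>\<close> with \<theta> < 2. For \<theta> = 2 the
  density is the Gauss kernel.\<close>

lemma stable_density_pos: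
  fixes x :: "'a::euclidean_space"
  assumes \<theta>: "0 < \<theta>" "\<theta> \<le> 2" and t: "0 < t"
  shows "0 < stable_density \<theta> x t"
proof (cases "\<theta> = 2")
  case True
  have "stable_density 2 x t = gauss_kernel t x"
    using t gauss_kernel_fourier[OF t, of x] by (simp add: stable_density_def has_bochner_integral_iff)
  then show ?thesis using gauss_kernel_pos[OF t] True by simp
next
  case False
  show ?thesis
  proof (rule ccontr)
    assume "\<not> ?thesis"
    then have x0: "stable_density \<theta> x t = 0" using stable_density_nonneg[OF \<theta>, of x t] by simp
    define R where "R = norm x"
    have vanish: "stable_density \<theta> y t = 0" if "R \<le> norm y" for y :: 'a
      using stable_density_antimono[OF \<theta>, of x y t] stable_density_nonneg[OF \<theta>, of y t] that x0 by (simp add: R_def)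
    have cos_le: "1 - cos z \<le> z\<^sup>2 / 2" for z :: real
    proof -
      have "cos z = 1 - 2 * (sin (z / 2))\<^sup>2" using cos_double_sin[of "z / 2"] by simp
      moreover have "(sin (z / 2))\<^sup>2 \<le> (z / 2)\<^sup>2" using abs_sin_x_le_abs_x[of "z / 2"] by (simp only: abs_le_square_iff)
      ultimately show ?thesis by (simp add: power_divide)
    qed
    obtain e :: 'a where e: "norm e = 1" using vector_choose_size[of 1] by auto
    have main: "1 - exp (- t * r powr \<theta>) \<le> R\<^sup>2 * r\<^sup>2 / 2" if r: "r > 0" for r
    proof -
      let ?\<eta> = "r *\<^sub>R e"
      have m: "has_bochner_integral lborel (\<lambda>y::'a. stable_density \<theta> y t) 1"
        by (rule has_bochner_integral_stable_density[OF \<theta> t])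
      have "has_bochner_integral lborel (\<lambda>y. stable_density \<theta> y t - stable_density \<theta> y t * cos (y \<bullet> ?\<eta>)) (1 - exp (- t * norm ?\<eta> powr \<theta>))"
        by (intro has_bochner_integral_diff m stable_density_cos[OF \<theta> t])
      moreover have "has_bochner_integral lborel (\<lambda>y::'a. stable_density \<theta> y t * (R\<^sup>2 * r\<^sup>2 / 2)) (1 * (R\<^sup>2 * r\<^sup>2 / 2))"
        by (intro has_bochner_integral_mult_left m)
      moreover have "stable_density \<theta> y t - stable_density \<theta> y t * cos (y \<bullet> ?\<eta>) \<le> stable_density \<theta> y t * (R\<^sup>2 * r\<^sup>2 / 2)" for y :: 'a
      proof (cases "R \<le> norm y")
        case True
        then show ?thesis by (simp add: vanish)
      next
        case False
        have "\<bar>y \<bullet> ?\<eta>\<bar> \<le> norm y * norm ?\<eta>" by (rule Cauchy_Schwarz_ineq2)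
        also have "\<dots> \<le> R * r" using False r e by simp
        finally have "(y \<bullet> ?\<eta>)\<^sup>2 \<le> (R * r)\<^sup>2"
          using abs_le_square_iff[of "y \<bullet> ?\<eta>" "R * r"] r by (simp add: R_def)
        with cos_le[of "y \<bullet> ?\<eta>"] have "1 - cos (y \<bullet> ?\<eta>) \<le> R\<^sup>2 * r\<^sup>2 / 2" by (simp add: power_mult_distrib)
        then have "stable_density \<theta> y t * (1 - cos (y \<bullet> ?\<eta>)) \<le> stable_density \<theta> y t * (R\<^sup>2 * r\<^sup>2 / 2)"
          by (intro mult_left_mono stable_density_nonneg[OF \<theta>])
        then show ?thesis by (simp add: right_diff_distrib)
      qed
      ultimately have "1 - exp (- t * norm ?\<eta> powr \<theta>) \<le> 1 * (R\<^sup>2 * r\<^sup>2 / 2)"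
        unfolding has_bochner_integral_iff by (metis (no_types, lifting) integral_mono)
      then show ?thesis using r e by simp
    qed
    have "\<forall>\<^sub>F r in at_right 0. t \<le> R\<^sup>2 * r powr (2 - \<theta>)"
    proof -
      have "((\<lambda>r. t * r powr \<theta>) \<longlongrightarrow> t * 0 powr \<theta>) (at_right 0)"
        using \<theta> by (intro tendsto_mult tendsto_const tendsto_powr2 tendsto_ident_at) (auto simp: eventually_at_filter)
      then have "\<forall>\<^sub>F r in at_right 0. t * r powr \<theta> < 1"
        using \<theta> by (intro order_tendstoD(2)) auto
      moreover have "\<forall>\<^sub>F r in at_right (0::real). 0 < r" by (simp add: eventually_at_filter)
      ultimately show ?thesis
      proof eventually_elim
        case (elim r)
        define u where "u = t * r powr \<theta>"
        have u: "0 < u" "u < 1" using elim t by (auto simp: u_def)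
        have "exp (- u) \<le> 1 - u / 2"
        proof -
          have "1 + u \<le> exp u" by (rule exp_ge_add_one_self)
          then have "exp (- u) \<le> 1 / (1 + u)" using u by (simp add: exp_minus inverse_eq_divide frac_le)
          also have "1 / (1 + u) \<le> 1 - u / 2"
          proof -
            have "1 * 2 \<le> (1 + u) * (2 - u)" using u mult_mono[of u 1 u u] by (simp add: algebra_simps)
            then show ?thesis using u by (simp add: field_simps)
          qed
          finally show ?thesis .
        qed
        then have "u \<le> R\<^sup>2 * r\<^sup>2" using main[of r] elim by (simp add: u_def)
        also have "r\<^sup>2 = r powr (2 - \<theta>) * r powr \<theta>" using elim by (simp add: powr_add[symmetric] flip: powr_numeral)
        finally have "t * r powr \<theta> \<le> (R\<^sup>2 * r powr (2 - \<theta>)) * r powr \<theta>" by (simp add: u_def mult.assoc)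
        then show ?case using elim by simp
      qed
    qed
    moreover have "((\<lambda>r. R\<^sup>2 * r powr (2 - \<theta>)) \<longlongrightarrow> R\<^sup>2 * 0 powr (2 - \<theta>)) (at_right 0)"
      using \<theta> False by (intro tendsto_mult tendsto_const tendsto_powr2 tendsto_ident_at) (auto simp: eventually_at_filter)
    ultimately have "t \<le> R\<^sup>2 * 0 powr (2 - \<theta>)"
      by (intro tendsto_lowerbound) auto
    then show False using t False by simp
  qed
qed

section \<open>Smoothness of the kernel in space and time\<close>

definition fourier_heat :: "real \<Rightarrow> ('a::euclidean_space \<Rightarrow> complex) \<Rightarrow> 'a \<Rightarrow> real \<Rightarrow> real" where
  "fourier_heat \<theta> c x t = Re (LBINT \<xi>. exp (- t * norm \<xi> powr \<theta>) *\<^sub>R (c \<xi> * iexp (x \<bullet> \<xi>)))"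

text \<open>This class of amplitudes is closed under multiplication by
  \<open>\<i> * (v \<bullet> \<xi>) - s * norm \<xi> powr \<theta>\<close>, which is what a
  derivative in direction \<open>(v, s)\<close> does to \<open>fourier_heat\<close>. Smoothness is
  then a single induction with the amplitude left free.\<close>

definition poly_bounded :: "('a::euclidean_space \<Rightarrow> complex) \<Rightarrow> bool" where
  "poly_bounded c \<longleftrightarrow> c \<in> borel_measurable borel \<and> (\<exists>A M. \<forall>\<xi>. norm (c \<xi>) \<le> A * (1 + norm \<xi>) ^ M)"

lemma fourier_heat_integrable:
  assumes "0 < \<theta>" "0 < t" "poly_bounded c"
  shows "integrable lborel (\<lambda>\<xi>. exp (- t * norm \<xi> powr \<theta>) *\<^sub>R (c \<xi> * iexp (x \<bullet> \<xi>)))"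
proof -
  from assms(3) obtain A M where [measurable]: "c \<in> borel_measurable borel" and "\<And>\<xi>. norm (c \<xi>) \<le> A * (1 + norm \<xi>) ^ M"
    by (auto simp: poly_bounded_def)
  then show ?thesis
    by (intro integrable_exp_powr[OF assms(1,2), where A=A and M=M]) (auto simp: norm_mult)
qed

lemma norm_powr_le_square:
  assumes "0 < \<theta>" "\<theta> \<le> 2" "0 \<le> (r::real)"
  shows "r powr \<theta> \<le> (1 + r)\<^sup>2"
proof -
  have "r powr \<theta> \<le> (1 + r) powr \<theta>" using assms by (intro powr_mono2) auto
  also have "\<dots> \<le> (1 + r) powr 2" using assms by (intro powr_mono) auto
  finally show ?thesis using assms by simp
qed

lemma symbol_bound:
  fixes v \<xi> :: "'a::euclidean_space"
  assumes "0 < \<theta>" "\<theta> \<le> 2"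
  shows "norm (\<i> * of_real (v \<bullet> \<xi>) - of_real (s * norm \<xi> powr \<theta>)) \<le> (norm v + \<bar>s\<bar>) * (1 + norm \<xi>)\<^sup>2"
proof -
  have "norm (\<i> * of_real (v \<bullet> \<xi>) - of_real (s * norm \<xi> powr \<theta>)) \<le> \<bar>v \<bullet> \<xi>\<bar> + \<bar>s * norm \<xi> powr \<theta>\<bar>"
    by (rule order_trans[OF norm_triangle_ineq4]) (simp add: norm_mult)
  also have "\<bar>v \<bullet> \<xi>\<bar> \<le> norm v * (1 + norm \<xi>)\<^sup>2"
  proof -
    have "\<bar>v \<bullet> \<xi>\<bar> \<le> norm v * norm \<xi>" by (rule Cauchy_Schwarz_ineq2)
    also have "norm \<xi> \<le> (1 + norm \<xi>)\<^sup>2" by (simp add: power2_eq_square algebra_simps)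
    finally show ?thesis by (simp add: mult_left_mono)
  qed
  also have "\<bar>s * norm \<xi> powr \<theta>\<bar> \<le> \<bar>s\<bar> * (1 + norm \<xi>)\<^sup>2"
    using norm_powr_le_square[OF assms, of "norm \<xi>"] by (simp add: abs_mult mult_left_mono)
  finally show ?thesis by (simp add: algebra_simps)
qed

lemma poly_bounded_symbol:
  assumes "0 < \<theta>" "\<theta> \<le> 2" "poly_bounded c"
  shows "poly_bounded (\<lambda>\<xi>. c \<xi> * (\<i> * of_real (v \<bullet> \<xi>) - of_real (s * norm \<xi> powr \<theta>)))"
proof -
  from assms(3) obtain A M where [measurable]: "c \<in> borel_measurable borel" and A: "\<And>\<xi>. norm (c \<xi>) \<le> A * (1 + norm \<xi>) ^ M"
    by (auto simp: poly_bounded_def)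
  have "norm (c \<xi> * (\<i> * of_real (v \<bullet> \<xi>) - of_real (s * norm \<xi> powr \<theta>))) \<le> (A * (norm v + \<bar>s\<bar>)) * (1 + norm \<xi>) ^ (M + 2)" for \<xi>
  proof -
    have "norm (c \<xi>) * norm (\<i> * of_real (v \<bullet> \<xi>) - of_real (s * norm \<xi> powr \<theta>)) \<le> (A * (1 + norm \<xi>) ^ M) * ((norm v + \<bar>s\<bar>) * (1 + norm \<xi>)\<^sup>2)"
      using order_trans[OF norm_ge_zero A] by (intro mult_mono A symbol_bound assms) auto
    then show ?thesis by (simp only: norm_mult power_add mult_ac)
  qed
  moreover have "(\<lambda>\<xi>. c \<xi> * (\<i> * of_real (v \<bullet> \<xi>) - of_real (s * norm \<xi> powr \<theta>))) \<in> borel_measurable borel"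
    by measurable
  ultimately show ?thesis unfolding poly_bounded_def by blast
qed

text \<open>The remainder of \<open>exp z\<close> after its linear term is at most
  \<open>exp \<bar>Re z\<bar> * (norm z)\<^sup>2\<close>. For \<open>norm h < t / 2\<close> the
  exponential factor uses up only half of the decay of the symbol, so the error is at most a
  constant times \<open>(norm h)\<^sup>2\<close>.\<close>

lemma fourier_heat_has_derivative:
  fixes x :: "'a::euclidean_space"
  assumes \<theta>: "0 < \<theta>" "\<theta> \<le> 2" and t: "0 < t" and c: "poly_bounded c"
  shows "((\<lambda>(x, t). fourier_heat \<theta> c x t) has_derivative
     (\<lambda>(v, s). fourier_heat \<theta> (\<lambda>\<xi>. c \<xi> * (\<i> * of_real (v \<bullet> \<xi>) - of_real (s * norm \<xi> powr \<theta>))) x t)) (at (x, t))"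
proof -
  let ?z = "\<lambda>v s \<xi>. \<i> * of_real (v \<bullet> \<xi>) - of_real (s * norm \<xi> powr \<theta>) :: complex"
  let ?D = "\<lambda>(v, s). fourier_heat \<theta> (\<lambda>\<xi>. c \<xi> * ?z v s \<xi>) x t"
  let ?I = "\<lambda>c x t \<xi>. exp (- t * norm \<xi> powr \<theta>) *\<^sub>R (c \<xi> * iexp (x \<bullet> \<xi>)) :: complex"
  from c obtain A M where [measurable]: "c \<in> borel_measurable borel" and A: "\<And>\<xi>. norm (c \<xi>) \<le> A * (1 + norm \<xi>) ^ M"
    by (auto simp: poly_bounded_def)
  have A0: "A * (1 + norm \<xi>) ^ M \<ge> 0" for \<xi> :: 'a using order_trans[OF norm_ge_zero A] .
  have int: "integrable lborel (?I c x t)" if "0 < t" for x t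
    by (rule fourier_heat_integrable[OF \<theta>(1) that c])
  have intz: "integrable lborel (?I (\<lambda>\<xi>. c \<xi> * ?z v s \<xi>) x t)" for v s
    by (rule fourier_heat_integrable[OF \<theta>(1) t poly_bounded_symbol[OF \<theta> c]])
  have lin: "linear ?D"
  proof (rule linearI)
    fix a b :: "'a \<times> real"
    obtain v s v' s' where ab: "a = (v, s)" "b = (v', s')" by (cases a, cases b) auto
    have "?I (\<lambda>\<xi>. c \<xi> * ?z (v + v') (s + s') \<xi>) x t \<xi> = ?I (\<lambda>\<xi>. c \<xi> * ?z v s \<xi>) x t \<xi> + ?I (\<lambda>\<xi>. c \<xi> * ?z v' s' \<xi>) x t \<xi>" for \<xi>
      by (simp add: inner_add_left algebra_simps)
    then show "?D (a + b) = ?D a + ?D b"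
      unfolding ab fourier_heat_def by (simp only: add_Pair split_conv) (simp only: Bochner_Integration.integral_add[OF intz intz] plus_complex.sel)
  next
    fix r :: real and a :: "'a \<times> real"
    obtain v s where a: "a = (v, s)" by (cases a) auto
    have "?I (\<lambda>\<xi>. c \<xi> * ?z (r *\<^sub>R v) (r * s) \<xi>) x t \<xi> = r *\<^sub>R ?I (\<lambda>\<xi>. c \<xi> * ?z v s \<xi>) x t \<xi>" for \<xi>
      by (simp add: scaleR_conv_of_real algebra_simps)
    then show "?D (r *\<^sub>R a) = r *\<^sub>R ?D a"
      unfolding a fourier_heat_def by (simp only: scaleR_Pair real_scaleR_def split_conv) (simp only: integral_scaleR_right scaleR_complex.sel real_scaleR_def)
  qed
  \<comment> \<open>The half of the decay that is left carries the weight: 4 and the exponent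
    \<open>M + 4\<close> come from squaring \<open>2 * norm h * (1 + norm \<xi>)\<^sup>2\<close> on
    top of an amplitude of degree \<open>M\<close>.\<close>
  define K where "K = (LBINT \<xi>. exp (- (t / 2) * norm (\<xi>::'a) powr \<theta>) *\<^sub>R (4 * A * (1 + norm \<xi>) ^ (M + 4)))"
  have Ki: "integrable lborel (\<lambda>\<xi>::'a. exp (- (t / 2) * norm \<xi> powr \<theta>) *\<^sub>R (4 * A * (1 + norm \<xi>) ^ (M + 4)))"
  proof (rule integrable_exp_powr[OF \<theta>(1)])
    show "norm (4 * A * (1 + norm (\<xi>::'a)) ^ (M + 4)) \<le> (4 * \<bar>A\<bar>) * (1 + norm \<xi>) ^ (M + 4)" for \<xi>
      by (simp add: abs_mult)
  qed (use t in auto)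
  have bound: "norm ((case (x, t) + h of (x, t) \<Rightarrow> fourier_heat \<theta> c x t) - (case (x, t) of (x, t) \<Rightarrow> fourier_heat \<theta> c x t) - ?D h) \<le> K * (norm h)\<^sup>2"
    if h: "norm h < t / 2" for h :: "'a \<times> real"
  proof -
    obtain v s where hv: "h = (v, s)" by (cases h) auto
    have v: "norm v \<le> norm h" and s: "\<bar>s\<bar> \<le> norm h"
      unfolding hv using norm_fst_le[of "v" s] norm_snd_le[of s v] by auto
    have ts: "0 < t + s" using s h by linarith
    have diff: "?I c (x + v) (t + s) \<xi> - ?I c x t \<xi> - ?I (\<lambda>\<xi>. c \<xi> * ?z v s \<xi>) x t \<xi> = ?I c x t \<xi> * (exp (?z v s \<xi>) - (1 + ?z v s \<xi>))" for \<xi>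
    proof -
      have "exp (- (t + s) * norm \<xi> powr \<theta>) *\<^sub>R iexp ((x + v) \<bullet> \<xi>) = exp (of_real (- t * norm \<xi> powr \<theta>) + \<i> * of_real (x \<bullet> \<xi>) + ?z v s \<xi>)"
        unfolding scaleR_conv_of_real exp_of_real[symmetric] exp_add[symmetric]
        by (rule arg_cong[where f=exp]) (simp add: inner_add_left algebra_simps)
      moreover have "exp (- t * norm \<xi> powr \<theta>) *\<^sub>R iexp (x \<bullet> \<xi>) = exp (of_real (- t * norm \<xi> powr \<theta>) + \<i> * of_real (x \<bullet> \<xi>))"
        unfolding scaleR_conv_of_real exp_of_real[symmetric] exp_add[symmetric] by simp
      ultimately have eI: "exp (- (t + s) * norm \<xi> powr \<theta>) *\<^sub>R iexp ((x + v) \<bullet> \<xi>) = (exp (- t * norm \<xi> powr \<theta>) *\<^sub>R iexp (x \<bullet> \<xi>)) * exp (?z v s \<xi>)"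
        by (simp only: exp_add)
      then have "?I c (x + v) (t + s) \<xi> = ?I c x t \<xi> * exp (?z v s \<xi>)"
      proof -
        have "?I c (x + v) (t + s) \<xi> = c \<xi> * (exp (- (t + s) * norm \<xi> powr \<theta>) *\<^sub>R iexp ((x + v) \<bullet> \<xi>))" by (simp only: mult_scaleR_right)
        also have "\<dots> = c \<xi> * ((exp (- t * norm \<xi> powr \<theta>) *\<^sub>R iexp (x \<bullet> \<xi>)) * exp (?z v s \<xi>))"
          by (simp only: eI)
        finally show ?thesis by (simp only: mult_scaleR_right mult_scaleR_left mult.assoc)
      qed
      then show ?thesis by (simp add: algebra_simps)
    qed
    have le: "norm (?I c x t \<xi> * (exp (?z v s \<xi>) - (1 + ?z v s \<xi>))) \<le> (norm h)\<^sup>2 * (exp (- (t / 2) * norm \<xi> powr \<theta>) *\<^sub>R (4 * A * (1 + norm \<xi>) ^ (M + 4)))" for \<xi>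
    proof -
      have "norm (exp (?z v s \<xi>) - (\<Sum>k\<le>1. ?z v s \<xi> ^ k / fact k)) \<le> exp \<bar>Re (?z v s \<xi>)\<bar> * norm (?z v s \<xi>) ^ Suc 1 / fact 1"
        by (rule Taylor_exp)
      then have "norm (exp (?z v s \<xi>) - (1 + ?z v s \<xi>)) \<le> exp (\<bar>s\<bar> * norm \<xi> powr \<theta>) * (norm (?z v s \<xi>))\<^sup>2"
        by (simp add: abs_mult power2_eq_square)
      also have "\<dots> \<le> exp (t / 2 * norm \<xi> powr \<theta>) * ((2 * norm h) * (1 + norm \<xi>)\<^sup>2)\<^sup>2"
      proof (intro mult_mono power_mono)
        show "exp (\<bar>s\<bar> * norm \<xi> powr \<theta>) \<le> exp (t / 2 * norm \<xi> powr \<theta>)"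
          using mult_right_mono[of "\<bar>s\<bar>" "t / 2" "norm \<xi> powr \<theta>"] s h by simp
        have "norm (?z v s \<xi>) \<le> (norm v + \<bar>s\<bar>) * (1 + norm \<xi>)\<^sup>2" by (rule symbol_bound[OF \<theta>])
        also have "\<dots> \<le> (2 * norm h) * (1 + norm \<xi>)\<^sup>2" using v s by (intro mult_right_mono) auto
        finally show "norm (?z v s \<xi>) \<le> (2 * norm h) * (1 + norm \<xi>)\<^sup>2" .
      qed auto
      finally have 1: "norm (exp (?z v s \<xi>) - (1 + ?z v s \<xi>)) \<le> exp (t / 2 * norm \<xi> powr \<theta>) * ((2 * norm h) * (1 + norm \<xi>)\<^sup>2)\<^sup>2" .
      have "norm (?I c x t \<xi>) \<le> exp (- t * norm \<xi> powr \<theta>) * (A * (1 + norm \<xi>) ^ M)"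
        using A[of \<xi>] by (simp add: norm_mult)
      then have "norm (?I c x t \<xi>) * norm (exp (?z v s \<xi>) - (1 + ?z v s \<xi>)) \<le>
         exp (- t * norm \<xi> powr \<theta>) * (A * (1 + norm \<xi>) ^ M) * (exp (t / 2 * norm \<xi> powr \<theta>) * ((2 * norm h) * (1 + norm \<xi>)\<^sup>2)\<^sup>2)"
        using 1 A0[of \<xi>] by (intro mult_mono) auto
      also have "\<dots> = (exp (- t * norm \<xi> powr \<theta>) * exp (t / 2 * norm \<xi> powr \<theta>)) * ((norm h)\<^sup>2 * (4 * A * ((1 + norm \<xi>) ^ M * ((1 + norm \<xi>)\<^sup>2)\<^sup>2)))"
        by (simp only: power_mult_distrib) simp
      also have "exp (- t * norm \<xi> powr \<theta>) * exp (t / 2 * norm \<xi> powr \<theta>) = exp (- (t / 2) * norm \<xi> powr \<theta>)"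
        by (simp add: exp_add[symmetric] algebra_simps)
      also have "(1 + norm \<xi>) ^ M * ((1 + norm \<xi>)\<^sup>2)\<^sup>2 = (1 + norm \<xi>) ^ (M + 4)"
        by (simp add: power_add flip: power_mult)
      finally show ?thesis by (simp only: norm_mult real_scaleR_def mult_ac)
    qed
    have "(case (x, t) + h of (x, t) \<Rightarrow> fourier_heat \<theta> c x t) - (case (x, t) of (x, t) \<Rightarrow> fourier_heat \<theta> c x t) - ?D h
       = Re (LBINT \<xi>. ?I c (x + v) (t + s) \<xi> - ?I c x t \<xi> - ?I (\<lambda>\<xi>. c \<xi> * ?z v s \<xi>) x t \<xi>)"
      unfolding hv fourier_heat_def add_Pair split_conv
      by (subst Bochner_Integration.integral_diff[OF Bochner_Integration.integrable_diff[OF int[OF ts] int[OF t]] intz],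
          subst Bochner_Integration.integral_diff[OF int[OF ts] int[OF t]]) (simp only: minus_complex.sel)
    also have "\<dots> = Re (LBINT \<xi>. ?I c x t \<xi> * (exp (?z v s \<xi>) - (1 + ?z v s \<xi>)))"
      by (simp only: diff)
    finally have "norm ((case (x, t) + h of (x, t) \<Rightarrow> fourier_heat \<theta> c x t) - (case (x, t) of (x, t) \<Rightarrow> fourier_heat \<theta> c x t) - ?D h) \<le> norm (LBINT \<xi>. ?I c x t \<xi> * (exp (?z v s \<xi>) - (1 + ?z v s \<xi>)))"
      by (simp only: real_norm_def abs_Re_le_cmod)
    also have "\<dots> \<le> (LBINT \<xi>. (norm h)\<^sup>2 * (exp (- (t / 2) * norm (\<xi>::'a) powr \<theta>) *\<^sub>R (4 * A * (1 + norm \<xi>) ^ (M + 4))))"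
    proof (rule Bochner_Integration.integral_norm_bound_integral)
      show "integrable lborel (\<lambda>\<xi>. ?I c x t \<xi> * (exp (?z v s \<xi>) - (1 + ?z v s \<xi>)))"
        unfolding diff[symmetric] by (intro Bochner_Integration.integrable_diff int[OF ts] int[OF t] intz)
      show "integrable lborel (\<lambda>\<xi>::'a. (norm h)\<^sup>2 * (exp (- (t / 2) * norm \<xi> powr \<theta>) *\<^sub>R (4 * A * (1 + norm \<xi>) ^ (M + 4))))"
        by (rule integrable_mult_right[OF Ki])
    qed (rule le)
    also have "\<dots> = (norm h)\<^sup>2 * K" unfolding K_def by (rule integral_mult_right_zero)
    finally show ?thesis by (simp only: mult.commute)
  qed
  show ?thesis
    unfolding has_derivative_at
  proof (intro conjI)
    show "bounded_linear ?D" using lin by (simp add: linear_conv_bounded_linear)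
    show "(\<lambda>h. norm ((case (x, t) + h of (x, t) \<Rightarrow> fourier_heat \<theta> c x t) - (case (x, t) of (x, t) \<Rightarrow> fourier_heat \<theta> c x t) - ?D h) / norm h) \<midarrow>0\<rightarrow> 0"
    proof (rule tendsto_sandwich)
      show "\<forall>\<^sub>F h in at 0. 0 \<le> norm ((case (x, t) + h of (x, t) \<Rightarrow> fourier_heat \<theta> c x t) - (case (x, t) of (x, t) \<Rightarrow> fourier_heat \<theta> c x t) - ?D h) / norm h"
        by simp
      have "\<forall>\<^sub>F h in at (0 :: 'a \<times> real). norm h < t / 2"
        unfolding eventually_at using t by (intro exI[of _ "t / 2"]) auto
      then show "\<forall>\<^sub>F h in at 0. norm ((case (x, t) + h of (x, t) \<Rightarrow> fourier_heat \<theta> c x t) - (case (x, t) of (x, t) \<Rightarrow> fourier_heat \<theta> c x t) - ?D h) / norm h \<le> K * norm h"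
      proof eventually_elim
        case (elim h)
        show ?case
        proof (cases "h = 0")
          case False
          have "norm ((case (x, t) + h of (x, t) \<Rightarrow> fourier_heat \<theta> c x t) - (case (x, t) of (x, t) \<Rightarrow> fourier_heat \<theta> c x t) - ?D h) \<le> (K * norm h) * norm h"
            using bound[OF elim] by (simp only: power2_eq_square mult.assoc)
          then show ?thesis using False by (subst pos_divide_le_eq) auto
        qed simp
      qed
      have "((\<lambda>h::'a \<times> real. K * norm h) \<longlongrightarrow> K * norm (0::'a \<times> real)) (at 0)" by (intro tendsto_intros)
      then show "((\<lambda>h::'a \<times> real. K * norm h) \<longlongrightarrow> 0) (at 0)" by simp
    qed simp
  qed
qed

text \<open>\<open>frechet_derivative\<close> is a choice among derivatives; on an open set the
  derivatives of \<open>f\<close> and \<open>g\<close> are the same relation, so the choices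
  coincide as well.\<close>

lemma C_k_cong:
  assumes S: "open S" and "\<And>x. x \<in> S \<Longrightarrow> f x = g x" and "C_k k f S"
  shows "C_k k g S"
  using assms(2,3)
proof (induction k arbitrary: f g)
  case 0
  then show ?case by (simp cong: continuous_on_cong)
next
  case (Suc k)
  have der: "(f has_derivative D) (at x) \<longleftrightarrow> (g has_derivative D) (at x)" if "x \<in> S" for x D
    using has_derivative_transform_within_open[OF _ S that, of f D UNIV g]
      has_derivative_transform_within_open[OF _ S that, of g D UNIV f] Suc.prems(1) by auto
  have "f differentiable_on S" and C: "\<And>v. C_k k (\<lambda>x. frechet_derivative f (at x) v) S"
    using Suc.prems(2) by auto
  then have "g differentiable_on S"
    using der by (auto simp: differentiable_on_eq_differentiable_at[OF S] differentiable_def)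
  moreover have "C_k k (\<lambda>x. frechet_derivative g (at x) v) S" for v
    by (rule Suc.IH[OF _ C]) (simp add: frechet_derivative_def der)
  ultimately show ?case by simp
qed

lemma open_space_time: "open (UNIV \<times> {0<..} :: ('a::euclidean_space \<times> real) set)"
  by (intro open_Times) auto

lemma C_k_fourier_heat:
  assumes \<theta>: "0 < \<theta>" "\<theta> \<le> 2" and c: "poly_bounded c"
  shows "C_k k (\<lambda>(x, t). fourier_heat \<theta> c x t) (UNIV \<times> {0<..})"
  using c
proof (induction k arbitrary: c)
  case 0
  have "isCont (\<lambda>(x, t). fourier_heat \<theta> c x t) p" if p: "p \<in> UNIV \<times> {0<..}" for p
    using fourier_heat_has_derivative[OF \<theta> _ 0, of "snd p" "fst p"] p has_derivative_continuous by fastforce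
  then show ?case by (auto intro!: continuous_at_imp_continuous_on)
next
  case (Suc k)
  have der: "((\<lambda>(x, t). fourier_heat \<theta> c x t) has_derivative
     (\<lambda>(v, s). fourier_heat \<theta> (\<lambda>\<xi>. c \<xi> * (\<i> * of_real (v \<bullet> \<xi>) - of_real (s * norm \<xi> powr \<theta>))) (fst p) (snd p))) (at p)"
    if p: "p \<in> UNIV \<times> {0<..}" for p
    using fourier_heat_has_derivative[OF \<theta> _ Suc.prems, of "snd p" "fst p"] p by auto
  have "(\<lambda>(x, t). fourier_heat \<theta> c x t) differentiable_on (UNIV \<times> {0<..})"
    using der unfolding differentiable_on_eq_differentiable_at[OF open_space_time] differentiable_def by blast
  moreover have "C_k k (\<lambda>p. frechet_derivative (\<lambda>(x, t). fourier_heat \<theta> c x t) (at p) w) (UNIV \<times> {0<..})" for w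
  proof -
   obtain v s where w: "w = (v, s)" by (cases w) auto
   show ?thesis
   proof (rule C_k_cong[OF open_space_time])
    show "C_k k (\<lambda>(x, t). fourier_heat \<theta> (\<lambda>\<xi>. c \<xi> * (\<i> * of_real (v \<bullet> \<xi>) - of_real (s * norm \<xi> powr \<theta>))) x t) (UNIV \<times> {0<..})"
      by (intro Suc.IH poly_bounded_symbol \<theta> Suc.prems)
    show "(case p of (x, t) \<Rightarrow> fourier_heat \<theta> (\<lambda>\<xi>. c \<xi> * (\<i> * of_real (v \<bullet> \<xi>) - of_real (s * norm \<xi> powr \<theta>))) x t)
      = frechet_derivative (\<lambda>(x, t). fourier_heat \<theta> c x t) (at p) w" if "p \<in> UNIV \<times> {0<..}" for p
      unfolding frechet_derivative_at[OF der[OF that], symmetric] w by (simp add: case_prod_beta)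
   qed
  qed
  ultimately show ?case by simp
qed

lemma stable_density_eq_fourier_heat:
  assumes "0 < \<theta>" "0 < t"
  shows "stable_density \<theta> x t = fourier_heat \<theta> (\<lambda>_. of_real (1 / (2 * pi) ^ DIM('a))) (x::'a::euclidean_space) t"
proof -
  let ?c = "of_real (1 / (2 * pi) ^ DIM('a)) :: complex"
  have "poly_bounded (\<lambda>_::'a. ?c)"
    unfolding poly_bounded_def by (intro conjI exI[of _ "norm ?c"] exI[of _ 0]) auto
  from integral_Re[OF fourier_heat_integrable[OF assms this, of x]]
  have "fourier_heat \<theta> (\<lambda>_. ?c) x t = (LBINT \<xi>. Re (exp (- t * norm \<xi> powr \<theta>) *\<^sub>R (?c * iexp (x \<bullet> \<xi>))))"
    by (simp only: fourier_heat_def)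
  moreover have "Re (exp (- t * norm \<xi> powr \<theta>) *\<^sub>R (?c * iexp (x \<bullet> \<xi>))) = 1 / (2 * pi) ^ DIM('a) * (cos (x \<bullet> \<xi>) * exp (- t * norm \<xi> powr \<theta>))" for \<xi>
    by (simp only: scaleR_complex.sel Re_complex_of_real times_complex.sel Im_complex_of_real cis_conv_exp[symmetric] cis.sel) simp
  ultimately show ?thesis using assms by (simp only: stable_density_def if_True)
qed

lemma smooth_on_stable_density:
  assumes \<theta>: "0 < \<theta>" "\<theta> \<le> 2"
  shows "smooth_on (\<lambda>(x, t). stable_density \<theta> (x::'a::euclidean_space) t) (UNIV \<times> {0<..})"
  unfolding smooth_on_def
proof
  fix k
  let ?c = "of_real (1 / (2 * pi) ^ DIM('a)) :: complex"
  have "poly_bounded (\<lambda>_::'a. ?c)"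
    unfolding poly_bounded_def by (intro conjI exI[of _ "norm ?c"] exI[of _ 0]) auto
  from C_k_fourier_heat[OF \<theta> this] show "C_k k (\<lambda>(x, t). stable_density \<theta> (x::'a) t) (UNIV \<times> {0<..})"
    by (rule C_k_cong[OF open_space_time, rotated]) (auto simp: stable_density_eq_fourier_heat[OF \<theta>(1)])
qed

lemma continuous_on_smooth: "smooth_on f S \<Longrightarrow> continuous_on S f"
  using C_k.simps(1) unfolding smooth_on_def by blast

lemma stable_density_measurable_pair:
  assumes \<theta>: "0 < \<theta>" "\<theta> \<le> 2"
  shows "(\<lambda>(x, t). stable_density \<theta> (x::'a::euclidean_space) t) \<in> borel_measurable borel"
proof -
  let ?S = "UNIV \<times> {0<..} :: ('a \<times> real) set"
  have "(\<lambda>p. if p \<in> ?S then (case p of (x, t) \<Rightarrow> stable_density \<theta> x t) else 0) \<in> borel_measurable borel"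
    using continuous_on_smooth[OF smooth_on_stable_density[OF \<theta>]]
    by (intro borel_measurable_continuous_on_if borel_open open_space_time continuous_on_const)
  also have "(\<lambda>p. if p \<in> ?S then (case p of (x, t) \<Rightarrow> stable_density \<theta> x t) else 0) = (\<lambda>(x, t). stable_density \<theta> x t)"
    by (auto simp: stable_density_def)
  finally show ?thesis .
qed

section \<open>Identification of the chosen kernel with the stable density\<close>

lemma exp_minus_ii: "exp (- (\<i> * complex_of_real z)) = of_real (cos z) - \<i> * of_real (sin z)"
  by (simp add: exp_minus cis_conv_exp[symmetric] cis_cnj[symmetric] complex_eq_iff flip: cis_inverse)

lemma is_frac_heat_kernel_stable_density:
  assumes \<theta>: "0 < \<theta>" "\<theta> \<le> 2"
  shows "is_frac_heat_kernel \<theta> (stable_density \<theta> :: real ^ 'n \<Rightarrow> real \<Rightarrow> real)"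
proof -
  have "has_bochner_integral lborel
        (\<lambda>x. complex_of_real (stable_density \<theta> x t) * exp (- (\<i> * complex_of_real (\<xi> \<bullet> x))))
        (complex_of_real (exp (- t * norm \<xi> powr \<theta>)))" if t: "t > 0" for t and \<xi> :: "real ^ 'n"
  proof -
    have "has_bochner_integral lborel (\<lambda>x. complex_of_real (stable_density \<theta> x t * cos (x \<bullet> \<xi>)) - \<i> * complex_of_real (stable_density \<theta> x t * sin (x \<bullet> \<xi>)))
       (complex_of_real (exp (- t * norm \<xi> powr \<theta>)) - \<i> * complex_of_real 0)"
      by (intro has_bochner_integral_diff has_bochner_integral_mult_right has_bochner_integral_of_real stable_density_cos stable_density_sin \<theta> t)
    then show ?thesis by (simp add: exp_minus_ii inner_commute algebra_simps)
  qed
  then show ?thesis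
    unfolding is_frac_heat_kernel_def using smooth_on_stable_density[OF \<theta>] stable_density_pos[OF \<theta>] by blast
qed

text \<open>The stable density shows that the choice is not from an empty class, so the chosen
  kernel has the defining properties; positivity, continuity and Fourier transform then leave no
  freedom at positive times.\<close>

lemma frac_heat_kernel_eq:
  assumes \<theta>: "0 < \<theta>" "\<theta> \<le> 2" and t: "0 < t"
  shows "frac_heat_kernel \<theta> x t = stable_density \<theta> (x :: real ^ 'n) t"
proof -
  let ?G = "frac_heat_kernel \<theta> :: real ^ 'n \<Rightarrow> real \<Rightarrow> real"
  have G: "is_frac_heat_kernel \<theta> ?G"
    unfolding frac_heat_kernel_def by (rule someI[of "is_frac_heat_kernel \<theta>", OF is_frac_heat_kernel_stable_density[OF \<theta>]])
  have pos: "?G x t > 0" for x using G t by (simp add: is_frac_heat_kernel_def)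
  have cont: "continuous_on UNIV (\<lambda>x. ?G x t)"
  proof -
    have "continuous_on (UNIV \<times> {0<..}) (\<lambda>(x, t). ?G x t)"
      using G continuous_on_smooth unfolding is_frac_heat_kernel_def by blast
    then have "continuous_on UNIV ((\<lambda>(x, t). ?G x t) \<circ> (\<lambda>x. (x, t)))"
      using t by (intro continuous_on_compose) (auto intro!: continuous_intros elim: continuous_on_subset)
    then show ?thesis by (simp add: o_def)
  qed
  have ft: "has_bochner_integral lborel (\<lambda>x. complex_of_real (?G x t) * exp (- (\<i> * complex_of_real (\<xi> \<bullet> x)))) (complex_of_real (exp (- t * norm \<xi> powr \<theta>)))" for \<xi>
    using G t by (simp add: is_frac_heat_kernel_def)
  have int: "integrable lborel (\<lambda>x. ?G x t)"
    using has_bochner_integral_Re[OF ft[of 0]] by (simp add: has_bochner_integral_iff)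
  have C: "(LBINT y. ?G y t * cos (y \<bullet> \<xi>)) = exp (- t * norm \<xi> powr \<theta>)" for \<xi>
    using has_bochner_integral_Re[OF ft[of \<xi>]] by (simp add: has_bochner_integral_iff exp_minus_ii inner_commute)
  have S: "(LBINT y. ?G y t * sin (y \<bullet> \<xi>)) = 0" for \<xi>
    using has_bochner_integral_Im[OF ft[of \<xi>]] by (simp add: has_bochner_integral_iff exp_minus_ii inner_commute)
  show ?thesis
    using fourier_uniqueness[OF \<theta> t cont less_imp_le[OF pos] int C S] .
qed

section \<open>Powers of extended nonnegative reals\<close>

text \<open>The value \<infinity> is sent to itself, so that nonlinear integrals make sense before
  any finiteness is known.\<close>

definition epow :: "real \<Rightarrow> ennreal \<Rightarrow> ennreal" where
  "epow p x = (if x = top then top else ennreal (enn2real x powr p))"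

lemma epow_ennreal [simp]: "0 \<le> r \<Longrightarrow> epow p (ennreal r) = ennreal (r powr p)"
  by (simp add: epow_def)

lemma epow_top [simp]: "epow p top = top"
  by (simp add: epow_def)

lemma epow_0 [simp]: "epow p 0 = 0"
  by (simp add: epow_def)

lemma epow_eq_top_iff [simp]: "epow p x = top \<longleftrightarrow> x = top"
  by (simp add: epow_def)

lemma epow_measurable [measurable]: "epow p \<in> borel_measurable borel"
  unfolding epow_def[abs_def] by (intro measurable_If) (auto simp: pred_def)

lemma epow_mono:
  assumes "0 < p" "x \<le> y"
  shows "epow p x \<le> epow p y"
proof (cases "y = top")
  case False
  then have "x \<noteq> top" using assms by (auto simp: top_unique)
  moreover have "enn2real x \<le> enn2real y" using assms False by (intro enn2real_mono) (auto simp: top.not_eq_extremum)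
  ultimately show ?thesis using False assms by (auto simp: epow_def intro!: ennreal_leI powr_mono2)
qed simp

lemma epow_mult:
  assumes "0 < p"
  shows "epow p (x * y) = epow p x * epow p y"
proof (cases "x = top \<or> y = top")
  case True
  then show ?thesis
    by (auto simp: ennreal_mult_eq_top_iff ennreal_top_mult ennreal_mult_top epow_def enn2real_eq_0_iff)
next
  case False
  then show ?thesis
    by (cases x; cases y) (simp_all add: ennreal_mult[symmetric] powr_mult)
qed

lemma epow_add:
  assumes "0 < a" "0 < b"
  shows "epow (a + b) x = epow a x * epow b x"
  by (cases x) (simp_all add: ennreal_mult[symmetric] powr_add)

lemma epow_epow:
  shows "epow a (epow b x) = epow (a * b) x"
  by (cases x) (simp_all add: powr_powr mult.commute)

lemma epow_1 [simp]: "epow 1 x = x"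
  by (cases x) simp_all

text \<open>Continuity from below, which lets the monotone iteration pass through the
  nonlinearity.\<close>

lemma epow_SUP:
  assumes p: "0 < p" and X: "incseq X"
  shows "epow p (SUP n. X n) = (SUP n. epow p (X n))"
proof (rule antisym)
  show "(SUP n. epow p (X n)) \<le> epow p (SUP n. X n)"
    by (intro SUP_least epow_mono p SUP_upper) auto
  have inc: "incseq (\<lambda>n. epow p (X n))"
    using X p by (auto simp: incseq_def intro: epow_mono)
  have lim: "X \<longlonglongrightarrow> (SUP n. X n)" by (rule LIMSEQ_SUP[OF X])
  show "epow p (SUP n. X n) \<le> (SUP n. epow p (X n))"
  proof (cases "SUP n. X n")
    case (real r)
    have X': "X n = ennreal (enn2real (X n))" for n
    proof -
      have "X n \<le> ennreal r" unfolding real(2)[symmetric] by (rule SUP_upper) simp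
      then show ?thesis by (metis ennreal_enn2real_if ennreal_neq_top neq_top_trans)
    qed
    have "(\<lambda>n. ennreal (enn2real (X n))) \<longlonglongrightarrow> ennreal r" using lim real X' by simp
    then have "(\<lambda>n. enn2real (X n)) \<longlonglongrightarrow> r" using real by (subst (asm) tendsto_ennreal_iff) auto
    then have "(\<lambda>n. enn2real (X n) powr p) \<longlonglongrightarrow> r powr p"
      using p by (intro tendsto_powr2) auto
    then have "(\<lambda>n. ennreal (enn2real (X n) powr p)) \<longlonglongrightarrow> ennreal (r powr p)" by (rule tendsto_ennrealI)
    moreover have "ennreal (enn2real (X n) powr p) = epow p (X n)" for n
      by (subst (2) X') simp
    ultimately have "(\<lambda>n. epow p (X n)) \<longlonglongrightarrow> epow p (SUP n. X n)"
      using real by simp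
    then show ?thesis using LIMSEQ_unique[OF LIMSEQ_SUP[OF inc]] by auto
  next
    case top
    have "\<exists>n\<in>UNIV. of_nat N \<le> epow p (X n)" for N :: nat
    proof -
      have "\<forall>\<^sub>F n in sequentially. X n > ennreal (real N powr (1 / p))"
        using lim top by (intro order_tendstoD(1)) auto
      then obtain n where n: "X n > ennreal (real N powr (1 / p))"
        by (auto simp: eventually_sequentially)
      have "of_nat N = epow p (ennreal (real N powr (1 / p)))"
        using p by (cases "N = 0") (simp_all add: powr_powr ennreal_of_nat_eq_real_of_nat)
      also have "\<dots> \<le> epow p (X n)" using n p by (intro epow_mono) auto
      finally show ?thesis by blast
    qed
    then have "(SUP n. epow p (X n)) = top" by (rule ennreal_SUP_eq_top)
    then show ?thesis by (simp only: top_greatest)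
  qed
qed

text \<open>The graph of \<open>y powr p\<close> lies above its tangent at \<open>c\<close>; this is
  Young's inequality for the pair \<open>y\<close>, \<open>c powr (p - 1)\<close>.\<close>

lemma young_tangent:
  fixes c y p :: real
  assumes "1 < p" "0 \<le> c" "0 \<le> y"
  shows "p * c powr (p - 1) * y \<le> y powr p + (p - 1) * c powr p"
proof -
  define q where "q = p / (p - 1)"
  have q: "q > 1" "1 / p + 1 / q = 1" using assms by (auto simp: q_def field_simps)
  have "y * (c powr (p - 1)) \<le> y powr p / p + (c powr (p - 1)) powr q / q"
    by (rule Youngs_inequality) (use assms q in auto)
  also have "(c powr (p - 1)) powr q = c powr p" using assms by (simp add: powr_powr q_def)
  finally have "p * (y * c powr (p - 1)) \<le> p * (y powr p / p + c powr p / q)"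
    using assms by (intro mult_left_mono) auto
  also have "\<dots> = y powr p + (p - 1) * c powr p" using assms by (simp add: q_def field_simps)
  finally show ?thesis by (simp add: mult_ac)
qed

lemma epow_tangent:
  assumes "1 < p" "0 \<le> c"
  shows "ennreal (p * c powr (p - 1)) * y \<le> epow p y + ennreal ((p - 1) * c powr p)"
proof (cases y)
  case (real r)
  then show ?thesis
    using young_tangent[OF assms, of r] assms
    by (simp add: ennreal_mult[symmetric] ennreal_plus[symmetric] del: ennreal_plus)
qed simp

text \<open>The tangent inequality is integrated, with the point of tangency at the mean. No
  integrability is assumed: if the mean is infinite, the tangent at 1 already forces the right-hand
  side to be infinite.\<close>

lemma epow_jensen:
  assumes p: "1 < p" and [measurable]: "f \<in> borel_measurable M" "w \<in> borel_measurable M"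
    and mass: "(\<integral>\<^sup>+x. w x \<partial>M) = 1"
  shows "epow p (\<integral>\<^sup>+x. w x * f x \<partial>M) \<le> (\<integral>\<^sup>+x. w x * epow p (f x) \<partial>M)"
proof -
  let ?I = "\<integral>\<^sup>+x. w x * epow p (f x) \<partial>M"
  have key: "ennreal (p * c powr (p - 1)) * (\<integral>\<^sup>+x. w x * f x \<partial>M) \<le> ?I + ennreal ((p - 1) * c powr p)" if "0 \<le> c" for c
  proof -
    have "ennreal (p * c powr (p - 1)) * (\<integral>\<^sup>+x. w x * f x \<partial>M) = (\<integral>\<^sup>+x. w x * (ennreal (p * c powr (p - 1)) * f x) \<partial>M)"
      by (subst nn_integral_cmult[symmetric]) (auto simp: mult_ac)
    also have "\<dots> \<le> (\<integral>\<^sup>+x. w x * (epow p (f x) + ennreal ((p - 1) * c powr p)) \<partial>M)"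
      by (intro nn_integral_mono mult_left_mono epow_tangent p that) auto
    also have "\<dots> = ?I + ennreal ((p - 1) * c powr p)"
      by (simp add: distrib_left nn_integral_add nn_integral_multc mass)
    finally show ?thesis .
  qed
  show ?thesis
  proof (cases "\<integral>\<^sup>+x. w x * f x \<partial>M")
    case (real m)
    show ?thesis
    proof (cases "?I")
      case I: (real i)
      from key[of m] real I have "ennreal (p * m powr (p - 1) * m) \<le> ennreal (i + (p - 1) * m powr p)"
        using p by (simp add: ennreal_mult[symmetric] ennreal_plus[symmetric] del: ennreal_plus)
      moreover have "m powr (p - 1) * m = m powr p" using real p by (simp add: powr_mult_base mult.commute)
      ultimately have "p * m powr p \<le> i + (p - 1) * m powr p"
        using I p by (simp add: mult.assoc del: ennreal_plus)
      then show ?thesis using real I by (simp add: algebra_simps ennreal_leI)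
    qed simp
  next
    case top
    then show ?thesis using key[of 1] p by (simp add: ennreal_mult_top top_unique)
  qed
qed

text \<open>Jensen on a two-point space with weights \<open>l\<close> and
  \<open>1 - l\<close>.\<close>

lemma epow_convex:
  assumes p: "1 < p" and l: "0 \<le> l" "l \<le> 1"
  shows "epow p (ennreal l * a + ennreal (1 - l) * b) \<le> ennreal l * epow p a + ennreal (1 - l) * epow p b"
proof -
  let ?M = "count_space (UNIV :: bool set)"
  let ?w = "\<lambda>i. if i then ennreal l else ennreal (1 - l)" and ?f = "\<lambda>i. if i then a else b"
  have sum: "(\<integral>\<^sup>+i. g i \<partial>?M) = g True + g False" for g :: "bool \<Rightarrow> ennreal"
    by (simp add: nn_integral_count_space_finite UNIV_bool add.commute)
  have "(\<integral>\<^sup>+i. ?w i \<partial>?M) = 1"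
    unfolding sum using l by (simp add: ennreal_plus[symmetric] del: ennreal_plus)
  from epow_jensen[OF p _ _ this, of ?f] show ?thesis
    unfolding sum by simp
qed

section \<open>Abstract heat semigroups and monotone iteration\<close>

lemma AE_lborel_swap:
  assumes "AE (x, t) in (lborel :: ('a::euclidean_space \<times> 'b::euclidean_space) measure). P x t"
  shows "AE t in lborel. AE x in lborel. P x t"
proof -
  have "AE z in (lborel \<Otimes>\<^sub>M lborel :: ('a \<times> 'b) measure). P (fst z) (snd z)"
    using assms unfolding lborel_prod by (simp add: case_prod_beta)
  \<comment> \<open>\<open>P\<close> is not assumed measurable, so Fubini is applied to a measurable
    null set that covers the exceptions.\<close>
  then obtain N where N: "{z \<in> space (lborel \<Otimes>\<^sub>M lborel :: ('a \<times> 'b) measure). \<not> P (fst z) (snd z)} \<subseteq> N"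
    and N0: "N \<in> null_sets (lborel \<Otimes>\<^sub>M lborel)"
    by (auto elim!: AE_E simp: null_sets_def)
  have [measurable]: "N \<in> sets (lborel \<Otimes>\<^sub>M lborel)" using N0 by auto
  have "AE z in (lborel \<Otimes>\<^sub>M lborel). z \<notin> N" using N0 by (rule AE_not_in)
  then have "AE x in lborel. AE t in lborel. (x, t) \<notin> N" by (rule lborel_pair.AE_pair)
  then have "AE t in lborel. AE x in lborel. (x, t) \<notin> N"
  proof (subst (asm) lborel_pair.AE_commute)
    have "{z \<in> space (lborel \<Otimes>\<^sub>M lborel). (fst z, snd z) \<notin> N} = space (lborel \<Otimes>\<^sub>M lborel) - N" by auto
    also have "\<dots> \<in> sets (lborel \<Otimes>\<^sub>M lborel)" by measurable
    finally show "{z \<in> space (lborel \<Otimes>\<^sub>M lborel). (fst z, snd z) \<notin> N} \<in> sets (lborel \<Otimes>\<^sub>M lborel)" .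
  qed
  then show ?thesis
  proof eventually_elim
    case (elim t)
    then show ?case
    proof eventually_elim
      case (elim x)
      have "(x, t) \<notin> {z \<in> space (lborel \<Otimes>\<^sub>M lborel :: ('a \<times> 'b) measure). \<not> P (fst z) (snd z)}" using elim N by blast
      then show ?case by (simp add: space_pair_measure)
    qed
  qed
qed

text \<open>\<open>K_antimono\<close> and \<open>K_scale\<close> replace explicit kernel estimates:
  together they give the maximum \<open>t powr - q * K 0 1\<close> at time \<open>t\<close> and the
  comparison of different times. In terms of \<open>q\<close> the critical exponent is
  \<open>1 + 1 / q\<close>.\<close>

locale heat_semigroup =
  fixes K :: "'a::euclidean_space \<Rightarrow> real \<Rightarrow> real" and \<theta> q :: real
  assumes \<theta>_pos: "0 < \<theta>"
    and q_def: "q = real DIM('a) / \<theta>"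
    and K_borel: "(\<lambda>(x, t). K x t) \<in> borel_measurable borel"
    and K_pos: "0 < t \<Longrightarrow> 0 < K x t"
    and K_zero: "t \<le> 0 \<Longrightarrow> K x t = 0"
    and K_mass: "0 < t \<Longrightarrow> (\<integral>\<^sup>+x. ennreal (K x t) \<partial>lborel) = 1"
    and K_semigroup: "0 < t \<Longrightarrow> 0 < s \<Longrightarrow>
      (\<integral>\<^sup>+y. ennreal (K (x - y) t) * ennreal (K y s) \<partial>lborel) = ennreal (K x (t + s))"
    and K_scale: "0 < t \<Longrightarrow> K x t = t powr - q * K (t powr (- (1 / \<theta>)) *\<^sub>R x) 1"
    and K_antimono: "norm x \<le> norm y \<Longrightarrow> K y t \<le> K x t"
begin

lemma K_measurable [measurable (raw)]:
  assumes [measurable]: "f \<in> borel_measurable M" "g \<in> borel_measurable M"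
  shows "(\<lambda>z. K (f z) (g z)) \<in> borel_measurable M"
proof -
  have "(\<lambda>z. (f z, g z)) \<in> M \<rightarrow>\<^sub>M borel" unfolding borel_prod[symmetric] by measurable
  from measurable_compose[OF this K_borel] show ?thesis by simp
qed

lemma K_nonneg: "0 \<le> K x t"
  using K_pos[of t x] K_zero[of t x] by (cases "0 < t") auto

definition heat :: "real \<Rightarrow> ('a \<Rightarrow> ennreal) \<Rightarrow> 'a \<Rightarrow> ennreal" where
  "heat t f x = (\<integral>\<^sup>+y. ennreal (K (x - y) t) * f y \<partial>lborel)"

lemma K_mass': "0 < t \<Longrightarrow> (\<integral>\<^sup>+y. ennreal (K (x - y) t) \<partial>lborel) = 1"
  using nn_integral_lborel_reflect[of "\<lambda>y. ennreal (K y t)" x] by (simp add: K_mass)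

lemma heat_const: "0 < t \<Longrightarrow> heat t (\<lambda>_. c) x = c"
  by (simp add: heat_def nn_integral_multc K_mass')

lemma heat_mono: "(\<And>y. f y \<le> g y) \<Longrightarrow> heat t f x \<le> heat t g x"
  unfolding heat_def by (intro nn_integral_mono mult_left_mono) auto

lemma heat_mono_AE: "(AE y in lborel. f y \<le> g y) \<Longrightarrow> heat t f x \<le> heat t g x"
  unfolding heat_def by (intro nn_integral_mono_AE) (auto elim!: eventually_mono intro: mult_left_mono)

lemma heat_measurable_pair [measurable (raw)]:
  assumes [measurable]: "(\<lambda>(z, y). f z y) \<in> borel_measurable (M \<Otimes>\<^sub>M borel)" "x \<in> borel_measurable M" "t \<in> borel_measurable M"
  shows "(\<lambda>z. heat (t z) (f z) (x z)) \<in> borel_measurable M"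
  unfolding heat_def by measurable

lemma heat_add:
  assumes [measurable]: "f \<in> borel_measurable borel" "g \<in> borel_measurable borel"
  shows "heat t (\<lambda>y. f y + g y) x = heat t f x + heat t g x"
  unfolding heat_def by (simp add: distrib_left nn_integral_add)

lemma heat_cmult:
  assumes [measurable]: "f \<in> borel_measurable borel"
  shows "heat t (\<lambda>y. c * f y) x = c * heat t f x"
  unfolding heat_def by (subst nn_integral_cmult[symmetric]) (auto simp: mult_ac)

lemma heat_heat:
  assumes [measurable]: "f \<in> borel_measurable borel" and "0 < t" "0 < s"
  shows "heat t (heat s f) x = heat (t + s) f x"
proof -
  have "heat t (heat s f) x = (\<integral>\<^sup>+y. (\<integral>\<^sup>+z. ennreal (K (x - y) t) * (ennreal (K (y - z) s) * f z) \<partial>lborel) \<partial>lborel)"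
    unfolding heat_def by (intro nn_integral_cong nn_integral_cmult[symmetric]) measurable
  also have "\<dots> = (\<integral>\<^sup>+z. (\<integral>\<^sup>+y. ennreal (K (x - y) t) * (ennreal (K (y - z) s) * f z) \<partial>lborel) \<partial>lborel)"
    by (rule lborel_pair.Fubini') measurable
  also have "\<dots> = (\<integral>\<^sup>+z. ennreal (K (x - z) (t + s)) * f z \<partial>lborel)"
  proof (intro nn_integral_cong)
    fix z
    have "(\<integral>\<^sup>+y. ennreal (K (x - y) t) * (ennreal (K (y - z) s) * f z) \<partial>lborel) = (\<integral>\<^sup>+y. ennreal (K (x - y) t) * ennreal (K (y - z) s) \<partial>lborel) * f z"
      by (subst nn_integral_multc[symmetric]) (auto simp: mult_ac)
    also have "(\<integral>\<^sup>+y. ennreal (K (x - y) t) * ennreal (K (y - z) s) \<partial>lborel) = (\<integral>\<^sup>+y. ennreal (K ((x - z) - (y - z)) t) * ennreal (K (y - z) s) \<partial>lborel)"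
      by simp
    also have "\<dots> = (\<integral>\<^sup>+y. ennreal (K ((x - z) - y) t) * ennreal (K y s) \<partial>lborel)"
      by (rule nn_integral_lborel_shift) measurable
    also have "\<dots> = ennreal (K (x - z) (t + s))" by (rule K_semigroup[OF assms(2,3)])
    finally show "(\<integral>\<^sup>+y. ennreal (K (x - y) t) * (ennreal (K (y - z) s) * f z) \<partial>lborel) = ennreal (K (x - z) (t + s)) * f z" .
  qed
  finally show ?thesis unfolding heat_def .
qed

lemma heat_jensen:
  assumes "1 < p" and [measurable]: "f \<in> borel_measurable borel" and "0 < t"
  shows "epow p (heat t f x) \<le> heat t (\<lambda>y. epow p (f y)) x"
  unfolding heat_def using assms by (intro epow_jensen) (auto simp: K_mass')

definition duhamel :: "real \<Rightarrow> ('a \<Rightarrow> real \<Rightarrow> ennreal) \<Rightarrow> 'a \<Rightarrow> real \<Rightarrow> ennreal" where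
  "duhamel p u x t = (\<integral>\<^sup>+s. indicator {0<..<t} s * heat (t - s) (\<lambda>y. epow p (u y s)) x \<partial>lborel)"

text \<open>Since \<open>K\<close> vanishes at nonpositive times, the upper limit of integration may
  be dropped; joint measurability in space and time is then immediate.\<close>

lemma duhamel_eq: "duhamel p u x t = (\<integral>\<^sup>+s. indicator {0<..} s * heat (t - s) (\<lambda>y. epow p (u y s)) x \<partial>lborel)"
  unfolding duhamel_def by (intro nn_integral_cong) (auto simp: heat_def K_zero split: split_indicator)

lemma duhamel_measurable [measurable (raw)]:
  assumes [measurable]: "(\<lambda>(x, t). u x t) \<in> borel_measurable (borel \<Otimes>\<^sub>M borel)" "x \<in> borel_measurable M" "t \<in> borel_measurable M"
  shows "(\<lambda>z. duhamel p u (x z) (t z)) \<in> borel_measurable M"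
  unfolding duhamel_eq heat_def by measurable

lemma duhamel_mono_AE:
  assumes "0 < p" "AE (x, t) in lborel. 0 < t \<and> ereal t < T \<longrightarrow> u x t \<le> v x t" "ereal t \<le> T"
  shows "duhamel p u x t \<le> duhamel p v x t"
  unfolding duhamel_def
proof (intro nn_integral_mono_AE)
  have "AE s in lborel. AE x in lborel. 0 < s \<and> ereal s < T \<longrightarrow> u x s \<le> v x s"
    using AE_lborel_swap[OF assms(2)] .
  then show "AE s in lborel. indicator {0<..<t} s * heat (t - s) (\<lambda>y. epow p (u y s)) x \<le> indicator {0<..<t} s * heat (t - s) (\<lambda>y. epow p (v y s)) x"
  proof eventually_elim
    case (elim s)
    show ?case
    proof (cases "s \<in> {0<..<t}")
      case True
      then have "ereal s < ereal t" by simp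
      from less_le_trans[OF this assms(3)] have "0 < s \<and> ereal s < T" using True by simp
      then have "AE x in lborel. epow p (u x s) \<le> epow p (v x s)"
        using elim by (elim eventually_mono) (use \<open>0 < s \<and> ereal s < T\<close> in \<open>auto intro: epow_mono assms(1)\<close>)
      then show ?thesis using True by (auto intro: heat_mono_AE)
    qed simp
  qed
qed

text \<open>Finiteness is part of the notion because the constant \<infinity> would satisfy the
  inequality trivially.\<close>

definition supersolution :: "real \<Rightarrow> ('a \<Rightarrow> ennreal) \<Rightarrow> ereal \<Rightarrow> ('a \<Rightarrow> real \<Rightarrow> ennreal) \<Rightarrow> bool" where
  "supersolution p f T u \<longleftrightarrow> (\<lambda>(x, t). u x t) \<in> borel_measurable (borel \<Otimes>\<^sub>M borel) \<and>
     (AE (x, t) in lborel. 0 < t \<and> ereal t < T \<longrightarrow> u x t < top \<and> heat t f x + duhamel p u x t \<le> u x t)"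

text \<open>Picard iterates starting from 0 increase and, by induction, stay below \<open>v\<close>
  almost everywhere; monotone convergence makes their limit a fixed point. The equation holds at
  every point with values in [0, \<infinity>], and the role of \<open>v\<close> is to keep the limit
  finite almost everywhere.\<close>

lemma solution_of_supersolution:
  assumes p: "0 < p" and [measurable]: "f \<in> borel_measurable borel" and v: "supersolution p f T v"
  obtains u where "(\<lambda>(x, t). u x t) \<in> borel_measurable (borel \<Otimes>\<^sub>M borel)"
    "AE (x, t) in lborel. 0 < t \<and> ereal t < T \<longrightarrow> u x t < top"
    "\<And>x t. u x t = heat t f x + duhamel p u x t"
proof -
  have [measurable]: "(\<lambda>(x, t). v x t) \<in> borel_measurable (borel \<Otimes>\<^sub>M borel)"
    and vs: "AE (x, t) in lborel. 0 < t \<and> ereal t < T \<longrightarrow> v x t < top \<and> heat t f x + duhamel p v x t \<le> v x t"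
    using v by (auto simp: supersolution_def)
  define U where "U = rec_nat (\<lambda>_ _. 0) (\<lambda>_ u x t. heat t f x + duhamel p u x t)"
  have U0: "U 0 = (\<lambda>_ _. 0)" and US: "U (Suc n) = (\<lambda>x t. heat t f x + duhamel p (U n) x t)" for n
    by (simp_all add: U_def)
  have Um[measurable]: "(\<lambda>(x, t). U n x t) \<in> borel_measurable (borel \<Otimes>\<^sub>M borel)" for n
  proof (induction n)
    case (Suc n)
    note Suc[measurable]
    show ?case unfolding US by measurable
  qed (simp add: U0)
  have duh_mono: "duhamel p u x t \<le> duhamel p u' x t" if "\<And>x t. u x t \<le> u' x t" for u u' x t
    unfolding duhamel_def by (intro nn_integral_mono mult_left_mono heat_mono epow_mono p that) auto
  have inc: "U n x t \<le> U (Suc n) x t" for n x t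
  proof (induction n arbitrary: x t)
    case (Suc n)
    have "U (Suc n) x t = heat t f x + duhamel p (U n) x t" by (simp only: US)
    also have "\<dots> \<le> heat t f x + duhamel p (U (Suc n)) x t" by (intro add_left_mono duh_mono Suc)
    also have "\<dots> = U (Suc (Suc n)) x t" by (simp only: US)
    finally show ?case .
  qed (simp add: U0)
  then have incU: "incseq (\<lambda>n. U n x t)" for x t by (rule incseq_SucI)
  have le_v: "AE (x, t) in lborel. 0 < t \<and> ereal t < T \<longrightarrow> U n x t \<le> v x t" for n
  proof (induction n)
    case (Suc n)
    have "duhamel p (U n) x t \<le> duhamel p v x t" if "ereal t < T" for x t
      using duhamel_mono_AE[OF p Suc] that by simp
    with vs show ?case
      unfolding US by (elim eventually_mono) (auto intro: order_trans[OF add_left_mono])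
  qed (simp add: U0)
  define u where "u x t = (SUP n. U n x t)" for x t
  have um: "(\<lambda>(x, t). u x t) \<in> borel_measurable (borel \<Otimes>\<^sub>M borel)"
    unfolding u_def by measurable
  have "AE z in lborel. \<forall>n. (case z of (x, t) \<Rightarrow> 0 < t \<and> ereal t < T \<longrightarrow> U n x t \<le> v x t)"
    using le_v unfolding AE_all_countable by blast
  with vs have fin: "AE (x, t) in lborel. 0 < t \<and> ereal t < T \<longrightarrow> u x t < top"
  proof eventually_elim
    case (elim z)
    then show ?case unfolding u_def by (auto split: prod.splits intro!: le_less_trans[OF SUP_least])
  qed
  have "u x t = heat t f x + duhamel p u x t" for x t
  proof -
    have heat_SUP: "heat r (\<lambda>y. epow p (u y s)) x = (SUP n. heat r (\<lambda>y. epow p (U n y s)) x)" for r s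
    proof -
      have "heat r (\<lambda>y. epow p (u y s)) x = (\<integral>\<^sup>+y. (SUP n. ennreal (K (x - y) r) * epow p (U n y s)) \<partial>lborel)"
        unfolding heat_def u_def by (intro nn_integral_cong) (simp add: epow_SUP[OF p incU] SUP_mult_left_ennreal)
      also have "\<dots> = (SUP n. heat r (\<lambda>y. epow p (U n y s)) x)"
        unfolding heat_def using inc p
        by (intro nn_integral_monotone_convergence_SUP) (auto intro!: incseq_SucI le_funI mult_left_mono epow_mono)
      finally show ?thesis .
    qed
    have "duhamel p u x t = (\<integral>\<^sup>+s. (SUP n. indicator {0<..<t} s * heat (t - s) (\<lambda>y. epow p (U n y s)) x) \<partial>lborel)"
      unfolding duhamel_def by (intro nn_integral_cong) (simp add: heat_SUP SUP_mult_left_ennreal)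
    also have "\<dots> = (SUP n. duhamel p (U n) x t)"
      unfolding duhamel_def using inc p
      by (intro nn_integral_monotone_convergence_SUP) (auto intro!: incseq_SucI le_funI mult_left_mono heat_mono epow_mono)
    finally have "heat t f x + duhamel p u x t = (SUP n. U (Suc n) x t)"
      unfolding US by (simp add: ennreal_SUP_add_right)
    also have "\<dots> = u x t"
      unfolding u_def using incU by (intro antisym SUP_mono) (auto intro: inc)
    finally show ?thesis by simp
  qed
  with um fin show ?thesis using that by blast
qed

end

section \<open>Necessary conditions for solvability\<close>

lemma AE_lborel_witness:
  assumes "AE x in lborel. P x" "emeasure lborel S \<noteq> 0" "S \<in> sets lborel"
  obtains x where "x \<in> S" "P x"
proof (rule ccontr)
  assume "\<not> thesis"
  then have "\<And>x. x \<in> S \<Longrightarrow> \<not> P x" using that by blast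
  then have "AE x in lborel. x \<notin> S" using assms(1) by (auto elim: eventually_mono)
  then have "S \<in> null_sets lborel" using AE_iff_null_sets[OF assms(3)] by simp
  then show False using assms(2) by auto
qed

lemma nn_integral_inverse:
  fixes s t :: real
  assumes "0 < s" "s \<le> t"
  shows "(\<integral>\<^sup>+r. indicator {s<..t} r * ennreal (1 / r) \<partial>lborel) = ennreal (ln (t / s))"
proof -
  have "(\<integral>\<^sup>+r. indicator {s<..t} r * ennreal (1 / r) \<partial>lborel) = (\<integral>\<^sup>+r. ennreal (1 / r) * indicator {s..t} r \<partial>lborel)"
    by (intro nn_integral_cong_AE eventually_mono[OF AE_lborel_singleton[of s]]) (auto split: split_indicator)
  also have "\<dots> = ennreal (ln t - ln s)"
    using assms by (intro nn_integral_FTC_Icc) (auto intro!: derivative_eq_intros)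
  finally show ?thesis using assms by (simp add: ln_div)
qed

text \<open>The value doubles along the times \<open>\<rho> exp \<tau>\<^sub>k\<close> whose increments in logarithmic time decay
  geometrically, so it blows up in finite logarithmic time.\<close>

lemma log_time_blowup:
  fixes F :: "real \<Rightarrow> ennreal"
  assumes p: "1 < p" and \<rho>: "0 < \<rho>" "\<rho> < R" and a: "0 < a" and c: "0 < c"
    and F\<rho>: "ennreal a \<le> F \<rho>"
    and F: "\<And>s t. \<rho> \<le> s \<Longrightarrow> s \<le> t \<Longrightarrow> t \<le> R \<Longrightarrow>
      F s + ennreal c * (\<integral>\<^sup>+r. indicator {s<..t} r * (ennreal (1 / r) * epow p (F r)) \<partial>lborel) \<le> F t"
    and fin: "F R < top"
  shows "a powr (p - 1) * c * ln (R / \<rho>) \<le> 1 / (1 - 2 powr (1 - p))"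
proof (rule ccontr)
  assume "\<not> ?thesis"
  then have big: "1 / (1 - 2 powr (1 - p)) < a powr (p - 1) * c * ln (R / \<rho>)" by simp
  define x where "x = 2 powr (1 - p)"
  have x: "0 < x" "x < 1" using p by (auto simp: x_def intro: powr_less_one)
  \<comment> \<open>\<open>A * x ^ k\<close> is the logarithmic time in which the value grows from
    \<open>2 ^ k * a\<close> to \<open>2 ^ (k + 1) * a\<close> when the nonlinearity is frozen at
    \<open>(2 ^ k * a) powr p\<close>. All steps together take \<open>A / (1 - x)\<close>, which the
    negated claim makes smaller than \<open>ln (R / \<rho>)\<close>.\<close>
  define A where "A = a powr (1 - p) / c"
  have A: "A > 0" using a c by (simp add: A_def)
  define \<tau> where "\<tau> k = A * (\<Sum>j<k. x ^ j)" for k :: nat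
  have \<tau>_le: "\<tau> k \<le> ln (R / \<rho>)" for k
  proof -
    have "(\<Sum>j<k. x ^ j) \<le> 1 / (1 - x)"
      using x by (simp add: sum_gp_strict divide_right_mono)
    then have "\<tau> k \<le> A * (1 / (1 - x))" unfolding \<tau>_def using A by (intro mult_left_mono) auto
    also have "\<dots> \<le> A * (a powr (p - 1) * c * ln (R / \<rho>))" using big A unfolding x_def by (intro mult_left_mono) auto
    also have "\<dots> = (a powr (1 - p) * a powr (p - 1)) * ln (R / \<rho>)" using c by (simp add: A_def)
    also have "a powr (1 - p) * a powr (p - 1) = 1" using a by (simp flip: powr_add)
    finally show ?thesis by simp
  qed
  define t where "t k = \<rho> * exp (\<tau> k)" for k
  have t_pos: "0 < t k" for k using \<rho> by (simp add: t_def)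
  have t_le: "t k \<le> R" for k
  proof -
    have "exp (\<tau> k) \<le> exp (ln (R / \<rho>))" using \<tau>_le by simp
    also have "\<dots> = R / \<rho>" using \<rho> by simp
    finally show ?thesis using \<rho> by (simp add: t_def field_simps)
  qed
  have \<tau>_nonneg: "0 \<le> \<tau> k" for k unfolding \<tau>_def using A x by (intro mult_nonneg_nonneg sum_nonneg) auto
  have t_ge: "\<rho> \<le> t k" for k using \<rho> \<tau>_nonneg[of k] by (simp add: t_def)
  have \<tau>_Suc: "\<tau> (Suc k) = \<tau> k + A * x ^ k" for k by (simp add: \<tau>_def algebra_simps)
  have t_Suc: "t k \<le> t (Suc k)" for k using \<rho> A x by (simp add: t_def \<tau>_Suc)
  have mono: "F s \<le> F r" if "\<rho> \<le> s" "s \<le> r" "r \<le> R" for s r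
    using order_trans[OF _ F[OF that]] by simp
  have grow: "ennreal (2 ^ k * a) \<le> F (t k)" for k
  proof (induction k)
    case 0
    then show ?case using F\<rho> by (simp add: t_def \<tau>_def)
  next
    case (Suc k)
    have "ennreal (2 ^ Suc k * a) = ennreal (2 ^ k * a) + ennreal c * (epow p (ennreal (2 ^ k * a)) * ennreal (ln (t (Suc k) / t k)))"
    proof -
      have "t (Suc k) / t k = exp (A * x ^ k)" using \<rho> by (simp add: t_def \<tau>_Suc exp_add)
      then have "ln (t (Suc k) / t k) = A * x ^ k" by simp
      moreover have "x ^ k = (2 ^ k) powr (1 - p)"
        by (simp add: x_def powr_powr mult.commute flip: powr_realpow)
      moreover have "c * ((2 ^ k * a) powr p * (A * (2 ^ k) powr (1 - p))) = 2 ^ k * a"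
      proof -
        have "c * ((2 ^ k * a) powr p * (A * (2 ^ k) powr (1 - p))) = (2 ^ k * a) powr p * (2 ^ k * a) powr (1 - p)"
          using a c by (simp add: A_def powr_mult)
        also have "\<dots> = (2 ^ k * a) powr 1" using a by (simp only: powr_add[symmetric]) simp
        finally show ?thesis using a by simp
      qed
      ultimately show ?thesis
        using a c A by (simp add: ennreal_mult[symmetric] ennreal_plus[symmetric] del: ennreal_plus)
    qed
    also have "epow p (ennreal (2 ^ k * a)) * ennreal (ln (t (Suc k) / t k)) = (\<integral>\<^sup>+r. epow p (ennreal (2 ^ k * a)) * (indicator {t k<..t (Suc k)} r * ennreal (1 / r)) \<partial>lborel)"
      using nn_integral_inverse[OF t_pos t_Suc, of k] by (simp add: nn_integral_cmult)
    also have "\<dots> \<le> (\<integral>\<^sup>+r. indicator {t k<..t (Suc k)} r * (ennreal (1 / r) * epow p (F r)) \<partial>lborel)"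
    proof (intro nn_integral_mono)
      fix r
      show "epow p (ennreal (2 ^ k * a)) * (indicator {t k<..t (Suc k)} r * ennreal (1 / r)) \<le> indicator {t k<..t (Suc k)} r * (ennreal (1 / r) * epow p (F r))"
      proof (cases "r \<in> {t k<..t (Suc k)}")
        case True
        have "F (t k) \<le> F r" using True t_ge[of k] t_le[of "Suc k"] by (intro mono) auto
        then have "epow p (ennreal (2 ^ k * a)) \<le> epow p (F r)"
          using Suc p by (intro epow_mono) auto
        then show ?thesis using True by (simp add: mult.commute mult_left_mono)
      qed simp
    qed
    also have "ennreal (2 ^ k * a) + ennreal c * (\<integral>\<^sup>+r. indicator {t k<..t (Suc k)} r * (ennreal (1 / r) * epow p (F r)) \<partial>lborel)
       \<le> F (t k) + ennreal c * (\<integral>\<^sup>+r. indicator {t k<..t (Suc k)} r * (ennreal (1 / r) * epow p (F r)) \<partial>lborel)"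
      by (intro add_right_mono Suc)
    also have "\<dots> \<le> F (t (Suc k))" by (rule F[OF t_ge t_Suc t_le])
    finally show ?case by (simp add: add_left_mono mult_left_mono)
  qed
  obtain r where r: "F R = ennreal r" "0 \<le> r" using fin by (cases "F R") auto
  have "2 ^ k * a \<le> r" for k
  proof -
    have "ennreal (2 ^ k * a) \<le> F R" using order_trans[OF grow mono[OF t_ge t_le]] by simp
    then show ?thesis using r by simp
  qed
  moreover obtain k where "r / a < 2 ^ k" using real_arch_pow[of 2 "r / a"] by auto
  ultimately show False using a by (simp add: field_simps) (metis not_less mult.commute)
qed

context heat_semigroup
begin

lemma q_pos: "0 < q" using \<theta>_pos by (simp add: q_def)

text \<open>By self-similarity both sides are \<open>r powr - q\<close> times a value of the profile
  at time 1; the later time rescales \<open>z\<close> closer to the origin, where the profile is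
  larger.\<close>

lemma K_time_compare:
  assumes "0 < s" "s \<le> r"
  shows "(s / r) powr q * K z s \<le> K z r"
proof -
  have "norm (r powr (- (1 / \<theta>)) *\<^sub>R z) \<le> norm (s powr (- (1 / \<theta>)) *\<^sub>R z)"
    using assms \<theta>_pos by (simp add: mult_right_mono powr_mono2')
  then have "K (s powr (- (1 / \<theta>)) *\<^sub>R z) 1 \<le> K (r powr (- (1 / \<theta>)) *\<^sub>R z) 1"
    by (rule K_antimono)
  then have "r powr - q * K (s powr (- (1 / \<theta>)) *\<^sub>R z) 1 \<le> K z r"
    using K_scale[of r z] assms by (simp add: q_def mult_left_mono)
  moreover have "(s / r) powr q * K z s = r powr - q * K (s powr (- (1 / \<theta>)) *\<^sub>R z) 1"
    using K_scale[of s z] assms by (simp add: q_def[symmetric] powr_divide powr_minus field_simps)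
  ultimately show ?thesis by simp
qed

lemma heat_time_compare:
  assumes "0 < s" "s \<le> r"  and [measurable]: "f \<in> borel_measurable borel"
  shows "ennreal ((s / r) powr q) * heat s f x \<le> heat r f x"
proof -
  have "ennreal ((s / r) powr q) * heat s f x = (\<integral>\<^sup>+y. ennreal ((s / r) powr q * K (x - y) s) * f y \<partial>lborel)"
    unfolding heat_def by (subst nn_integral_cmult[symmetric]) (auto simp: ennreal_mult K_nonneg mult_ac)
  also have "\<dots> \<le> heat r f x"
    unfolding heat_def by (intro nn_integral_mono mult_right_mono ennreal_leI K_time_compare assms) auto
  finally show ?thesis .
qed

text \<open>Points of the ball are less than \<open>2 * \<rho> powr (1 / \<theta>)\<close> apart,
  and rescaling by a time beyond \<rho> brings this distance to at most 2. Hence the value of the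
  profile at a vector \<open>e\<close> of norm 2 serves as the lower constant.\<close>

lemma K_ball_lower:
  assumes "0 < \<rho>" "2 * \<rho> \<le> t" "norm e = 2" "norm x < \<rho> powr (1 / \<theta>)" "norm y < \<rho> powr (1 / \<theta>)"
  shows "t powr - q * K e 1 \<le> K (x - y) t"
proof -
  have "norm (x - y) \<le> 2 * \<rho> powr (1 / \<theta>)"
    using norm_triangle_ineq4[of x y] assms by simp
  then have "norm (t powr (- (1 / \<theta>)) *\<^sub>R (x - y)) \<le> t powr (- (1 / \<theta>)) * (2 * \<rho> powr (1 / \<theta>))"
    by (simp add: mult_left_mono)
  also have "\<dots> \<le> \<rho> powr (- (1 / \<theta>)) * (2 * \<rho> powr (1 / \<theta>))"
    using assms \<theta>_pos by (intro mult_right_mono powr_mono2') auto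
  also have "\<dots> = 2" using assms by (simp add: powr_minus)
  finally have "K e 1 \<le> K (t powr (- (1 / \<theta>)) *\<^sub>R (x - y)) 1"
    using assms by (intro K_antimono) simp
  then show ?thesis
    using K_scale[of t "x - y"] assms by (simp add: q_def mult_left_mono)
qed

lemma heat_ball_lower:
  assumes "0 < \<rho>" "2 * \<rho> \<le> t" "norm e = 2" "norm x < \<rho> powr (1 / \<theta>)" and [measurable]: "f \<in> borel_measurable borel"
  shows "ennreal (t powr - q * K e 1) * (\<integral>\<^sup>+y. indicator (ball 0 (\<rho> powr (1 / \<theta>))) y * f y \<partial>lborel) \<le> heat t f x"
proof -
  note borel_open[OF open_ball, measurable]
  have "ennreal (t powr - q * K e 1) * (\<integral>\<^sup>+y. indicator (ball 0 (\<rho> powr (1 / \<theta>))) y * f y \<partial>lborel)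
    = (\<integral>\<^sup>+y. ennreal (t powr - q * K e 1) * (indicator (ball 0 (\<rho> powr (1 / \<theta>))) y * f y) \<partial>lborel)"
    by (subst nn_integral_cmult) auto
  also have "\<dots> \<le> heat t f x"
    unfolding heat_def
  proof (intro nn_integral_mono)
    fix y
    show "ennreal (t powr - q * K e 1) * (indicator (ball 0 (\<rho> powr (1 / \<theta>))) y * f y) \<le> ennreal (K (x - y) t) * f y"
      using K_ball_lower[OF assms(1-4), of y]
      by (cases "y \<in> ball 0 (\<rho> powr (1 / \<theta>))") (auto intro!: mult_right_mono ennreal_leI)
  qed
  finally show ?thesis .
qed

text \<open>The point of averaging once more by \<open>heat t\<close>: the kernel in the Duhamel
  term moves from time \<open>t - s\<close>, which degenerates at \<open>s = t\<close>, to
  \<open>2 * t - s\<close>. This is larger than \<open>s\<close>, so the kernel there can be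
  compared with the one at time \<open>s\<close>.\<close>

lemma heat_duhamel:
  assumes [measurable]: "(\<lambda>(x, t). u x t) \<in> borel_measurable (borel \<Otimes>\<^sub>M borel)" and t: "0 < t"
  shows "heat t (\<lambda>x. duhamel p u x t) z = (\<integral>\<^sup>+s. indicator {0<..<t} s * heat (2 * t - s) (\<lambda>y. epow p (u y s)) z \<partial>lborel)"
proof -
  have "heat t (\<lambda>x. duhamel p u x t) z = (\<integral>\<^sup>+x. (\<integral>\<^sup>+s. ennreal (K (z - x) t) * (indicator {0<..<t} s * heat (t - s) (\<lambda>y. epow p (u y s)) x) \<partial>lborel) \<partial>lborel)"
    unfolding heat_def[of t] duhamel_def by (intro nn_integral_cong nn_integral_cmult[symmetric]) measurable
  also have "\<dots> = (\<integral>\<^sup>+s. (\<integral>\<^sup>+x. ennreal (K (z - x) t) * (indicator {0<..<t} s * heat (t - s) (\<lambda>y. epow p (u y s)) x) \<partial>lborel) \<partial>lborel)"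
    by (rule lborel_pair.Fubini') measurable
  also have "\<dots> = (\<integral>\<^sup>+s. indicator {0<..<t} s * heat (2 * t - s) (\<lambda>y. epow p (u y s)) z \<partial>lborel)"
  proof (intro nn_integral_cong)
    fix s
    have "(\<integral>\<^sup>+x. ennreal (K (z - x) t) * (indicator {0<..<t} s * heat (t - s) (\<lambda>y. epow p (u y s)) x) \<partial>lborel)
      = indicator {0<..<t} s * heat t (heat (t - s) (\<lambda>y. epow p (u y s))) z"
      unfolding heat_def[of t] by (subst nn_integral_cmult[symmetric]) (auto simp: mult_ac)
    also have "\<dots> = indicator {0<..<t} s * heat (2 * t - s) (\<lambda>y. epow p (u y s)) z"
      using t by (cases "s \<in> {0<..<t}") (auto simp: heat_heat)
    finally show "(\<integral>\<^sup>+x. ennreal (K (z - x) t) * (indicator {0<..<t} s * heat (t - s) (\<lambda>y. epow p (u y s)) x) \<partial>lborel) = indicator {0<..<t} s * heat (2 * t - s) (\<lambda>y. epow p (u y s)) z" .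
  qed
  finally show ?thesis .
qed

text \<open>\<open>F\<close> is a lower bound for \<open>t powr q\<close> times the solution
  averaged by \<open>heat t\<close> at \<open>x0\<close>. It is defined through the right-hand side
  of the equation, so that it is monotone and its increments are exact integrals. Jensen bounds
  \<open>Z s\<close> below by the \<open>p\<close>-th power of \<open>s powr - q * F s\<close>; with
  the weight \<open>s powr q\<close> this leaves \<open>s powr (- \<kappa>)\<close>, and
  \<open>1 \<le> \<kappa>\<close> allows \<open>R powr (1 - \<kappa>) / s\<close> in its place, the
  form that blows up in logarithmic time.\<close>

lemma necessary_condition:
  assumes p: "1 < p" and \<kappa>: "1 \<le> q * (p - 1)" and f[measurable]: "f \<in> borel_measurable borel"
    and U: "supersolution p f (ereal T) U"
    and \<rho>: "0 < \<rho>" "\<rho> < R" "2 * R < T" and e: "norm e = 2"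
    and m: "ennreal m \<le> (\<integral>\<^sup>+y. indicator (ball 0 (\<rho> powr (1 / \<theta>))) y * f y \<partial>lborel)" "0 < m"
  shows "(2 powr - q * K e 1 * m) powr (p - 1) * (2 powr - q * R powr (1 - q * (p - 1))) * ln (R / \<rho>) \<le> 1 / (1 - 2 powr (1 - p))"
proof -
  define \<kappa> where "\<kappa> = q * (p - 1)"
  define M where "M = (\<integral>\<^sup>+y. indicator (ball 0 (\<rho> powr (1 / \<theta>))) y * f y \<partial>lborel)"
  have [measurable]: "(\<lambda>(x, t). U x t) \<in> borel_measurable (borel \<Otimes>\<^sub>M borel)"
    and Us: "AE (x, t) in lborel. 0 < t \<and> ereal t < ereal T \<longrightarrow> U x t < top \<and> heat t f x + duhamel p U x t \<le> U x t"
    using U by (auto simp: supersolution_def)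
  have AEt: "AE t in lborel. AE x in lborel. 0 < t \<and> ereal t < ereal T \<longrightarrow> U x t < top \<and> heat t f x + duhamel p U x t \<le> U x t"
    by (rule AE_lborel_swap[OF Us])
  \<comment> \<open>The inequality holds only almost everywhere, so a time and a point are picked
    where it does. A time \<open>t0\<close> beyond \<open>2 * R\<close> has
    \<open>s \<le> t0 - s\<close> for all \<open>s \<le> R\<close>, and finiteness of
    \<open>U x0 t0\<close> then makes \<open>F R\<close> finite.\<close>
  have "emeasure lborel {2 * R<..<T} \<noteq> 0" using \<rho> by simp
  from AE_lborel_witness[OF AEt this] obtain t0 where t0: "2 * R < t0" "t0 < T"
    and AEx: "AE x in lborel. 0 < t0 \<and> ereal t0 < ereal T \<longrightarrow> U x t0 < top \<and> heat t0 f x + duhamel p U x t0 \<le> U x t0"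
    by auto
  have "emeasure lborel (ball (0::'a) (\<rho> powr (1 / \<theta>))) \<noteq> 0" using \<rho> by (simp add: emeasure_ball less_imp_neq[OF unit_ball_vol_pos, symmetric])
  from AE_lborel_witness[OF AEx this] obtain x0 where "x0 \<in> ball (0::'a) (\<rho> powr (1 / \<theta>))"
    and x0': "0 < t0 \<and> ereal t0 < ereal T \<longrightarrow> U x0 t0 < top \<and> heat t0 f x0 + duhamel p U x0 t0 \<le> U x0 t0"
    by auto
  then have x0: "norm x0 < \<rho> powr (1 / \<theta>)" "U x0 t0 < top" "heat t0 f x0 + duhamel p U x0 t0 \<le> U x0 t0"
    using t0 \<rho> by auto
  define Z where "Z s = heat s (\<lambda>y. epow p (U y s)) x0" for s
  have Zm[measurable]: "Z \<in> borel_measurable borel" unfolding Z_def by measurable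
  define c1 where "c1 = 2 powr - q"
  have c1: "0 < c1" by (simp add: c1_def)
  define F where "F t = ennreal (c1 * K e 1) * M + ennreal c1 * (\<integral>\<^sup>+s. indicator {\<rho><..t} s * (ennreal (s powr q) * Z s) \<partial>lborel)" for t
  \<comment> \<open>The moving interval is rewritten as a Borel set in the plane, which makes
    \<open>F\<close> measurable.\<close>
  define S where "S = {z :: real \<times> real. \<rho> < snd z \<and> snd z \<le> fst z}"
  have "open {z :: real \<times> real. \<rho> < snd z}" "closed {z :: real \<times> real. snd z \<le> fst z}"
    by (intro open_Collect_less closed_Collect_le continuous_intros)+
  then have "{z :: real \<times> real. \<rho> < snd z} \<inter> {z. snd z \<le> fst z} \<in> sets borel"
    by (intro sets.Int) (auto intro: borel_open borel_closed)
  moreover have "S = {z. \<rho> < snd z} \<inter> {z. snd z \<le> fst z}" by (auto simp: S_def)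
  ultimately have [measurable]: "S \<in> sets (borel \<Otimes>\<^sub>M borel)" unfolding borel_prod by simp
  have "F = (\<lambda>t. ennreal (c1 * K e 1) * M + ennreal c1 * (\<integral>\<^sup>+s. indicator S (t, s) * (ennreal (s powr q) * Z s) \<partial>lborel))"
    unfolding F_def S_def by (intro ext arg_cong2[where f="(+)"] arg_cong2[where f="(*)"] refl nn_integral_cong) (auto split: split_indicator)
  then have Fm[measurable]: "F \<in> borel_measurable borel" by simp
  have M_fin: "M < top"
  proof -
    have "ennreal (t0 powr - q * K e 1) * M \<le> heat t0 f x0"
      unfolding M_def using t0 \<rho> x0 e by (intro heat_ball_lower) auto
    also have "\<dots> \<le> U x0 t0" by (rule order_trans[OF _ x0(3)]) (simp add: add_increasing add_increasing2)
    finally have "ennreal (t0 powr - q * K e 1) * M < top" using x0(2) by (rule le_less_trans)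
    moreover have "0 < t0 powr - q * K e 1" using K_pos[of 1 e] t0 \<rho> by simp
    ultimately show ?thesis by (auto simp: ennreal_mult_less_top)
  qed
  have F_fin: "F R < top"
  proof -
    have "(\<integral>\<^sup>+s. indicator {\<rho><..R} s * (ennreal (t0 powr - q) * (ennreal (s powr q) * Z s)) \<partial>lborel) \<le> duhamel p U x0 t0"
      unfolding duhamel_def
    proof (intro nn_integral_mono)
      fix s
      show "indicator {\<rho><..R} s * (ennreal (t0 powr - q) * (ennreal (s powr q) * Z s)) \<le> indicator {0<..<t0} s * heat (t0 - s) (\<lambda>y. epow p (U y s)) x0"
      proof (cases "s \<in> {\<rho><..R}")
        case True
        then have s: "0 < s" "s \<le> t0 - s" "s < t0" using \<rho> t0 by auto
        have "s powr q * t0 powr - q \<le> (s / (t0 - s)) powr q"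
        proof -
          have "s powr q * t0 powr - q = (s / t0) powr q" using s by (simp add: powr_divide powr_minus field_simps)
          also have "\<dots> \<le> (s / (t0 - s)) powr q" using s q_pos by (intro powr_mono2 divide_left_mono) auto
          finally show ?thesis .
        qed
        then have "ennreal (t0 powr - q) * (ennreal (s powr q) * Z s) \<le> ennreal ((s / (t0 - s)) powr q) * Z s"
          by (simp add: ennreal_mult[symmetric] mult.assoc[symmetric] mult.commute[of "t0 powr - q"] mult_right_mono ennreal_leI)
        also have "\<dots> \<le> heat (t0 - s) (\<lambda>y. epow p (U y s)) x0"
          unfolding Z_def by (rule heat_time_compare) (use s in auto)
        finally show ?thesis using True s by simp
      qed simp
    qed
    also have "\<dots> \<le> U x0 t0" by (rule order_trans[OF _ x0(3)]) (simp add: add_increasing add_increasing2)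
    finally have "(\<integral>\<^sup>+s. ennreal (t0 powr - q) * (indicator {\<rho><..R} s * (ennreal (s powr q) * Z s)) \<partial>lborel) < top"
      using x0(2) by (simp add: mult.left_commute)
    then have "ennreal (t0 powr - q) * (\<integral>\<^sup>+s. indicator {\<rho><..R} s * (ennreal (s powr q) * Z s) \<partial>lborel) < top"
      by (subst (asm) nn_integral_cmult) auto
    then have "(\<integral>\<^sup>+s. indicator {\<rho><..R} s * (ennreal (s powr q) * Z s) \<partial>lborel) < top"
      using t0 \<rho> by (auto simp: ennreal_mult_less_top)
    then show ?thesis unfolding F_def using M_fin by (auto simp: ennreal_mult_less_top)
  qed
  \<comment> \<open>The slice at time \<open>t\<close> is averaged by \<open>heat t\<close>: the
    data then appear at time \<open>2 * t\<close>, and both parts carry the factor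
    \<open>c1\<close>, which comes from \<open>(2 * t) powr - q\<close>.\<close>
  have W: "AE t in lborel. \<rho> < t \<and> t \<le> R \<longrightarrow> ennreal (t powr - q) * F t \<le> heat t (\<lambda>y. U y t) x0"
    using AEt
  proof eventually_elim
    case (elim t)
    show ?case
    proof
      assume t: "\<rho> < t \<and> t \<le> R"
      then have tT: "0 < t" "t < T" using \<rho> by auto
      have "ennreal ((2 * t) powr - q * K e 1) * M \<le> heat (2 * t) f x0"
        unfolding M_def using t \<rho> x0 e by (intro heat_ball_lower) auto
      moreover have "(2 * t) powr - q = t powr - q * c1" using tT by (simp add: c1_def powr_mult)
      ultimately have 1: "ennreal (t powr - q) * (ennreal (c1 * K e 1) * M) \<le> heat (2 * t) f x0"
        using c1 K_nonneg[of e 1] by (simp add: ennreal_mult mult.assoc)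
      have "ennreal (t powr - q) * (ennreal c1 * (\<integral>\<^sup>+s. indicator {\<rho><..t} s * (ennreal (s powr q) * Z s) \<partial>lborel))
         = (\<integral>\<^sup>+s. ennreal (t powr - q * c1) * (indicator {\<rho><..t} s * (ennreal (s powr q) * Z s)) \<partial>lborel)"
        using c1 by (subst nn_integral_cmult) (auto simp: ennreal_mult mult.assoc)
      also have "\<dots> = (\<integral>\<^sup>+s. ennreal (t powr - q * c1) * (indicator {\<rho><..<t} s * (ennreal (s powr q) * Z s)) \<partial>lborel)"
        by (intro nn_integral_cong_AE eventually_mono[OF AE_lborel_singleton[of t]]) (auto split: split_indicator)
      also have "\<dots> \<le> (\<integral>\<^sup>+s. indicator {0<..<t} s * heat (2 * t - s) (\<lambda>y. epow p (U y s)) x0 \<partial>lborel)"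
      proof (intro nn_integral_mono)
        fix s
        show "ennreal (t powr - q * c1) * (indicator {\<rho><..<t} s * (ennreal (s powr q) * Z s)) \<le> indicator {0<..<t} s * heat (2 * t - s) (\<lambda>y. epow p (U y s)) x0"
        proof (cases "s \<in> {\<rho><..<t}")
          case True
          then have s: "0 < s" "s \<le> 2 * t - s" "s < t" using \<rho> by auto
          have "t powr - q * c1 * s powr q \<le> (s / (2 * t - s)) powr q"
          proof -
            have "t powr - q * c1 * s powr q = (s / (2 * t)) powr q" using s by (simp add: c1_def powr_divide powr_mult powr_minus field_simps)
            also have "\<dots> \<le> (s / (2 * t - s)) powr q" using s q_pos by (intro powr_mono2 divide_left_mono) auto
            finally show ?thesis .
          qed
          then have "ennreal (t powr - q * c1 * s powr q) * Z s \<le> ennreal ((s / (2 * t - s)) powr q) * Z s"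
            by (intro mult_right_mono ennreal_leI) auto
          also have "\<dots> \<le> heat (2 * t - s) (\<lambda>y. epow p (U y s)) x0"
            unfolding Z_def by (rule heat_time_compare) (use s in auto)
          finally show ?thesis using True s c1 by (simp add: ennreal_mult mult.assoc)
        qed simp
      qed
      also have "\<dots> = heat t (\<lambda>x. duhamel p U x t) x0"
        by (rule heat_duhamel[symmetric]) (use tT in measurable)
      finally have 2: "ennreal (t powr - q) * (ennreal c1 * (\<integral>\<^sup>+s. indicator {\<rho><..t} s * (ennreal (s powr q) * Z s) \<partial>lborel)) \<le> heat t (\<lambda>x. duhamel p U x t) x0" .
      have "ennreal (t powr - q) * F t \<le> heat (2 * t) f x0 + heat t (\<lambda>x. duhamel p U x t) x0"
        unfolding F_def distrib_left by (intro add_mono 1 2)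
      also have "\<dots> = heat t (\<lambda>x. heat t f x + duhamel p U x t) x0"
        using tT by (subst heat_add) (auto simp: heat_heat)
      also have "\<dots> \<le> heat t (\<lambda>y. U y t) x0"
        using elim tT by (intro heat_mono_AE) (auto elim: eventually_mono)
      finally show "ennreal (t powr - q) * F t \<le> heat t (\<lambda>y. U y t) x0" .
    qed
  qed
  have Z_ge: "AE s in lborel. \<rho> < s \<and> s \<le> R \<longrightarrow> ennreal (R powr (1 - \<kappa>)) * (ennreal (1 / s) * epow p (F s)) \<le> ennreal (s powr q) * Z s"
    using W
  proof eventually_elim
    case (elim s)
    show ?case
    proof
      assume s: "\<rho> < s \<and> s \<le> R"
      then have s0: "0 < s" using \<rho> by auto
      have "epow p (ennreal (s powr - q) * F s) \<le> epow p (heat s (\<lambda>y. U y s) x0)"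
        using elim s p by (intro epow_mono) auto
      also have "\<dots> \<le> Z s" unfolding Z_def by (rule heat_jensen) (use p s0 in auto)
      finally have "ennreal (s powr q) * (ennreal ((s powr - q) powr p) * epow p (F s)) \<le> ennreal (s powr q) * Z s"
        using p by (intro mult_left_mono) (auto simp: epow_mult)
      moreover have "R powr (1 - \<kappa>) * (1 / s) \<le> s powr q * (s powr - q) powr p"
      proof -
        have "s powr q * (s powr - q) powr p = s powr (- \<kappa>)"
          by (simp add: powr_powr \<kappa>_def algebra_simps flip: powr_add)
        also have "s powr (- \<kappa>) = s powr (1 - \<kappa>) * (1 / s)"
          using s0 by (simp add: powr_diff powr_minus field_simps)
        moreover have "R powr (1 - \<kappa>) \<le> s powr (1 - \<kappa>)"
          using s s0 assms(2) by (intro powr_mono2') (auto simp: \<kappa>_def)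
        ultimately show ?thesis using s0 by (simp add: divide_right_mono)
      qed
      then have "ennreal (R powr (1 - \<kappa>) * (1 / s)) * epow p (F s) \<le> ennreal (s powr q * (s powr - q) powr p) * epow p (F s)"
        by (intro mult_right_mono ennreal_leI) auto
      ultimately show "ennreal (R powr (1 - \<kappa>)) * (ennreal (1 / s) * epow p (F s)) \<le> ennreal (s powr q) * Z s"
        using s0 by (simp only: ennreal_mult powr_ge_zero divide_nonneg_pos zero_le_one mult.assoc)
    qed
  qed
  have step: "F s + ennreal (c1 * R powr (1 - \<kappa>)) * (\<integral>\<^sup>+r. indicator {s<..t} r * (ennreal (1 / r) * epow p (F r)) \<partial>lborel) \<le> F t"
    if st: "\<rho> \<le> s" "s \<le> t" "t \<le> R" for s t
  proof -
    have "ennreal (c1 * R powr (1 - \<kappa>)) * (\<integral>\<^sup>+r. indicator {s<..t} r * (ennreal (1 / r) * epow p (F r)) \<partial>lborel)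
      = ennreal c1 * (\<integral>\<^sup>+r. indicator {s<..t} r * (ennreal (R powr (1 - \<kappa>)) * (ennreal (1 / r) * epow p (F r))) \<partial>lborel)"
      using c1 by (simp add: nn_integral_cmult[symmetric] ennreal_mult mult_ac)
    also have "\<dots> \<le> ennreal c1 * (\<integral>\<^sup>+r. indicator {s<..t} r * (ennreal (r powr q) * Z r) \<partial>lborel)"
    proof (intro mult_left_mono nn_integral_mono_AE)
      show "AE r in lborel. indicator {s<..t} r * (ennreal (R powr (1 - \<kappa>)) * (ennreal (1 / r) * epow p (F r))) \<le> indicator {s<..t} r * (ennreal (r powr q) * Z r)"
        using Z_ge by eventually_elim (use st in \<open>auto split: split_indicator\<close>)
    qed simp
    finally have "F s + ennreal (c1 * R powr (1 - \<kappa>)) * (\<integral>\<^sup>+r. indicator {s<..t} r * (ennreal (1 / r) * epow p (F r)) \<partial>lborel)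
      \<le> F s + ennreal c1 * (\<integral>\<^sup>+r. indicator {s<..t} r * (ennreal (r powr q) * Z r) \<partial>lborel)" by (rule add_left_mono)
    also have "\<dots> = F t"
    proof -
      have "(\<integral>\<^sup>+r. indicator {\<rho><..t} r * (ennreal (r powr q) * Z r) \<partial>lborel)
        = (\<integral>\<^sup>+r. indicator {\<rho><..s} r * (ennreal (r powr q) * Z r) + indicator {s<..t} r * (ennreal (r powr q) * Z r) \<partial>lborel)"
        using st by (intro nn_integral_cong) (auto split: split_indicator)
      also have "\<dots> = (\<integral>\<^sup>+r. indicator {\<rho><..s} r * (ennreal (r powr q) * Z r) \<partial>lborel) + (\<integral>\<^sup>+r. indicator {s<..t} r * (ennreal (r powr q) * Z r) \<partial>lborel)"
        by (rule nn_integral_add) measurable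
      finally show ?thesis unfolding F_def by (simp add: distrib_left add.assoc)
    qed
    finally show ?thesis .
  qed
  have Ke: "0 < K e 1" by (rule K_pos) simp
  have F\<rho>: "ennreal (c1 * K e 1 * m) \<le> F \<rho>"
  proof -
    have "ennreal (c1 * K e 1 * m) = ennreal (c1 * K e 1) * ennreal m" using c1 Ke m by (simp add: ennreal_mult)
    also have "\<dots> \<le> ennreal (c1 * K e 1) * M" unfolding M_def by (intro mult_left_mono m) auto
    also have "\<dots> \<le> F \<rho>" unfolding F_def by simp
    finally show ?thesis .
  qed
  have "(c1 * K e 1 * m) powr (p - 1) * (c1 * R powr (1 - \<kappa>)) * ln (R / \<rho>) \<le> 1 / (1 - 2 powr (1 - p))"
    using \<rho> by (intro log_time_blowup[OF p _ _ _ _ F\<rho> step F_fin]) (use c1 Ke m in auto)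
  then show ?thesis by (simp add: c1_def \<kappa>_def)
qed

end

section \<open>Supersolutions for singular data\<close>

lemma nn_integral_radial_ball:
  fixes \<phi> :: "real \<Rightarrow> real"
  assumes [measurable]: "\<phi> \<in> borel_measurable borel" and \<phi>: "\<And>s. 0 \<le> \<phi> s"
  shows "(\<integral>\<^sup>+(y::'a::euclidean_space). indicator (ball 0 r) y * ennreal (\<phi> (norm y)) \<partial>lborel)
     = ennreal (real DIM('a) * unit_ball_vol DIM('a)) * (\<integral>\<^sup>+s. ennreal (s powr (real DIM('a) - 1) * \<phi> s) * indicator {0<..r} s \<partial>lborel)"
proof -
  let ?c = "real DIM('a) * unit_ball_vol DIM('a)"
  have "(\<integral>\<^sup>+(y::'a). indicator (ball 0 r) y * ennreal (\<phi> (norm y)) \<partial>lborel)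
    = (\<integral>\<^sup>+(y::'a). indicator {..<r} (norm y) * ennreal (\<phi> (norm y)) \<partial>lborel)"
    by (intro nn_integral_cong) (auto split: split_indicator)
  also have "\<dots> = (\<integral>\<^sup>+s. ennreal (?c * s ^ (DIM('a) - 1)) * indicator {0<..} s * (indicator {..<r} s * ennreal (\<phi> s)) \<partial>lborel)"
    by (rule nn_integral_radial) measurable
  also have "\<dots> = (\<integral>\<^sup>+s. ennreal ?c * (ennreal (s powr (real DIM('a) - 1) * \<phi> s) * indicator {0<..r} s) \<partial>lborel)"
  proof (intro nn_integral_cong_AE eventually_mono[OF AE_lborel_singleton[of r]])
    fix s assume "s \<noteq> r"
    show "ennreal (?c * s ^ (DIM('a) - 1)) * indicator {0<..} s * (indicator {..<r} s * ennreal (\<phi> s)) = ennreal ?c * (ennreal (s powr (real DIM('a) - 1) * \<phi> s) * indicator {0<..r} s)"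
    proof (cases "0 < s \<and> s < r")
      case True
      have "s ^ (DIM('a) - 1) = s powr (real DIM('a) - 1)"
        using True by (simp add: of_nat_diff flip: powr_realpow)
      then show ?thesis using True \<phi>[of s] by (simp add: ennreal_mult[symmetric] mult.assoc)
    qed (use \<open>s \<noteq> r\<close> in \<open>auto split: split_indicator\<close>)
  qed
  also have "\<dots> = ennreal ?c * (\<integral>\<^sup>+s. ennreal (s powr (real DIM('a) - 1) * \<phi> s) * indicator {0<..r} s \<partial>lborel)"
    by (rule nn_integral_cmult) measurable
  finally show ?thesis .
qed

lemma nn_integral_power_ball:
  assumes b: "b < real DIM('a::euclidean_space)" and r: "0 < r"
  shows "(\<integral>\<^sup>+(y::'a). indicator (ball 0 r) y * ennreal (norm y powr (- b)) \<partial>lborel)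
     = ennreal (real DIM('a) * unit_ball_vol DIM('a) * (r powr (real DIM('a) - b) / (real DIM('a) - b)))"
proof -
  let ?c = "real DIM('a) * unit_ball_vol DIM('a)"
  have "(\<integral>\<^sup>+(y::'a). indicator (ball 0 r) y * ennreal (norm y powr (- b)) \<partial>lborel)
    = ennreal ?c * (\<integral>\<^sup>+s. ennreal (s powr (real DIM('a) - 1 - b)) * indicator {0<..r} s \<partial>lborel)"
    by (subst nn_integral_radial_ball[of "\<lambda>s. s powr (- b)"]) (auto simp flip: powr_add)
  also have "\<dots> = ennreal ?c * ennreal (r powr (real DIM('a) - 1 - b + 1) / (real DIM('a) - 1 - b + 1))"
    using b r by (subst nn_integral_powr_at_0) auto
  also have "\<dots> = ennreal (?c * (r powr (real DIM('a) - b) / (real DIM('a) - b)))"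
    using b by (subst ennreal_mult[symmetric]) auto
  finally show ?thesis .
qed

lemma nn_integral_log_at_0:
  assumes m: "0 < m" and r: "0 < r" "r < 1"
  shows "(\<integral>\<^sup>+s. ennreal ((- ln s) powr (- m - 1) / s) * indicator {0<..r} s \<partial>lborel) = ennreal ((- ln r) powr (- m) / m)"
proof -
  have "(\<integral>\<^sup>+s. ennreal ((- ln s) powr (- m - 1) / s) * indicator {0<..r} s \<partial>lborel) = ennreal ((- ln r) powr (- m) / m - 0)"
  proof (rule nn_integral_FTC_at_0[OF r(1)])
    show "((\<lambda>s. (- ln s) powr (- m) / m) has_real_derivative (- ln s) powr (- m - 1) / s) (at s)" if "0 < s" "s \<le> r" for s
      using that r m by (auto intro!: derivative_eq_intros)
    have "filterlim (\<lambda>s::real. - ln s) at_top (at_right 0)"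
      using ln_at_0 by (simp add: filterlim_uminus_at_top)
    then have "((\<lambda>s. (- ln s) powr (- m)) \<longlongrightarrow> 0) (at_right 0)"
      using m by (intro tendsto_neg_powr) auto
    then show "((\<lambda>s. (- ln s) powr (- m) / m) \<longlongrightarrow> 0) (at_right 0)"
      using tendsto_divide_zero by blast
  qed (use r in auto)
  then show ?thesis by simp
qed

text \<open>Meant for the punctured unit ball, where \<open>- ln (norm y)\<close> is positive. With
  \<open>m = q + 1\<close> it is comparable to the critical profile near 0, with
  \<open>m = q / 2 + 1\<close> it is the auxiliary datum of the critical supersolution.\<close>

definition log_weight :: "real \<Rightarrow> 'a::euclidean_space \<Rightarrow> real" where
  "log_weight m y = norm y powr (- real DIM('a)) * (- ln (norm y)) powr (- m)"

lemma log_weight_measurable [measurable]: "log_weight m \<in> borel_measurable borel"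
  unfolding log_weight_def by measurable

lemma log_weight_nonneg: "0 \<le> log_weight m y"
  by (simp add: log_weight_def)

text \<open>One power of the logarithm is spent on integrability:
  \<open>(- ln s) powr (- m) / m\<close> is an antiderivative of
  \<open>(- ln s) powr (- m - 1) / s\<close>.\<close>

lemma nn_integral_log_weight_ball:
  assumes m: "0 < m" and r: "0 < r" "r < 1"
  shows "(\<integral>\<^sup>+(y::'a::euclidean_space). indicator (ball 0 r) y * ennreal (log_weight (m + 1) y) \<partial>lborel)
     = ennreal (real DIM('a) * unit_ball_vol DIM('a) * ((- ln r) powr (- m) / m))"
proof -
  let ?c = "real DIM('a) * unit_ball_vol DIM('a)"
  let ?\<phi> = "\<lambda>s. s powr (- real DIM('a)) * (- ln s) powr (- (m + 1))"
  have "(\<integral>\<^sup>+(y::'a). indicator (ball 0 r) y * ennreal (log_weight (m + 1) y) \<partial>lborel)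
    = ennreal ?c * (\<integral>\<^sup>+s. ennreal (s powr (real DIM('a) - 1) * ?\<phi> s) * indicator {0<..r} s \<partial>lborel)"
    unfolding log_weight_def by (rule nn_integral_radial_ball) auto
  also have "(\<integral>\<^sup>+s. ennreal (s powr (real DIM('a) - 1) * ?\<phi> s) * indicator {0<..r} s \<partial>lborel)
    = (\<integral>\<^sup>+s. ennreal ((- ln s) powr (- m - 1) / s) * indicator {0<..r} s \<partial>lborel)"
  proof (intro nn_integral_cong)
    fix s :: real
    have "s powr (real DIM('a) - 1) * s powr (- real DIM('a)) = 1 / s" if "0 < s"
    proof -
      have "s powr (real DIM('a) - 1) * s powr (- real DIM('a)) = s powr (- 1)"
        by (simp only: powr_add[symmetric]) simp
      then show ?thesis using that by (simp add: powr_minus inverse_eq_divide)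
    qed
    then have "s powr (real DIM('a) - 1) * ?\<phi> s = (- ln s) powr (- m - 1) / s" if "0 < s"
      using that by (simp add: mult.assoc[symmetric])
    then show "ennreal (s powr (real DIM('a) - 1) * ?\<phi> s) * indicator {0<..r} s = ennreal ((- ln s) powr (- m - 1) / s) * indicator {0<..r} s"
      by (auto split: split_indicator)
  qed
  also have "ennreal ?c * \<dots> = ennreal (?c * ((- ln r) powr (- m) / m))"
    using m by (subst nn_integral_log_at_0[OF assms], subst ennreal_mult[symmetric]) auto
  finally show ?thesis .
qed

text \<open>With \<open>N\<close> the dimension, \<open>M\<close> says that
  \<open>r powr N * (- ln r) powr m\<close> has a nonnegative derivative for
  \<open>r \<le> norm y\<close>. The comparison itself is read off from
  \<open>1 + z \<le> exp z\<close>, applied to the ratio of the two logarithms.\<close>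

lemma log_weight_antimono:
  fixes x y :: "'a::euclidean_space"
  assumes m: "0 < m" and r: "0 < norm x" "norm x \<le> norm y" "norm y < 1" and M: "m \<le> real DIM('a) * (- ln (norm y))"
  shows "log_weight m y \<le> log_weight m x"
proof -
  define a where "a = ln (norm y) - ln (norm x)"
  have y0: "0 < norm y" using r by linarith
  then have a: "0 \<le> a" using ln_le_cancel_iff[OF r(1)] r(2) by (simp only: a_def diff_ge_0_iff_ge)
  have ly: "0 < - ln (norm y)" using ln_less_zero[OF y0 r(3)] by simp
  have lx: "0 < - ln (norm x)" using ln_less_zero[OF r(1)] r by simp
  have "- ln (norm x) / - ln (norm y) = 1 + a / - ln (norm y)" using ly by (simp add: a_def field_simps)
  also have "\<dots> \<le> exp (a / - ln (norm y))" by (rule exp_ge_add_one_self)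
  finally have "(- ln (norm x) / - ln (norm y)) powr m \<le> exp (a / - ln (norm y)) powr m"
    using m ly lx by (intro powr_mono2) (auto intro: divide_nonpos_neg)
  also have "\<dots> = exp (a * (m / - ln (norm y)))" by (simp add: powr_def)
  also have "\<dots> \<le> exp (a * real DIM('a))"
  proof -
    have "m / - ln (norm y) \<le> real DIM('a)" using M ly by (subst pos_divide_le_eq) auto
    from mult_left_mono[OF this a] show ?thesis by simp
  qed
  also have "\<dots> = (norm y / norm x) powr real DIM('a)"
    using r y0 by (simp add: powr_def a_def ln_div mult.commute)
  finally have "(- ln (norm x)) powr m / (- ln (norm y)) powr m \<le> norm y powr real DIM('a) / norm x powr real DIM('a)"
    using r ly lx by (simp only: powr_divide less_imp_le norm_ge_zero)
  moreover have "A * B \<le> C * D" if "B / D \<le> C / A" "0 < A" "0 < D" for A B C D :: real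
    using that by (simp add: field_simps)
  moreover have pos: "0 < norm x powr real DIM('a)" "0 < (- ln (norm y)) powr m" "0 < (- ln (norm x)) powr m" "0 < norm y powr real DIM('a)"
    using r y0 ly lx by (auto simp: powr_gt_zero)
  ultimately have le: "norm x powr real DIM('a) * (- ln (norm x)) powr m \<le> norm y powr real DIM('a) * (- ln (norm y)) powr m"
    by blast
  have eq: "log_weight m z = 1 / (norm z powr real DIM('a) * (- ln (norm z)) powr m)" for z :: 'a
    by (simp add: log_weight_def powr_minus divide_inverse)
  show ?thesis unfolding eq
    using pos by (intro divide_left_mono le mult_pos_pos) auto
qed

context heat_semigroup
begin

text \<open>Inside the ball the kernel is replaced by its maximum; outside, the data are replaced by
  their bound and the kernel contributes at most its mass 1.\<close>

lemma heat_bound: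
  assumes t: "0 < t" and [measurable]: "f \<in> borel_measurable borel"
    and out: "\<And>y. r \<le> norm y \<Longrightarrow> f y \<le> C"
  shows "heat t f x \<le> ennreal (t powr - q * K 0 1) * (\<integral>\<^sup>+y. indicator (ball 0 r) y * f y \<partial>lborel) + C"
proof -
  note borel_open[OF open_ball, measurable]
  have K_le: "K z t \<le> t powr - q * K 0 1" for z
    using K_antimono[of 0 z t] K_scale[OF t, of 0] by (simp add: q_def)
  have "heat t f x \<le> (\<integral>\<^sup>+y. ennreal (t powr - q * K 0 1) * (indicator (ball 0 r) y * f y) + ennreal (K (x - y) t) * C \<partial>lborel)"
    unfolding heat_def
  proof (intro nn_integral_mono)
    fix y
    show "ennreal (K (x - y) t) * f y \<le> ennreal (t powr - q * K 0 1) * (indicator (ball 0 r) y * f y) + ennreal (K (x - y) t) * C"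
    proof (cases "norm y < r")
      case True
      have "ennreal (K (x - y) t) * f y \<le> ennreal (t powr - q * K 0 1) * f y"
        by (intro mult_right_mono ennreal_leI K_le) auto
      then show ?thesis using True by (simp add: add_increasing2)
    next
      case False
      then show ?thesis using out[of y] by (simp add: mult_left_mono add_increasing)
    qed
  qed
  also have "\<dots> = ennreal (t powr - q * K 0 1) * (\<integral>\<^sup>+y. indicator (ball 0 r) y * f y \<partial>lborel) + C"
    by (simp add: nn_integral_add nn_integral_cmult nn_integral_multc K_mass'[OF t])
  finally show ?thesis .
qed

lemma heat_power_bound:
  assumes b: "0 < b" "b < real DIM('a)"
  obtains C where "0 < C" "\<And>t x. 0 < t \<Longrightarrow> heat t (\<lambda>y. ennreal (norm y powr (- b))) x \<le> ennreal (C * t powr (- (b / \<theta>)))"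
proof
  let ?c = "real DIM('a) * unit_ball_vol DIM('a)"
  define C where "C = K 0 1 * ?c / (real DIM('a) - b) + 1"
  have K0: "0 < K 0 1" by (rule K_pos) simp
  show "0 < C" using K0 b by (auto simp: C_def intro!: add_nonneg_pos divide_nonneg_pos)
  fix t :: real and x :: 'a assume t: "0 < t"
  \<comment> \<open>At this radius both contributions of \<open>heat_bound\<close> are of the order
    \<open>t powr (- (b / \<theta>))\<close>.\<close>
  define r where "r = t powr (1 / \<theta>)"
  have r: "0 < r" using t by (simp add: r_def)
  have e1: "r powr (real DIM('a) - b) = t powr q * t powr (- (b / \<theta>))"
    by (simp add: r_def powr_powr q_def diff_divide_distrib flip: powr_add)
  have e2: "r powr (- b) = t powr (- (b / \<theta>))" by (simp add: r_def powr_powr)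
  have "heat t (\<lambda>y. ennreal (norm y powr (- b))) x \<le> ennreal (t powr - q * K 0 1) * (\<integral>\<^sup>+(y::'a). indicator (ball 0 r) y * ennreal (norm y powr (- b)) \<partial>lborel) + ennreal (r powr (- b))"
    using r b by (intro heat_bound[OF t] ennreal_leI powr_mono2') auto
  also have "\<dots> = ennreal (t powr - q * K 0 1 * (?c * (r powr (real DIM('a) - b) / (real DIM('a) - b))) + r powr (- b))"
    using K0 b by (subst nn_integral_power_ball[OF b(2) r]) (simp only: ennreal_mult[symmetric] ennreal_plus[symmetric] mult_nonneg_nonneg divide_nonneg_pos powr_ge_zero less_imp_le of_nat_0_le_iff unit_ball_vol_nonneg diff_gt_0_iff_gt)
  also have "t powr - q * K 0 1 * (?c * (r powr (real DIM('a) - b) / (real DIM('a) - b))) + r powr (- b) = C * t powr (- (b / \<theta>))"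
  proof -
    have "t powr - q * t powr q = 1" using t by (simp flip: powr_add)
    then have "t powr - q * (t powr q * z) = z" for z by (simp flip: mult.assoc)
    then show ?thesis unfolding e1 e2 C_def by (simp add: algebra_simps add_divide_distrib)
  qed
  finally show "heat t (\<lambda>y. ennreal (norm y powr (- b))) x \<le> ennreal (C * t powr (- (b / \<theta>)))" .
qed

text \<open>A power \<alpha> > 1 with \<open>\<alpha> * b\<close> below the dimension keeps
  \<open>h = epow \<alpha> g\<close> integrable at 0, and Jensen bounds \<open>heat t g\<close> by
  \<open>epow (1 / \<alpha>) (heat t h)\<close>. The power \<open>p / \<alpha> > 1\<close> of
  \<open>heat s h\<close> is split into a factor that is estimated uniformly and one copy of
  \<open>heat s h\<close>, which the semigroup law carries to time \<open>t\<close>. All powers of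
  \<open>t\<close> cancel because the data are invariant under the scaling of the equation; this is
  why the time interval is unbounded.\<close>

lemma supercritical_supersolution:
  assumes p: "1 < p" and b: "\<theta> / (p - 1) < real DIM('a)"
  obtains \<gamma> U where "0 < \<gamma>" "supersolution p (\<lambda>y. ennreal (\<gamma> * norm y powr (- (\<theta> / (p - 1))))) \<infinity> U"
proof -
  define b where "b = \<theta> / (p - 1)"
  have b0: "0 < b" "b < real DIM('a)" using p b \<theta>_pos by (auto simp: b_def)
  \<comment> \<open>The midpoint between 1 and the smaller of \<open>p\<close> and
    \<open>real DIM('a) / b\<close>, so that \<open>\<alpha> < p\<close> and
    \<open>\<alpha> * b\<close> is still below the dimension.\<close>
  define \<alpha> where "\<alpha> = (1 + min p (real DIM('a) / b)) / 2"
  have Nb: "1 < real DIM('a) / b" using b0 by simp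
  have \<alpha>: "1 < \<alpha>" "\<alpha> < p" using p Nb by (auto simp: \<alpha>_def min_def)
  have "\<alpha> \<le> (1 + real DIM('a) / b) / 2" unfolding \<alpha>_def by (intro divide_right_mono add_left_mono min.cobounded2) simp
  also have "(1 + X) / 2 < X" if "1 < X" for X :: real using that by simp
  from this[OF Nb] have "(1 + real DIM('a) / b) / 2 < real DIM('a) / b" .
  finally have "\<alpha> < real DIM('a) / b" .
  then have \<alpha>b: "0 < \<alpha> * b" "\<alpha> * b < real DIM('a)" using \<alpha> b0 by (auto simp: pos_less_divide_eq)
  define g where "g y = ennreal (norm (y::'a) powr (- b))" for y
  define h where "h y = ennreal (norm (y::'a) powr (- (\<alpha> * b)))" for y
  have [measurable]: "g \<in> borel_measurable borel" "h \<in> borel_measurable borel" unfolding g_def h_def by measurable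
  have hg: "h y = epow \<alpha> (g y)" for y by (simp add: h_def g_def powr_powr mult.commute)
  obtain C where C: "0 < C" and Hb: "\<And>t x. 0 < t \<Longrightarrow> heat t h x \<le> ennreal (C * t powr (- (\<alpha> * b / \<theta>)))"
    using heat_power_bound[OF \<alpha>b] unfolding h_def by blast
  have \<alpha>b\<theta>: "\<alpha> * b / \<theta> = \<alpha> / (p - 1)" using \<theta>_pos by (simp add: b_def)
  \<comment> \<open>\<open>s powr (- \<eta>)\<close> is the size of the factor taken out of
    \<open>epow p (V y s)\<close>; it is integrable at \<open>s = 0\<close> because
    \<open>1 < \<alpha>\<close> gives \<open>\<eta> < 1\<close>.\<close>
  define \<eta> where "\<eta> = (p - \<alpha>) / (p - 1)"
  have \<eta>: "\<eta> < 1" using \<alpha> p by (simp add: \<eta>_def field_simps)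
  define B where "B = 2 powr p * C powr ((p - 1) / \<alpha>) / (1 - \<eta>)"
  have B: "0 < B" using C \<eta> by (simp add: B_def)
  \<comment> \<open>The Duhamel term costs \<open>\<gamma> powr p * B\<close>, and \<gamma> is
    chosen to make this equal to \<gamma>. The factor 2 in \<open>V\<close> then leaves one copy for
    the linear part and one for the Duhamel term.\<close>
  define \<gamma> where "\<gamma> = B powr (- (1 / (p - 1)))"
  have \<gamma>: "0 < \<gamma>" using B by (simp add: \<gamma>_def)
  have \<gamma>B: "\<gamma> powr p * B = \<gamma>"
  proof -
    have "\<gamma> powr (p - 1) = B powr (- 1)" unfolding \<gamma>_def powr_powr using p by simp
    then have "\<gamma> powr (p - 1) * B = 1" using B by (simp add: powr_minus)
    moreover have "\<gamma> powr p = \<gamma> * \<gamma> powr (p - 1)" using \<gamma> by (simp add: powr_mult_base)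
    ultimately show ?thesis by (simp add: mult.assoc)
  qed
  define V where "V x t = ennreal (2 * \<gamma>) * epow (1 / \<alpha>) (heat t h x)" for x t
  have Vm: "(\<lambda>(x, t). V x t) \<in> borel_measurable (borel \<Otimes>\<^sub>M borel)"
    unfolding V_def by measurable
  have main: "V x t < top \<and> heat t (\<lambda>y. ennreal \<gamma> * g y) x + duhamel p V x t \<le> V x t" if t: "0 < t" for x t
  proof
    have H_fin: "heat t h x < top" using Hb[OF t, of x] by (rule le_less_trans) simp
    then show "V x t < top" using H_fin by (simp add: V_def ennreal_mult_eq_top_iff less_top[symmetric])
    have "epow \<alpha> (heat t g x) \<le> heat t h x"
      unfolding hg[abs_def] by (rule heat_jensen[OF \<alpha>(1)]) (use t in auto)
    then have "epow (1 / \<alpha>) (epow \<alpha> (heat t g x)) \<le> epow (1 / \<alpha>) (heat t h x)"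
      using \<alpha> by (intro epow_mono) auto
    then have lin: "heat t (\<lambda>y. ennreal \<gamma> * g y) x \<le> ennreal \<gamma> * epow (1 / \<alpha>) (heat t h x)"
      using \<alpha> by (simp add: epow_epow heat_cmult mult_left_mono)
    define D where "D = (2 * \<gamma>) powr p * C powr (p / \<alpha> - 1)"
    have D: "0 \<le> D" by (simp add: D_def)
    have Vp: "epow p (V y s) \<le> ennreal (D * s powr (- \<eta>)) * heat s h y" if s: "0 < s" for y s
    proof -
      have "epow p (V y s) = ennreal ((2 * \<gamma>) powr p) * epow (p / \<alpha>) (heat s h y)"
        unfolding V_def using p \<gamma> by (simp add: epow_mult epow_epow)
      also have "epow (p / \<alpha>) (heat s h y) = epow (p / \<alpha> - 1) (heat s h y) * heat s h y"
        using epow_add[of "p / \<alpha> - 1" 1 "heat s h y"] \<alpha> by simp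
      also have "epow (p / \<alpha> - 1) (heat s h y) \<le> epow (p / \<alpha> - 1) (ennreal (C * s powr (- (\<alpha> * b / \<theta>))))"
        using \<alpha> by (intro epow_mono Hb s) auto
      also have "\<dots> = ennreal (C powr (p / \<alpha> - 1) * s powr (- \<eta>))"
      proof -
        have "\<alpha> / (p - 1) * (p / \<alpha> - 1) = \<eta>" using \<alpha> by (simp add: \<eta>_def right_diff_distrib diff_divide_distrib)
        then have "(s powr (- (\<alpha> / (p - 1)))) powr (p / \<alpha> - 1) = s powr (- \<eta>)" by (simp add: powr_powr)
        then show ?thesis using C unfolding \<alpha>b\<theta> by (simp add: powr_mult)
      qed
      finally have "epow p (V y s) \<le> ennreal ((2 * \<gamma>) powr p) * (ennreal (C powr (p / \<alpha> - 1) * s powr (- \<eta>)) * heat s h y)"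
        by (simp add: mult_left_mono mult_right_mono)
      then show ?thesis by (simp add: D_def ennreal_mult mult.assoc)
    qed
    have "duhamel p V x t \<le> (\<integral>\<^sup>+s. ennreal D * (ennreal (s powr (- \<eta>)) * indicator {0<..t} s) * heat t h x \<partial>lborel)"
      unfolding duhamel_def
    proof (intro nn_integral_mono)
      fix s
      show "indicator {0<..<t} s * heat (t - s) (\<lambda>y. epow p (V y s)) x \<le> ennreal D * (ennreal (s powr (- \<eta>)) * indicator {0<..t} s) * heat t h x"
      proof (cases "s \<in> {0<..<t}")
        case True
        then have s: "0 < s" "s < t" by auto
        have "heat (t - s) (\<lambda>y. epow p (V y s)) x \<le> heat (t - s) (\<lambda>y. ennreal (D * s powr (- \<eta>)) * heat s h y) x"
          by (intro heat_mono Vp s)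
        also have "\<dots> = ennreal (D * s powr (- \<eta>)) * heat t h x"
          using s by (subst heat_cmult) (auto simp: heat_heat)
        finally show ?thesis using s D by (simp add: ennreal_mult)
      qed simp
    qed
    also have "\<dots> = ennreal D * ennreal (t powr (- \<eta> + 1) / (- \<eta> + 1)) * heat t h x"
      using \<eta> t by (simp add: nn_integral_multc nn_integral_cmult nn_integral_powr_at_0)
    also have "heat t h x = epow (1 - 1 / \<alpha>) (heat t h x) * epow (1 / \<alpha>) (heat t h x)"
      using epow_add[of "1 - 1 / \<alpha>" "1 / \<alpha>" "heat t h x"] \<alpha> by simp
    also have "ennreal D * ennreal (t powr (- \<eta> + 1) / (- \<eta> + 1)) * (epow (1 - 1 / \<alpha>) (heat t h x) * epow (1 / \<alpha>) (heat t h x))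
      \<le> ennreal D * ennreal (t powr (- \<eta> + 1) / (- \<eta> + 1)) * (ennreal (C powr (1 - 1 / \<alpha>) * t powr (- (1 - \<eta>))) * epow (1 / \<alpha>) (heat t h x))"
    proof (intro mult_left_mono mult_right_mono)
      have "epow (1 - 1 / \<alpha>) (heat t h x) \<le> epow (1 - 1 / \<alpha>) (ennreal (C * t powr (- (\<alpha> * b / \<theta>))))"
        using \<alpha> by (intro epow_mono Hb t) auto
      also have "\<dots> = ennreal (C powr (1 - 1 / \<alpha>) * t powr (- (1 - \<eta>)))"
      proof -
        have "\<alpha> / (p - 1) * (1 - 1 / \<alpha>) = (\<alpha> - 1) / (p - 1)" using \<alpha> by (simp add: right_diff_distrib diff_divide_distrib)
        also have "\<dots> = 1 - \<eta>" using p by (simp add: \<eta>_def field_simps)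
        finally have "(t powr (- (\<alpha> / (p - 1)))) powr (1 - 1 / \<alpha>) = t powr (- (1 - \<eta>))" by (simp add: powr_powr)
        then show ?thesis using C unfolding \<alpha>b\<theta> by (simp add: powr_mult)
      qed
      finally show "epow (1 - 1 / \<alpha>) (heat t h x) \<le> ennreal (C powr (1 - 1 / \<alpha>) * t powr (- (1 - \<eta>)))" .
    qed auto
    also have "\<dots> = ennreal (D * (t powr (- \<eta> + 1) / (- \<eta> + 1)) * (C powr (1 - 1 / \<alpha>) * t powr (- (1 - \<eta>)))) * epow (1 / \<alpha>) (heat t h x)"
    proof -
      have "ennreal d * ennreal e * (ennreal k * z) = ennreal (d * e * k) * z" if "0 \<le> d" "0 \<le> e" "0 \<le> k" for d e k z
        using that by (simp add: ennreal_mult mult.assoc)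
      from this[OF D] show ?thesis using \<eta> by auto
    qed
    also have "D * (t powr (- \<eta> + 1) / (- \<eta> + 1)) * (C powr (1 - 1 / \<alpha>) * t powr (- (1 - \<eta>))) = \<gamma>"
    proof -
      have 1: "t powr (- \<eta> + 1) * t powr (- (1 - \<eta>)) = 1" using t by (simp flip: powr_add)
      have "C powr (p / \<alpha> - 1) * C powr (1 - 1 / \<alpha>) = C powr ((p - 1) / \<alpha>)" by (simp add: diff_divide_distrib flip: powr_add)
      then have 2: "D * C powr (1 - 1 / \<alpha>) / (1 - \<eta>) = \<gamma> powr p * B"
        using \<gamma> by (simp add: D_def B_def powr_mult mult_ac)
      have "D * (t powr (- \<eta> + 1) / (- \<eta> + 1)) * (C powr (1 - 1 / \<alpha>) * t powr (- (1 - \<eta>))) = (D * C powr (1 - 1 / \<alpha>) / (1 - \<eta>)) * (t powr (- \<eta> + 1) * t powr (- (1 - \<eta>)))"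
        by (simp add: mult_ac)
      then show ?thesis unfolding 1 2 using \<gamma>B by simp
    qed
    finally have duh: "duhamel p V x t \<le> ennreal \<gamma> * epow (1 / \<alpha>) (heat t h x)" .
    have "V x t = ennreal \<gamma> * epow (1 / \<alpha>) (heat t h x) + ennreal \<gamma> * epow (1 / \<alpha>) (heat t h x)"
      using \<gamma> by (simp add: V_def distrib_right[symmetric] ennreal_plus[symmetric] del: ennreal_plus)
    then show "heat t (\<lambda>y. ennreal \<gamma> * g y) x + duhamel p V x t \<le> V x t"
      using add_mono[OF lin duh] by simp
  qed
  have "(\<lambda>y. ennreal \<gamma> * g y) = (\<lambda>y. ennreal (\<gamma> * norm y powr (- b)))"
    using \<gamma> by (simp add: g_def ennreal_mult)
  then have "supersolution p (\<lambda>y. ennreal (\<gamma> * norm y powr (- b))) \<infinity> V"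
    unfolding supersolution_def using Vm main by (auto intro!: always_eventually)
  then show ?thesis using that \<gamma> by (simp add: b_def)
qed

text \<open>\<open>g\<close> is split at radius \<open>rad t\<close>: inside, it is at most
  \<open>L t powr (- (q / 2))\<close> times \<open>\<nu>\<close>; outside, it is at most
  \<open>t powr - q * L t powr (- q - 1)\<close>. The \<open>p\<close>-th power of the inner part
  produces the integrand \<open>L s powr (- (q / 2) - 1) / s\<close>, whose integral reproduces the
  very weight \<open>L t powr (- (q / 2))\<close> of the term with \<open>\<nu>\<close>. The outer
  part produces \<open>L s powr (- (1 / q) - 1) / s\<close>, which is integrable at 0. Small
  \<gamma> absorbs both constants.\<close>

lemma critical_supersolution:
  assumes p: "p = 1 + 1 / q"
  obtains \<gamma> r0 T U where "0 < \<gamma>" "0 < r0" "r0 < 1" "0 < T"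
    "supersolution p (\<lambda>y. ennreal (\<gamma> * (if norm y < r0 then log_weight (q + 1) y else 0))) (ereal T) U"
proof -
  define N where "N = real DIM('a)"
  have N: "N \<ge> 1" by (simp add: N_def Suc_le_eq)
  \<comment> \<open>\<open>q + 1 \<le> N * M\<close> makes \<open>log_weight (m + 1)\<close>
    radially decreasing inside \<open>r0 = exp (- M)\<close> for all \<open>m \<le> q\<close>, and
    \<open>1 \<le> M\<close> gives \<open>1 \<le> L t\<close>. The time \<open>T\<close> equals
    \<open>r0 powr \<theta>\<close>, which keeps \<open>rad t\<close> below
    \<open>r0\<close>.\<close>
  define M where "M = max 1 ((q + 1) / N)"
  have M: "1 \<le> M" "q + 1 \<le> N * M"
  proof -
    have "(q + 1) / N \<le> M" by (simp add: M_def)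
    then show "q + 1 \<le> N * M" using N by (simp add: pos_divide_le_eq mult.commute)
  qed (simp add: M_def)
  define r0 where "r0 = exp (- M)"
  define T where "T = exp (- \<theta> * M)"
  have r0: "0 < r0" "r0 < 1" using M by (auto simp: r0_def)
  have q0: "0 < q" by (rule q_pos)
  have p1: "1 < p" "p - 1 = 1 / q" using p q0 by auto
  define L where "L t = - ln t / \<theta>" for t
  define rad where "rad t = t powr (1 / \<theta>)" for t
  have L: "M < L t" "0 < L t" "1 \<le> L t" "0 < rad t" "rad t < r0" "- ln (rad t) = L t" if t: "0 < t" "t < T" for t
  proof -
    have "ln t < ln T" using t by simp
    then have "ln t < - \<theta> * M" by (simp add: T_def)
    then show "M < L t" using \<theta>_pos by (simp add: L_def field_simps)
    then show "0 < L t" "1 \<le> L t" using M by auto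
    show "0 < rad t" using t by (simp add: rad_def)
    show e: "- ln (rad t) = L t" using t by (simp add: rad_def L_def ln_powr)
    have "rad t = exp (- L t)" using t e \<open>0 < rad t\<close> by (metis exp_ln minus_minus)
    then show "rad t < r0" using \<open>M < L t\<close> by (simp add: r0_def)
  qed
  define lam where "lam m y = ennreal (if norm y < r0 then log_weight m y else 0)" for m and y :: 'a
  have [measurable]: "lam m \<in> borel_measurable borel" for m unfolding lam_def by measurable
  have lam_out: "lam (m + 1) y \<le> ennreal (t powr - q * L t powr (- m - 1))"
    if t: "0 < t" "t < T" and m: "0 < m" "m \<le> q" and y: "rad t \<le> norm y" for m t y
  proof (cases "norm y < r0")
    case True
    obtain x :: 'a where x: "norm x = rad t" using vector_choose_size[of "rad t"] L(4)[OF t] by auto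
    have y0: "0 < norm y" using y L(4)[OF t] by linarith
    have "M \<le> - ln (norm y)"
    proof -
      have "ln (norm y) \<le> ln r0" using True y0 r0 by (subst ln_le_cancel_iff) auto
      then show ?thesis by (simp add: r0_def)
    qed
    then have "m + 1 \<le> real DIM('a) * (- ln (norm y))"
      using M m N mult_left_mono[of M "- ln (norm y)" N] by (simp add: N_def)
    then have "log_weight (m + 1) y \<le> log_weight (m + 1) x"
      using x y m True r0 L(4)[OF t] by (intro log_weight_antimono) auto
    also have "log_weight (m + 1) x = t powr - q * L t powr (- m - 1)"
      unfolding log_weight_def x L(6)[OF t] by (simp add: rad_def powr_powr q_def)
    finally show ?thesis using True by (simp add: lam_def ennreal_leI)
  qed (simp add: lam_def)
  define c where "c m = K 0 1 * (real DIM('a) * unit_ball_vol DIM('a)) / m + 1" for m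
  have K0: "0 < K 0 1" by (rule K_pos) simp
  have c0: "0 < c m" if "0 < m" for m using K0 that by (auto simp: c_def intro!: add_nonneg_pos divide_nonneg_pos)
  have heat_lam: "heat t (lam (m + 1)) x \<le> ennreal (c m * (t powr - q * L t powr (- m)))"
    if t: "0 < t" "t < T" and m: "0 < m" "m \<le> q" for m t x
  proof -
    have rt: "rad t < 1" using L(5)[OF t] r0 by simp
    have "heat t (lam (m + 1)) x \<le> ennreal (t powr - q * K 0 1) * (\<integral>\<^sup>+y. indicator (ball 0 (rad t)) y * lam (m + 1) y \<partial>lborel)
       + ennreal (t powr - q * L t powr (- m - 1))"
      using lam_out[OF t m] t by (intro heat_bound) auto
    also have "(\<integral>\<^sup>+y. indicator (ball 0 (rad t)) y * lam (m + 1) y \<partial>lborel) = (\<integral>\<^sup>+(y::'a). indicator (ball 0 (rad t)) y * ennreal (log_weight (m + 1) y) \<partial>lborel)"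
      using L(5)[OF t] by (intro nn_integral_cong) (auto simp: lam_def split: split_indicator)
    also have "\<dots> = ennreal (real DIM('a) * unit_ball_vol DIM('a) * (L t powr (- m) / m))"
      unfolding nn_integral_log_weight_ball[OF m(1) L(4)[OF t] rt] L(6)[OF t] ..
    also have "ennreal (t powr - q * K 0 1) * \<dots> + ennreal (t powr - q * L t powr (- m - 1))
      \<le> ennreal (t powr - q * K 0 1) * ennreal (real DIM('a) * unit_ball_vol DIM('a) * (L t powr (- m) / m)) + ennreal (t powr - q * L t powr (- m))"
      using L(3)[OF t] by (intro add_left_mono ennreal_leI mult_left_mono powr_mono) auto
    also have "\<dots> = ennreal (c m * (t powr - q * L t powr (- m)))"
    proof -
      have aux: "ennreal A * ennreal B + ennreal D = ennreal (A * B + D)" if "0 \<le> A" "0 \<le> B" "0 \<le> D" for A B D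
        using that by (simp add: ennreal_mult)
      have "ennreal (t powr - q * K 0 1) * ennreal (real DIM('a) * unit_ball_vol DIM('a) * (L t powr (- m) / m)) + ennreal (t powr - q * L t powr (- m))
        = ennreal ((t powr - q * K 0 1) * (real DIM('a) * unit_ball_vol DIM('a) * (L t powr (- m) / m)) + t powr - q * L t powr (- m))"
        by (rule aux) (use K0 m in auto)
      then show ?thesis by (simp add: c_def algebra_simps)
    qed
    finally show ?thesis .
  qed
  define g where "g = lam (q + 1)"
  define \<nu> where "\<nu> = lam (q / 2 + 1)"
  have [measurable]: "g \<in> borel_measurable borel" "\<nu> \<in> borel_measurable borel" by (simp_all add: g_def \<nu>_def)
  \<comment> \<open>The part of \<open>g\<close> away from the origin at the spatial scale of time
    \<open>t\<close>; its uniform bound has one more logarithm than that of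
    \<open>heat t g\<close>.\<close>
  define h where "h t y = (if rad t \<le> norm y then g y else 0)" for t and y :: 'a
  have [measurable]: "h t \<in> borel_measurable borel" for t unfolding h_def by measurable
  have h_le: "h t y \<le> g y" for t y by (simp add: h_def)
  have split: "g y \<le> ennreal (L t powr (- (q / 2))) * \<nu> y + h t y" if t: "0 < t" "t < T" for t y
  proof (cases "rad t \<le> norm y")
    case True
    then show ?thesis by (simp add: h_def add_increasing)
  next
    case False
    then have "g y \<le> ennreal (L t powr (- (q / 2))) * \<nu> y"
    proof (cases "y = 0")
      case True
      then show ?thesis by (simp add: g_def lam_def log_weight_def)
    next
      case y0: False
      have yr: "norm y < r0" using False L(5)[OF t] by simp
      have l: "L t \<le> - ln (norm y)"
      proof -
        have "ln (norm y) \<le> ln (rad t)" using False y0 L(4)[OF t] by (subst ln_le_cancel_iff) auto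
        then show ?thesis using L(6)[OF t] by simp
      qed
      have "(- ln (norm y)) powr (- (q + 1)) = (- ln (norm y)) powr (- (q / 2)) * (- ln (norm y)) powr (- (q / 2 + 1))"
        by (simp flip: powr_add)
      also have "\<dots> \<le> L t powr (- (q / 2)) * (- ln (norm y)) powr (- (q / 2 + 1))"
        using l L(2)[OF t] q0 by (intro mult_right_mono powr_mono2') auto
      finally have "log_weight (q + 1) y \<le> L t powr (- (q / 2)) * log_weight (q / 2 + 1) y"
        unfolding log_weight_def by (simp add: mult.left_commute mult_left_mono)
      then have "ennreal (log_weight (q + 1) y) \<le> ennreal (L t powr (- (q / 2)) * log_weight (q / 2 + 1) y)"
        by (rule ennreal_leI)
      then show ?thesis using yr by (simp add: g_def \<nu>_def lam_def ennreal_mult log_weight_nonneg)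
    qed
    then show ?thesis by (simp add: add_increasing2)
  qed
  define G where "G t = heat t g" for t
  define V where "V t = heat t \<nu>" for t
  define H where "H t = heat t (h t)" for t
  have V_le: "V t x \<le> ennreal (c (q / 2) * (t powr - q * L t powr (- (q / 2))))" if "0 < t" "t < T" for t x
    unfolding V_def \<nu>_def using that q0 by (intro heat_lam) auto
  have G_le: "G t x \<le> ennreal (c q * (t powr - q * L t powr (- q)))" if "0 < t" "t < T" for t x
    unfolding G_def g_def using that q0 by (intro heat_lam) auto
  have H_le: "H t x \<le> ennreal (t powr - q * L t powr (- q - 1))" if t: "0 < t" "t < T" for t x
  proof -
    have "H t x \<le> heat t (\<lambda>_. ennreal (t powr - q * L t powr (- q - 1))) x"
      unfolding H_def using lam_out[OF t q0 order_refl] by (intro heat_mono) (simp add: h_def g_def)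
    then show ?thesis using t by (simp add: heat_const)
  qed
  have HG: "H t x \<le> G t x" for t x unfolding H_def G_def by (intro heat_mono h_le)
  have G_split: "G t x \<le> ennreal (L t powr (- (q / 2))) * V t x + H t x" if t: "0 < t" "t < T" for t x
  proof -
    have "G t x \<le> heat t (\<lambda>y. ennreal (L t powr (- (q / 2))) * \<nu> y + h t y) x"
      unfolding G_def by (intro heat_mono split t)
    then show ?thesis by (simp add: V_def H_def heat_add heat_cmult)
  qed
  \<comment> \<open>\<open>B1\<close> and \<open>B2\<close> are, up to \<open>2 powr p\<close>, the
    costs of the Duhamel terms multiplying \<open>V\<close> and \<open>G\<close>. The factors 3 and
    2 are the coefficients of \<open>V\<close> and \<open>H\<close> after the splitting of
    \<open>G\<close>; \<open>2 * \<theta> / q\<close> and \<open>\<theta> * q\<close> come from the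
    time integrals.\<close>
  define B1 where "B1 = 3 powr p * c (q / 2) powr (1 / q) * (2 * \<theta> / q)"
  define B2 where "B2 = 2 powr p * (\<theta> * q)"
  define B where "B = 2 powr p * max B1 B2"
  have B1: "0 \<le> B1" using \<theta>_pos q0 by (simp add: B1_def)
  have B2: "0 < B2" using \<theta>_pos q0 by (simp add: B2_def)
  have B: "0 < B" using B2 by (simp add: B_def less_max_iff_disj)
  define \<gamma> where "\<gamma> = B powr (- (1 / (p - 1)))"
  have \<gamma>: "0 < \<gamma>" using B by (simp add: \<gamma>_def)
  have \<gamma>B: "\<gamma> powr p * B = \<gamma>"
  proof -
    have "\<gamma> powr (p - 1) = B powr (- 1)" unfolding \<gamma>_def powr_powr using p1 q0 by simp
    then have "\<gamma> powr (p - 1) * B = 1" using B by (simp add: powr_minus)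
    moreover have "\<gamma> powr p = \<gamma> * \<gamma> powr (p - 1)" using \<gamma> by (simp add: powr_mult_base)
    ultimately show ?thesis by (simp add: mult.assoc)
  qed
  define U where "U x t = ennreal (2 * \<gamma>) * G t x + ennreal (\<gamma> * L t powr (- (q / 2))) * V t x" for x t
  have Um: "(\<lambda>(x, t). U x t) \<in> borel_measurable (borel \<Otimes>\<^sub>M borel)"
    unfolding U_def G_def V_def L_def by measurable
  have U_pow: "epow p (U x s) \<le> ennreal (2 powr p * ((3 * \<gamma>) powr p * c (q / 2) powr (1 / q)) * (L s powr (- (q / 2) - 1) / s)) * V s x
      + ennreal (2 powr p * (2 * \<gamma>) powr p * (L s powr (- (1 / q) - 1) / s)) * G s x" if s: "0 < s" "s < T" for x s
  proof -
    define a where "a = ennreal (3 * \<gamma> * L s powr (- (q / 2))) * V s x"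
    define b where "b = ennreal (2 * \<gamma>) * H s x"
    have Lp: "0 < L s" by (rule L(2)[OF s])
    have "U x s \<le> ennreal (2 * \<gamma>) * (ennreal (L s powr (- (q / 2))) * V s x + H s x) + ennreal (\<gamma> * L s powr (- (q / 2))) * V s x"
      unfolding U_def by (intro add_right_mono mult_left_mono G_split s) auto
    also have "\<dots> = a + b"
    proof -
      have "ennreal (3 * \<gamma> * L s powr (- (q / 2))) = ennreal (2 * \<gamma>) * ennreal (L s powr (- (q / 2))) + ennreal (\<gamma> * L s powr (- (q / 2)))"
        using \<gamma> by (simp add: ennreal_mult[symmetric] ennreal_plus[symmetric] del: ennreal_plus)
      then show ?thesis by (simp add: a_def b_def distrib_left distrib_right mult.assoc add_ac)
    qed
    finally have "epow p (U x s) \<le> epow p (a + b)" using p1 by (intro epow_mono) auto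
    also have "\<dots> \<le> epow p (2 * max a b)"
      using p1 by (intro epow_mono) (auto simp: mult_2 intro: add_mono)
    also have "\<dots> = ennreal (2 powr p) * epow p (max a b)"
      using p1 epow_ennreal[of 2 p] by (simp add: epow_mult)
    also have "epow p (max a b) \<le> epow p a + epow p b"
      by (cases "a \<le> b") (auto simp: max_def add_increasing add_increasing2)
    finally have 1: "epow p (U x s) \<le> ennreal (2 powr p) * epow p a + ennreal (2 powr p) * epow p b"
      by (simp add: distrib_left mult_left_mono)
    have sq: "(s powr - q) powr (1 / q) = 1 / s"
    proof -
      have "(s powr - q) powr (1 / q) = s powr (- 1)" unfolding powr_powr using q0 by simp
      then show ?thesis using s by (simp add: powr_minus inverse_eq_divide)
    qed
    \<comment> \<open>Because \<open>p - 1 = 1 / q\<close>, the surplus power is the one that turns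
      the uniform bound \<open>s powr - q\<close> into \<open>1 / s\<close>.\<close>
    have self: "epow p z = epow (1 / q) z * z" for z
      using epow_add[of "1 / q" 1 z] q0 p by (simp add: add.commute)
    have "epow p a = ennreal ((3 * \<gamma> * L s powr (- (q / 2))) powr p) * (epow (1 / q) (V s x) * V s x)"
      unfolding a_def using p1 \<gamma> by (simp add: epow_mult self[symmetric])
    also have "\<dots> \<le> ennreal ((3 * \<gamma> * L s powr (- (q / 2))) powr p) * (epow (1 / q) (ennreal (c (q / 2) * (s powr - q * L s powr (- (q / 2))))) * V s x)"
      using q0 by (intro mult_left_mono mult_right_mono epow_mono V_le s) auto
    also have "\<dots> = ennreal (((3 * \<gamma>) powr p * c (q / 2) powr (1 / q)) * (L s powr (- (q / 2) - 1) / s)) * V s x"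
    proof -
      have "(3 * \<gamma> * L s powr (- (q / 2))) powr p * (c (q / 2) * (s powr - q * L s powr (- (q / 2)))) powr (1 / q)
        = ((3 * \<gamma>) powr p * c (q / 2) powr (1 / q)) * (((L s powr (- (q / 2))) powr p * (L s powr (- (q / 2))) powr (1 / q)) * (1 / s))"
        using \<gamma> c0[of "q / 2"] q0 by (simp add: powr_mult sq mult_ac)
      also have "(L s powr (- (q / 2))) powr p * (L s powr (- (q / 2))) powr (1 / q) = L s powr (- (q / 2) - 1)"
      proof -
        have "- (q / 2) * p + - (q / 2) * (1 / q) = - (q / 2) - 1" using q0 by (simp add: p field_simps)
        then show ?thesis by (simp only: powr_powr powr_add[symmetric])
      qed
      finally show ?thesis
        using c0[of "q / 2"] q0 by (simp add: mult.assoc[symmetric] ennreal_mult[symmetric])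
    qed
    finally have 2: "epow p a \<le> ennreal (((3 * \<gamma>) powr p * c (q / 2) powr (1 / q)) * (L s powr (- (q / 2) - 1) / s)) * V s x" .
    have "epow p b = ennreal ((2 * \<gamma>) powr p) * (epow (1 / q) (H s x) * H s x)"
      unfolding b_def using p1 \<gamma> by (simp add: epow_mult self[symmetric])
    also have "\<dots> \<le> ennreal ((2 * \<gamma>) powr p) * (epow (1 / q) (ennreal (s powr - q * L s powr (- q - 1))) * G s x)"
      using q0 by (intro mult_left_mono mult_mono epow_mono H_le s HG) auto
    also have "\<dots> = ennreal ((2 * \<gamma>) powr p * (L s powr (- (1 / q) - 1) / s)) * G s x"
    proof -
      have "(s powr - q * L s powr (- q - 1)) powr (1 / q) = (1 / s) * (L s powr (- q - 1)) powr (1 / q)"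
        by (simp add: powr_mult sq)
      also have "(L s powr (- q - 1)) powr (1 / q) = L s powr (- (1 / q) - 1)"
      proof -
        have "(- q - 1) * (1 / q) = - (1 / q) - 1" using q0 by (simp add: field_simps)
        then show ?thesis by (simp only: powr_powr)
      qed
      finally show ?thesis using s by (simp add: mult.assoc[symmetric] ennreal_mult[symmetric])
    qed
    finally have 3: "epow p b \<le> ennreal ((2 * \<gamma>) powr p * (L s powr (- (1 / q) - 1) / s)) * G s x" .
    have "ennreal (2 powr p) * (ennreal A * z) = ennreal (2 powr p * A) * z" if "0 \<le> A" for A z
      using that by (simp add: ennreal_mult mult.assoc)
    note e = this
    have "ennreal (2 powr p) * epow p a + ennreal (2 powr p) * epow p b
      \<le> ennreal (2 powr p) * (ennreal (((3 * \<gamma>) powr p * c (q / 2) powr (1 / q)) * (L s powr (- (q / 2) - 1) / s)) * V s x)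
       + ennreal (2 powr p) * (ennreal ((2 * \<gamma>) powr p * (L s powr (- (1 / q) - 1) / s)) * G s x)"
      by (intro add_mono mult_left_mono 2 3) auto
    also have "\<dots> = ennreal (2 powr p * ((3 * \<gamma>) powr p * c (q / 2) powr (1 / q)) * (L s powr (- (q / 2) - 1) / s)) * V s x
      + ennreal (2 powr p * (2 * \<gamma>) powr p * (L s powr (- (1 / q) - 1) / s)) * G s x"
      using s by (subst (1 2) e) (auto simp: mult.assoc)
    finally show ?thesis using 1 by (rule order_trans[rotated])
  qed
  have time_int: "(\<integral>\<^sup>+s. indicator {0<..<t} s * ennreal (L s powr (- m - 1) / s) \<partial>lborel) = ennreal (\<theta> / m * L t powr (- m))"
    if t: "0 < t" "t < T" and m: "0 < m" for t m
  proof -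
    have T1: "T \<le> 1" using \<theta>_pos M by (simp add: T_def)
    have "(\<integral>\<^sup>+s. indicator {0<..<t} s * ennreal (L s powr (- m - 1) / s) \<partial>lborel)
      = (\<integral>\<^sup>+s. ennreal (L s powr (- m - 1) / s) * indicator {0<..t} s \<partial>lborel)"
      by (intro nn_integral_cong_AE eventually_mono[OF AE_lborel_singleton[of t]]) (auto split: split_indicator)
    also have "\<dots> = (\<integral>\<^sup>+s. ennreal (\<theta> powr (m + 1)) * (ennreal ((- ln s) powr (- m - 1) / s) * indicator {0<..t} s) \<partial>lborel)"
    proof (intro nn_integral_cong)
      fix s
      show "ennreal (L s powr (- m - 1) / s) * indicator {0<..t} s = ennreal (\<theta> powr (m + 1)) * (ennreal ((- ln s) powr (- m - 1) / s) * indicator {0<..t} s)"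
      proof (cases "s \<in> {0<..t}")
        case True
        then have "0 < s" "s < 1" using t T1 by auto
        then have "0 \<le> - ln s" by simp
        then have "L s powr (- m - 1) = (- ln s) powr (- m - 1) / \<theta> powr (- m - 1)"
          unfolding L_def using \<theta>_pos by (subst powr_divide) auto
        also have "\<dots> = \<theta> powr (m + 1) * (- ln s) powr (- m - 1)"
          using powr_minus[of \<theta> "m + 1"] by (simp add: divide_inverse)
        finally show ?thesis using True by (simp add: ennreal_mult[symmetric])
      qed simp
    qed
    also have "\<dots> = ennreal (\<theta> powr (m + 1)) * ennreal ((- ln t) powr (- m) / m)"
      using t T1 m by (simp add: nn_integral_cmult nn_integral_log_at_0)
    also have "\<dots> = ennreal (\<theta> / m * L t powr (- m))"
    proof -
      have "0 \<le> - ln t" using t T1 by simp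
      then have "L t powr (- m) = (- ln t) powr (- m) / \<theta> powr (- m)"
        unfolding L_def using \<theta>_pos by (subst powr_divide) auto
      then have "\<theta> / m * L t powr (- m) = \<theta> powr (m + 1) * ((- ln t) powr (- m) / m)"
        using \<theta>_pos powr_minus[of \<theta> m] by (simp add: powr_add divide_inverse)
      moreover have "ennreal (\<theta> powr (m + 1) * ((- ln t) powr (- m) / m)) = ennreal (\<theta> powr (m + 1)) * ennreal ((- ln t) powr (- m) / m)"
        using m by (intro ennreal_mult) auto
      ultimately show ?thesis by (simp only:)
    qed
    finally show ?thesis .
  qed
  have main: "U x t < top \<and> heat t (\<lambda>y. ennreal \<gamma> * g y) x + duhamel p U x t \<le> U x t" if t: "0 < t" "t < T" for x t
  proof
    have "G t x < top" "V t x < top"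
      using le_less_trans[OF G_le[OF t] ennreal_less_top] le_less_trans[OF V_le[OF t] ennreal_less_top] by auto
    then show "U x t < top" by (simp add: U_def ennreal_mult_eq_top_iff less_top[symmetric])
    define D1 where "D1 = 2 powr p * ((3 * \<gamma>) powr p * c (q / 2) powr (1 / q))"
    define D2 where "D2 = 2 powr p * (2 * \<gamma>) powr p"
    have D: "0 \<le> D1" "0 \<le> D2" by (simp_all add: D1_def D2_def)
    have "duhamel p U x t \<le> (\<integral>\<^sup>+s. ennreal D1 * (indicator {0<..<t} s * ennreal (L s powr (- (q / 2) - 1) / s)) * V t x
        + ennreal D2 * (indicator {0<..<t} s * ennreal (L s powr (- (1 / q) - 1) / s)) * G t x \<partial>lborel)"
      unfolding duhamel_def
    proof (intro nn_integral_mono)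
      fix s
      show "indicator {0<..<t} s * heat (t - s) (\<lambda>y. epow p (U y s)) x
        \<le> ennreal D1 * (indicator {0<..<t} s * ennreal (L s powr (- (q / 2) - 1) / s)) * V t x
        + ennreal D2 * (indicator {0<..<t} s * ennreal (L s powr (- (1 / q) - 1) / s)) * G t x"
      proof (cases "s \<in> {0<..<t}")
        case True
        then have s: "0 < s" "s < t" "s < T" using t by auto
        have "heat (t - s) (\<lambda>y. epow p (U y s)) x \<le> heat (t - s) (\<lambda>y. ennreal (D1 * (L s powr (- (q / 2) - 1) / s)) * V s y + ennreal (D2 * (L s powr (- (1 / q) - 1) / s)) * G s y) x"
          unfolding D1_def D2_def by (intro heat_mono U_pow s)
        also have "\<dots> = ennreal (D1 * (L s powr (- (q / 2) - 1) / s)) * V t x + ennreal (D2 * (L s powr (- (1 / q) - 1) / s)) * G t x"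
          using s by (simp add: heat_add heat_cmult V_def G_def heat_heat)
        also have "ennreal (D1 * (L s powr (- (q / 2) - 1) / s)) = ennreal D1 * ennreal (L s powr (- (q / 2) - 1) / s)"
          using D s by (intro ennreal_mult) auto
        also have "ennreal (D2 * (L s powr (- (1 / q) - 1) / s)) = ennreal D2 * ennreal (L s powr (- (1 / q) - 1) / s)"
          using D s by (intro ennreal_mult) auto
        finally show ?thesis using True by simp
      qed simp
    qed
    also have "\<dots> = ennreal D1 * ennreal (\<theta> / (q / 2) * L t powr (- (q / 2))) * V t x + ennreal D2 * ennreal (\<theta> / (1 / q) * L t powr (- (1 / q))) * G t x"
    proof -
      have [measurable]: "L \<in> borel_measurable borel" unfolding L_def by measurable
      show ?thesis
        using q0 by (subst nn_integral_add, simp, simp, simp only: nn_integral_multc nn_integral_cmult)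
          (simp add: nn_integral_multc nn_integral_cmult time_int[OF t])
    qed
    also have "\<dots> \<le> ennreal (\<gamma> * L t powr (- (q / 2))) * V t x + ennreal \<gamma> * G t x"
    proof (intro add_mono mult_right_mono)
      have "D1 * (\<theta> / (q / 2)) = \<gamma> powr p * (2 powr p * B1)"
        using \<gamma> by (simp add: D1_def B1_def powr_mult mult_ac)
      also have "\<dots> \<le> \<gamma> powr p * B" unfolding B_def by (intro mult_left_mono) auto
      finally have "D1 * (\<theta> / (q / 2)) \<le> \<gamma>" using \<gamma>B by simp
      then have "D1 * (\<theta> / (q / 2)) * L t powr (- (q / 2)) \<le> \<gamma> * L t powr (- (q / 2))" by (rule mult_right_mono) simp
      then show "ennreal D1 * ennreal (\<theta> / (q / 2) * L t powr (- (q / 2))) \<le> ennreal (\<gamma> * L t powr (- (q / 2)))"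
        using D q0 \<theta>_pos by (subst ennreal_mult[symmetric]) (auto simp: mult.assoc intro!: ennreal_leI)
      have "D2 * (\<theta> / (1 / q)) = \<gamma> powr p * (2 powr p * B2)"
        using \<gamma> by (simp add: D2_def B2_def powr_mult mult_ac)
      also have "\<dots> \<le> \<gamma> powr p * B" unfolding B_def by (intro mult_left_mono) auto
      finally have "D2 * (\<theta> / (1 / q)) \<le> \<gamma>" using \<gamma>B by simp
      moreover have "L t powr (- (1 / q)) \<le> 1"
        using powr_mono[of "- (1 / q)" 0 "L t"] L(3)[OF t] q0 by simp
      ultimately have "D2 * (\<theta> / (1 / q)) * L t powr (- (1 / q)) \<le> \<gamma> * 1" using \<gamma> by (intro mult_mono) auto
      then show "ennreal D2 * ennreal (\<theta> / (1 / q) * L t powr (- (1 / q))) \<le> ennreal \<gamma>"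
        using D q0 \<theta>_pos by (subst ennreal_mult[symmetric]) (auto simp: mult.assoc intro!: ennreal_leI)
    qed auto
    finally have duh: "duhamel p U x t \<le> ennreal (\<gamma> * L t powr (- (q / 2))) * V t x + ennreal \<gamma> * G t x" .
    have "heat t (\<lambda>y. ennreal \<gamma> * g y) x = ennreal \<gamma> * G t x" by (simp add: G_def heat_cmult)
    moreover have "ennreal \<gamma> * G t x + (ennreal (\<gamma> * L t powr (- (q / 2))) * V t x + ennreal \<gamma> * G t x) = U x t"
    proof -
      have "ennreal (2 * \<gamma>) = ennreal \<gamma> + ennreal \<gamma>" using \<gamma> by (simp add: ennreal_plus[symmetric] del: ennreal_plus)
      then show ?thesis by (simp add: U_def distrib_right add_ac)
    qed
    ultimately show "heat t (\<lambda>y. ennreal \<gamma> * g y) x + duhamel p U x t \<le> U x t"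
      using add_left_mono[OF duh, of "ennreal \<gamma> * G t x"] by simp
  qed
  have "(\<lambda>y. ennreal \<gamma> * g y) = (\<lambda>y. ennreal (\<gamma> * (if norm y < r0 then log_weight (q + 1) y else 0)))"
    using \<gamma> by (simp add: g_def lam_def ennreal_mult log_weight_nonneg)
  then have "supersolution p (\<lambda>y. ennreal (\<gamma> * (if norm y < r0 then log_weight (q + 1) y else 0))) (ereal T) U"
    unfolding supersolution_def using Um main by (auto intro!: always_eventually)
  moreover have "0 < T" by (simp add: T_def)
  ultimately show ?thesis using that \<gamma> r0 by blast
qed

end

section \<open>Thresholds\<close>

context heat_semigroup
begin

lemma supersolution_mono:
  assumes U: "supersolution p f T U" and f: "AE y in lborel. f' y \<le> f y" and T: "T' \<le> T"
  shows "supersolution p f' T' U"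
proof -
  have "AE (x, t) in lborel. 0 < t \<and> ereal t < T \<longrightarrow> U x t < top \<and> heat t f x + duhamel p U x t \<le> U x t"
    using U by (simp add: supersolution_def)
  then have "AE (x, t) in lborel. 0 < t \<and> ereal t < T' \<longrightarrow> U x t < top \<and> heat t f' x + duhamel p U x t \<le> U x t"
    by (elim eventually_mono) (auto intro: order_trans[OF add_right_mono[OF heat_mono_AE[OF f]]] less_le_trans[OF _ T])
  then show ?thesis using U by (simp add: supersolution_def)
qed

text \<open>Convexity of \<open>z \<mapsto> z\<^sup>p\<close> makes room for an additive constant in the data at the price of an
  arbitrarily small loss in the multiplicative constant.\<close>

lemma supersolution_perturb:
  assumes p: "1 < p" and [measurable]: "f \<in> borel_measurable borel"
    and U: "supersolution p f T U" and T: "0 < T" and l: "0 \<le> l" "l < 1" and C: "0 \<le> C"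
  obtains T' V where "0 < T'" "supersolution p (\<lambda>y. ennreal l * f y + ennreal C) T' V"
proof -
  have [measurable]: "(\<lambda>(x, t). U x t) \<in> borel_measurable (borel \<Otimes>\<^sub>M borel)"
    and Us: "AE (x, t) in lborel. 0 < t \<and> ereal t < T \<longrightarrow> U x t < top \<and> heat t f x + duhamel p U x t \<le> U x t"
    using U by (auto simp: supersolution_def)
  \<comment> \<open>In the convex combination \<open>V = l * U + (1 - l) * (2 * C / (1 - l))\<close>
    the constant contributes \<open>k\<close> to the \<open>p\<close>-th power. Of the
    \<open>2 * C\<close>, one \<open>C\<close> is the constant in the data, the other pays for the
    Duhamel integral of \<open>k\<close> over times up to \<delta>.\<close>
  define k where "k = (1 - l) * (2 * C / (1 - l)) powr p"
  have k: "0 \<le> k" using l by (simp add: k_def)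
  obtain \<delta> where \<delta>: "0 < \<delta>" "k * \<delta> \<le> C"
  proof (cases "C = 0")
    case True
    then show ?thesis using that[of 1] by (simp add: k_def)
  next
    case False
    then have "0 < k" using C l by (simp add: k_def)
    then show ?thesis using that[of "C / k"] C False by simp
  qed
  define T' where "T' = min T (ereal \<delta>)"
  have T': "0 < T'" "T' \<le> T" "T' \<le> ereal \<delta>" using T \<delta> by (auto simp: T'_def)
  define V where "V x t = ennreal l * U x t + ennreal (2 * C)" for x t
  have Vm: "(\<lambda>(x, t). V x t) \<in> borel_measurable (borel \<Otimes>\<^sub>M borel)" unfolding V_def by measurable
  have pow: "epow p (V y s) \<le> ennreal l * epow p (U y s) + ennreal k" for y s
  proof -
    have "ennreal (2 * C) = ennreal (1 - l) * ennreal (2 * C / (1 - l))"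
      using l C by (simp add: ennreal_mult[symmetric])
    then have "epow p (V y s) \<le> ennreal l * epow p (U y s) + ennreal (1 - l) * epow p (ennreal (2 * C / (1 - l)))"
      unfolding V_def using epow_convex[OF p l(1), of "U y s" "ennreal (2 * C / (1 - l))"] l by simp
    also have "ennreal (1 - l) * epow p (ennreal (2 * C / (1 - l))) = ennreal k"
      using l C by (simp add: k_def ennreal_mult)
    finally show ?thesis .
  qed
  have duh: "duhamel p V x t \<le> ennreal l * duhamel p U x t + ennreal C" if t: "0 < t" "t \<le> \<delta>" for x t
  proof -
    have "duhamel p V x t \<le> (\<integral>\<^sup>+s. ennreal l * (indicator {0<..<t} s * heat (t - s) (\<lambda>y. epow p (U y s)) x) + ennreal k * indicator {0<..<t} s \<partial>lborel)"
      unfolding duhamel_def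
    proof (intro nn_integral_mono)
      fix s
      show "indicator {0<..<t} s * heat (t - s) (\<lambda>y. epow p (V y s)) x
        \<le> ennreal l * (indicator {0<..<t} s * heat (t - s) (\<lambda>y. epow p (U y s)) x) + ennreal k * indicator {0<..<t} s"
      proof (cases "s \<in> {0<..<t}")
        case True
        have "heat (t - s) (\<lambda>y. epow p (V y s)) x \<le> heat (t - s) (\<lambda>y. ennreal l * epow p (U y s) + ennreal k) x"
          by (intro heat_mono pow)
        also have "\<dots> = ennreal l * heat (t - s) (\<lambda>y. epow p (U y s)) x + ennreal k"
          using True by (subst heat_add) (auto simp: heat_cmult heat_const)
        finally show ?thesis using True by simp
      qed simp
    qed
    also have "\<dots> = ennreal l * duhamel p U x t + ennreal k * ennreal t"
      unfolding duhamel_eq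
      using t by (subst nn_integral_add) (auto simp: nn_integral_cmult duhamel_def[symmetric] duhamel_eq[symmetric])
    also have "ennreal k * ennreal t \<le> ennreal C"
    proof -
      have "k * t \<le> C" using mult_left_mono[OF t(2) k] \<delta> by simp
      then show ?thesis using k t by (simp add: ennreal_mult[symmetric] ennreal_leI)
    qed
    finally show ?thesis by (simp add: add_left_mono)
  qed
  have "AE (x, t) in lborel. 0 < t \<and> ereal t < T' \<longrightarrow> V x t < top \<and> heat t (\<lambda>y. ennreal l * f y + ennreal C) x + duhamel p V x t \<le> V x t"
    using Us
  proof eventually_elim
    case (elim z)
    obtain x t where z: "z = (x, t)" by (cases z) auto
    have "V x t < top \<and> heat t (\<lambda>y. ennreal l * f y + ennreal C) x + duhamel p V x t \<le> V x t" if t: "0 < t" "ereal t < T'"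
    proof
      have "ereal t < T" using less_le_trans[OF t(2) T'(2)] .
      then have u: "U x t < top" "heat t f x + duhamel p U x t \<le> U x t" using elim t z by auto
      have "ereal t < ereal \<delta>" using less_le_trans[OF t(2) T'(3)] .
      then have t\<delta>: "t \<le> \<delta>" by simp
      show "V x t < top" using u(1) by (simp add: V_def ennreal_mult_eq_top_iff less_top[symmetric])
      have "heat t (\<lambda>y. ennreal l * f y + ennreal C) x + duhamel p V x t \<le> (ennreal l * heat t f x + ennreal C) + (ennreal l * duhamel p U x t + ennreal C)"
        using t by (intro add_mono duh t\<delta>) (auto simp: heat_add heat_cmult heat_const)
      also have "\<dots> = ennreal l * (heat t f x + duhamel p U x t) + ennreal (2 * C)"
      proof -
        have "ennreal (2 * C) = ennreal C + ennreal C" using C by (simp add: ennreal_plus[symmetric] del: ennreal_plus)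
        then show ?thesis by (simp add: distrib_left add_ac)
      qed
      also have "\<dots> \<le> V x t" unfolding V_def by (intro add_right_mono mult_left_mono u) auto
      finally show "heat t (\<lambda>y. ennreal l * f y + ennreal C) x + duhamel p V x t \<le> V x t" .
    qed
    then show ?case using z by auto
  qed
  then have "supersolution p (\<lambda>y. ennreal l * f y + ennreal C) T' V"
    using Vm by (simp add: supersolution_def)
  then show ?thesis using that T' by blast
qed

definition solvable :: "real \<Rightarrow> ('a \<Rightarrow> ennreal) \<Rightarrow> bool" where
  "solvable p f \<longleftrightarrow> (\<exists>T>0. \<exists>U. supersolution p f T U)"

lemma solvable_mono: "solvable p f \<Longrightarrow> (AE y in lborel. f' y \<le> f y) \<Longrightarrow> solvable p f'"
  unfolding solvable_def using supersolution_mono[OF _ _ order_refl] by blast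

lemma solvable_perturb:
  assumes "1 < p" "f \<in> borel_measurable borel" "solvable p f" "0 \<le> l" "l < 1" "0 \<le> C"
  shows "solvable p (\<lambda>y. ennreal l * f y + ennreal C)"
proof -
  from assms(3) obtain T U where "0 < T" "supersolution p f T U" by (auto simp: solvable_def)
  from supersolution_perturb[OF assms(1,2) this(2,1) assms(4-6)] show ?thesis
    unfolding solvable_def by metis
qed

lemma solvability_threshold:
  fixes g :: "'a \<Rightarrow> real"
  assumes p: "1 < p" and [measurable]: "g \<in> borel_measurable borel" and g0: "\<And>y. 0 \<le> g y"
    and ex: "0 < \<gamma>0" "solvable p (\<lambda>y. ennreal (\<gamma>0 * g y))"
    and bd: "\<And>\<gamma>. 0 < \<gamma> \<Longrightarrow> solvable p (\<lambda>y. ennreal (\<gamma> * g y)) \<Longrightarrow> \<gamma> \<le> \<Gamma>"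
  shows "\<exists>\<gamma>\<^sub>s>0. \<forall>\<gamma>\<ge>0. \<forall>C\<ge>0. (\<gamma> < \<gamma>\<^sub>s \<longrightarrow> solvable p (\<lambda>y. ennreal (\<gamma> * g y + C))) \<and>
     (\<gamma> > \<gamma>\<^sub>s \<longrightarrow> \<not> solvable p (\<lambda>y. ennreal (\<gamma> * g y + C)))"
proof -
  define A where "A = {\<gamma>. 0 < \<gamma> \<and> solvable p (\<lambda>y. ennreal (\<gamma> * g y))}"
  have A: "\<gamma>0 \<in> A" "bdd_above A" using ex bd by (auto simp: A_def intro!: bdd_aboveI)
  have "solvable p (\<lambda>y. ennreal (\<gamma> * g y + C))" if \<gamma>: "0 \<le> \<gamma>" "\<gamma> < Sup A" and C: "0 \<le> C" for \<gamma> C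
  proof -
    obtain \<gamma>' where \<gamma>': "\<gamma>' \<in> A" "\<gamma> < \<gamma>'" using \<gamma>(2) less_cSup_iff[OF _ A(2)] A(1) by blast
    have "solvable p (\<lambda>y. ennreal (\<gamma> / \<gamma>') * ennreal (\<gamma>' * g y) + ennreal C)"
      using \<gamma>' \<gamma> C p by (intro solvable_perturb) (auto simp: A_def)
    moreover have "ennreal (\<gamma> / \<gamma>') * ennreal (\<gamma>' * g y) + ennreal C = ennreal (\<gamma> * g y + C)" for y
      using \<gamma>' \<gamma> C g0[of y] by (simp add: ennreal_mult[symmetric] ennreal_plus[symmetric] del: ennreal_plus)
    ultimately show ?thesis by simp
  qed
  moreover have "\<not> solvable p (\<lambda>y. ennreal (\<gamma> * g y + C))" if \<gamma>: "0 \<le> \<gamma>" "Sup A < \<gamma>" and C: "0 \<le> C" for \<gamma> C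
  proof
    assume "solvable p (\<lambda>y. ennreal (\<gamma> * g y + C))"
    then have "solvable p (\<lambda>y. ennreal (\<gamma> * g y))"
      by (rule solvable_mono) (use C in \<open>auto intro!: always_eventually ennreal_leI\<close>)
    moreover have "0 < \<gamma>" using cSup_upper[OF A] \<gamma> ex by linarith
    ultimately have "\<gamma> \<in> A" by (simp add: A_def)
    then show False using cSup_upper[OF _ A(2)] \<gamma> by fastforce
  qed
  moreover have "0 < Sup A" using cSup_upper[OF A] ex by linarith
  ultimately show ?thesis by blast
qed

section \<open>The two singular profiles: solvability and bounds on the coefficient\<close>

lemma solvable_real_time:
  assumes "solvable p f"
  obtains T U where "0 < T" "supersolution p f (ereal T) U"
proof -
  obtain T U where T: "0 < T" and U: "supersolution p f T U" using assms by (auto simp: solvable_def)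
  obtain T' where "0 < T'" "ereal T' < T" using ereal_dense2[OF T] by auto
  then show ?thesis using that supersolution_mono[OF U _ less_imp_le[of "ereal T'" T]] by auto
qed

text \<open>The mass of a ball to the power \<open>p - 1\<close> and the factor
  \<open>R powr (1 - \<kappa>)\<close> scale inversely. With \<open>R = 2 * \<rho>\<close> every
  power of \<rho> drops out, and the bound on \<gamma> depends neither on \<open>T\<close> nor on
  \<open>U\<close>.\<close>

lemma supercritical_bound:
  assumes p: "1 < p" and b: "\<theta> / (p - 1) < real DIM('a)"
  shows "\<exists>\<Gamma>. \<forall>\<gamma>>0. solvable p (\<lambda>y. ennreal (\<gamma> * norm y powr (- (\<theta> / (p - 1))))) \<longrightarrow> \<gamma> \<le> \<Gamma>"
proof -
  define b where "b = \<theta> / (p - 1)"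
  have b0: "b < real DIM('a)" using b by (simp add: b_def)
  define \<kappa> where "\<kappa> = q * (p - 1)"
  have \<kappa>: "1 < \<kappa>"
    using b p \<theta>_pos by (simp add: \<kappa>_def q_def field_simps)
  obtain e :: 'a where e: "norm e = 2" using vector_choose_size[of 2] by auto
  have Ke: "0 < K e 1" by (rule K_pos) simp
  define c where "c = real DIM('a) * unit_ball_vol DIM('a) / (real DIM('a) - b)"
  have c: "0 < c" using b0 by (simp add: c_def)
  define a where "a = 2 powr - q * K e 1 * c"
  have a: "0 < a" using Ke c by (simp add: a_def)
  define D where "D = 2 powr - q * 2 powr (1 - \<kappa>) * ln 2"
  have D: "0 < D" by (simp add: D_def)
  define Z where "Z = 1 / (1 - 2 powr (1 - p)) / D"
  have "\<gamma> \<le> Z powr (1 / (p - 1)) / a" if \<gamma>: "0 < \<gamma>" and sol: "solvable p (\<lambda>y. ennreal (\<gamma> * norm y powr (- b)))" for \<gamma>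
  proof -
    obtain T U where T: "0 < T" and U: "supersolution p (\<lambda>y. ennreal (\<gamma> * norm y powr (- b))) (ereal T) U"
      using solvable_real_time[OF sol] by blast
    \<comment> \<open>Any \<rho> with \<open>4 * \<rho> < T\<close> would do; in contrast to the
      critical case, nothing is gained from a long range between \<rho> and
      \<open>R\<close>.\<close>
    define \<rho> where "\<rho> = T / 8"
    have \<rho>: "0 < \<rho>" "\<rho> < 2 * \<rho>" "2 * (2 * \<rho>) < T" using T by (auto simp: \<rho>_def)
    define m where "m = \<gamma> * (c * \<rho> powr ((\<kappa> - 1) / (p - 1)))"
    have m: "0 < m" using \<gamma> c \<rho> by (simp add: m_def)
    have "(\<integral>\<^sup>+(y::'a). indicator (ball 0 (\<rho> powr (1 / \<theta>))) y * ennreal (\<gamma> * norm y powr (- b)) \<partial>lborel)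
      = (\<integral>\<^sup>+(y::'a). ennreal \<gamma> * (indicator (ball 0 (\<rho> powr (1 / \<theta>))) y * ennreal (norm y powr (- b))) \<partial>lborel)"
      using \<gamma> by (intro nn_integral_cong) (simp add: ennreal_mult mult_ac)
    also have "\<dots> = ennreal \<gamma> * ennreal (real DIM('a) * unit_ball_vol DIM('a) * ((\<rho> powr (1 / \<theta>)) powr (real DIM('a) - b) / (real DIM('a) - b)))"
    proof (subst nn_integral_cmult)
      note borel_open[OF open_ball, measurable]
      show "(\<lambda>y::'a. indicator (ball 0 (\<rho> powr (1 / \<theta>))) y * ennreal (norm y powr (- b))) \<in> borel_measurable lborel" by measurable
      show "ennreal \<gamma> * (\<integral>\<^sup>+(y::'a). indicator (ball 0 (\<rho> powr (1 / \<theta>))) y * ennreal (norm y powr (- b)) \<partial>lborel)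
        = ennreal \<gamma> * ennreal (real DIM('a) * unit_ball_vol DIM('a) * ((\<rho> powr (1 / \<theta>)) powr (real DIM('a) - b) / (real DIM('a) - b)))"
        using nn_integral_power_ball[OF b0, of "\<rho> powr (1 / \<theta>)"] \<rho> by simp
    qed
    also have "\<dots> = ennreal m"
    proof -
      have "1 / \<theta> * (real DIM('a) - b) = (\<kappa> - 1) / (p - 1)"
        using p \<theta>_pos by (simp add: b_def \<kappa>_def q_def field_simps)
      then have "(\<rho> powr (1 / \<theta>)) powr (real DIM('a) - b) = \<rho> powr ((\<kappa> - 1) / (p - 1))" by (simp only: powr_powr)
      then have "real DIM('a) * unit_ball_vol DIM('a) * ((\<rho> powr (1 / \<theta>)) powr (real DIM('a) - b) / (real DIM('a) - b)) = c * \<rho> powr ((\<kappa> - 1) / (p - 1))"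
        by (simp add: c_def)
      then show ?thesis unfolding m_def using \<gamma> c by (simp only:) (intro ennreal_mult[symmetric], auto)
    qed
    finally have M: "ennreal m \<le> (\<integral>\<^sup>+(y::'a). indicator (ball 0 (\<rho> powr (1 / \<theta>))) y * ennreal (\<gamma> * norm y powr (- b)) \<partial>lborel)" by simp
    have "(2 powr - q * K e 1 * m) powr (p - 1) * (2 powr - q * (2 * \<rho>) powr (1 - q * (p - 1))) * ln (2 * \<rho> / \<rho>) \<le> 1 / (1 - 2 powr (1 - p))"
      by (rule necessary_condition[OF p _ _ U \<rho> e M m]) (use \<kappa> in \<open>auto simp: \<kappa>_def\<close>)
    also have "(2 powr - q * K e 1 * m) powr (p - 1) * (2 powr - q * (2 * \<rho>) powr (1 - q * (p - 1))) * ln (2 * \<rho> / \<rho>) = (a * \<gamma>) powr (p - 1) * D"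
    proof -
      have "2 powr - q * K e 1 * m = (a * \<gamma>) * \<rho> powr ((\<kappa> - 1) / (p - 1))" by (simp add: a_def m_def)
      then have "(2 powr - q * K e 1 * m) powr (p - 1) = (a * \<gamma>) powr (p - 1) * \<rho> powr (\<kappa> - 1)"
        using a \<gamma> p by (simp add: powr_mult powr_powr)
      moreover have "(2 * \<rho>) powr (1 - q * (p - 1)) = 2 powr (1 - \<kappa>) * \<rho> powr (1 - \<kappa>)"
        using \<rho> by (simp add: powr_mult \<kappa>_def)
      moreover have "\<rho> powr (\<kappa> - 1) * \<rho> powr (1 - \<kappa>) = 1" using \<rho> by (simp flip: powr_add)
      then have "\<rho> powr (\<kappa> - 1) * (\<rho> powr (1 - \<kappa>) * z) = z" for z by (simp flip: mult.assoc)
      ultimately show ?thesis using \<rho> by (simp add: D_def mult_ac)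
    qed
    finally have "(a * \<gamma>) powr (p - 1) \<le> Z" using D by (simp only: Z_def pos_le_divide_eq)
    then have "((a * \<gamma>) powr (p - 1)) powr (1 / (p - 1)) \<le> Z powr (1 / (p - 1))"
      using p by (intro powr_mono2) auto
    then have "a * \<gamma> \<le> Z powr (1 / (p - 1))" using p a \<gamma> by (simp add: powr_powr)
    then show ?thesis using a by (simp add: pos_le_divide_eq mult.commute)
  qed
  then show ?thesis unfolding b_def by blast
qed

definition critical_profile :: "'a \<Rightarrow> real" where
  "critical_profile y = norm y powr (- real DIM('a)) * ln (exp 1 + 1 / norm y) powr (- q - 1)"

lemma critical_profile_measurable [measurable]: "critical_profile \<in> borel_measurable borel"
  unfolding critical_profile_def by measurable

lemma critical_profile_nonneg: "0 \<le> critical_profile y"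
  by (simp add: critical_profile_def)

text \<open>The added constant covers the region away from 0. It is harmless, since an additive
  constant costs only an arbitrarily small part of the coefficient.\<close>

lemma critical_profile_le:
  assumes r0: "0 < r0" "r0 < 1"
  shows "critical_profile y \<le> (if norm y < r0 then log_weight (q + 1) y else 0) + r0 powr (- real DIM('a))"
proof (cases "y = 0")
  case True
  then show ?thesis using r0 by (simp add: critical_profile_def log_weight_def)
next
  case False
  then have y: "0 < norm y" by simp
  have ge1: "1 \<le> ln (exp 1 + 1 / norm y)"
  proof -
    have "ln (exp 1) \<le> ln (exp 1 + 1 / norm y)" using y by (subst ln_le_cancel_iff) (auto intro: add_pos_pos)
    then show ?thesis by simp
  qed
  show ?thesis
  proof (cases "norm y < r0")
    case True
    have ln0: "0 < - ln (norm y)" using True r0 y ln_less_zero[of "norm y"] by simp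
    have "- ln (norm y) = ln (1 / norm y)" using y by (simp add: ln_div)
    also have "\<dots> \<le> ln (exp 1 + 1 / norm y)" using y by (subst ln_le_cancel_iff) (auto intro: add_pos_pos)
    finally have "ln (exp 1 + 1 / norm y) powr (- q - 1) \<le> (- ln (norm y)) powr (- q - 1)"
      using ln0 q_pos by (intro powr_mono2') auto
    then have "critical_profile y \<le> log_weight (q + 1) y"
      unfolding critical_profile_def log_weight_def by (simp add: mult_left_mono)
    then show ?thesis using True by (simp add: add_increasing2)
  next
    case False
    have "critical_profile y \<le> norm y powr (- real DIM('a)) * 1"
      unfolding critical_profile_def using powr_mono[of "- q - 1" 0 "ln (exp 1 + 1 / norm y)"] ge1 q_pos
      by (intro mult_left_mono) auto
    also have "\<dots> \<le> r0 powr (- real DIM('a))" using False r0 by (simp add: powr_mono2')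
    finally show ?thesis using False by simp
  qed
qed

text \<open>For \<open>s = 1 / norm y > 3\<close> one has \<open>exp 1 + s \<le> s\<^sup>2\<close>,
  so the regularized logarithm is at most twice \<open>- ln (norm y)\<close>.\<close>

lemma critical_profile_ge:
  assumes y: "norm y < 1 / 3"
  shows "2 powr (- q - 1) * log_weight (q + 1) y \<le> critical_profile y"
proof (cases "y = 0")
  case True
  then show ?thesis by (simp add: critical_profile_def log_weight_def)
next
  case False
  define s where "s = 1 / norm y"
  have s: "3 < s" using y False by (simp add: s_def field_simps)
  have "exp 1 + s \<le> s\<^sup>2"
  proof -
    have "exp 1 + s \<le> s + s" using exp_le s by simp
    also have "\<dots> \<le> s * s" using s mult_right_mono[of 2 s s] by simp
    finally show ?thesis by (simp add: power2_eq_square)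
  qed
  then have "ln (exp 1 + s) \<le> ln (s\<^sup>2)" using s by (subst ln_le_cancel_iff) (auto intro: add_pos_pos)
  also have "\<dots> = 2 * ln s" using s by (simp add: ln_realpow)
  also have "ln s = - ln (norm y)" using False by (simp add: s_def ln_div)
  finally have le: "ln (exp 1 + 1 / norm y) \<le> 2 * (- ln (norm y))" by (simp add: s_def)
  have "ln (exp 1) < ln (exp 1 + s)" using s by (subst ln_less_cancel_iff) (auto intro: add_pos_pos)
  then have "0 < ln (exp 1 + 1 / norm y)" by (simp add: s_def)
  then have "(2 * (- ln (norm y))) powr (- q - 1) \<le> ln (exp 1 + 1 / norm y) powr (- q - 1)"
    using le q_pos by (intro powr_mono2') auto
  moreover have "(2 * (- ln (norm y))) powr (- q - 1) = 2 powr (- q - 1) * (- ln (norm y)) powr (- q - 1)"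
    using \<open>0 < ln (exp 1 + 1 / norm y)\<close> le by (subst powr_mult) auto
  ultimately have "norm y powr (- real DIM('a)) * (2 powr (- q - 1) * (- ln (norm y)) powr (- q - 1)) \<le> critical_profile y"
    unfolding critical_profile_def by (intro mult_left_mono) auto
  then show ?thesis by (simp add: log_weight_def mult.left_commute)
qed

text \<open>The supersolution belongs to the truncated weight; the perturbation with
  \<open>l = 1 / 2\<close> adds the constant by which the true profile may exceed it.\<close>

lemma critical_solvable:
  assumes p: "p = 1 + 1 / q"
  obtains \<gamma> where "0 < \<gamma>" "solvable p (\<lambda>y. ennreal (\<gamma> * critical_profile y))"
proof -
  have p1: "1 < p" using p q_pos by simp
  obtain \<gamma> r0 T U where \<gamma>: "0 < \<gamma>" and r0: "0 < r0" "r0 < 1" and T: "0 < T"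
    and U: "supersolution p (\<lambda>y. ennreal (\<gamma> * (if norm y < r0 then log_weight (q + 1) y else 0))) (ereal T) U"
    by (rule critical_supersolution[OF p])
  let ?w = "\<lambda>y::'a. if norm y < r0 then log_weight (q + 1) y else 0"
  have "solvable p (\<lambda>y. ennreal (\<gamma> * ?w y))"
    unfolding solvable_def using U T by (intro exI[of _ "ereal T"]) auto
  then have "solvable p (\<lambda>y. ennreal (1 / 2) * ennreal (\<gamma> * ?w y) + ennreal (\<gamma> / 2 * r0 powr (- real DIM('a))))"
    using \<gamma> by (intro solvable_perturb p1) auto
  moreover have "ennreal (\<gamma> / 2 * critical_profile y) \<le> ennreal (1 / 2) * ennreal (\<gamma> * ?w y) + ennreal (\<gamma> / 2 * r0 powr (- real DIM('a)))" for y
  proof -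
    have w0: "0 \<le> ?w y" by (simp add: log_weight_nonneg)
    have "\<gamma> / 2 * critical_profile y \<le> \<gamma> / 2 * (?w y + r0 powr (- real DIM('a)))"
      using \<gamma> by (intro mult_left_mono critical_profile_le r0) auto
    also have "\<dots> = 1 / 2 * (\<gamma> * ?w y) + \<gamma> / 2 * r0 powr (- real DIM('a))" by (simp add: algebra_simps)
    finally have "ennreal (\<gamma> / 2 * critical_profile y) \<le> ennreal (1 / 2 * (\<gamma> * ?w y) + \<gamma> / 2 * r0 powr (- real DIM('a)))" by (rule ennreal_leI)
    also have "\<dots> = ennreal (1 / 2 * (\<gamma> * ?w y)) + ennreal (\<gamma> / 2 * r0 powr (- real DIM('a)))"
      using \<gamma> w0 by (intro ennreal_plus) auto
    also have "ennreal (1 / 2 * (\<gamma> * ?w y)) = ennreal (1 / 2) * ennreal (\<gamma> * ?w y)"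
      using \<gamma> w0 by (intro ennreal_mult) auto
    finally show ?thesis .
  qed
  ultimately have "solvable p (\<lambda>y. ennreal (\<gamma> / 2 * critical_profile y))"
    by (rule solvable_mono[OF _ always_eventually[OF allI]])
  then show ?thesis using that[of "\<gamma> / 2"] \<gamma> by simp
qed

text \<open>Here \<open>q * (p - 1) = 1\<close>, so the power of \<open>R\<close> disappears and
  only logarithms matter: the mass to the power \<open>p - 1\<close> is of order
  \<open>1 / \<Lambda>\<close>, while \<open>ln (R / \<rho>)\<close> is at least
  \<open>\<theta> * \<Lambda> / 2\<close>. The product gives a bound on \<gamma> free of \<Lambda>,
  \<open>T\<close> and \<open>U\<close>.\<close>

lemma critical_bound:
  assumes p: "p = 1 + 1 / q"
  shows "\<exists>\<Gamma>. \<forall>\<gamma>>0. solvable p (\<lambda>y. ennreal (\<gamma> * critical_profile y)) \<longrightarrow> \<gamma> \<le> \<Gamma>"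
proof -
  have p1: "1 < p" "q * (p - 1) = 1" using p q_pos by auto
  obtain e :: 'a where e: "norm e = 2" using vector_choose_size[of 2] by auto
  have Ke: "0 < K e 1" by (rule K_pos) simp
  define c where "c = 2 powr (- q - 1) * (real DIM('a) * unit_ball_vol DIM('a) / q)"
  have c: "0 < c" using q_pos by (simp add: c_def)
  define a where "a = 2 powr - q * K e 1 * c"
  have a: "0 < a" using Ke c by (simp add: a_def)
  define D where "D = 2 powr - q * \<theta> / 2"
  have D: "0 < D" using \<theta>_pos by (simp add: D_def)
  define Z where "Z = 1 / (1 - 2 powr (1 - p)) / D"
  have "\<gamma> \<le> Z powr q / a" if \<gamma>: "0 < \<gamma>" and sol: "solvable p (\<lambda>y. ennreal (\<gamma> * critical_profile y))" for \<gamma>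
  proof -
    obtain T U where T: "0 < T" and U: "supersolution p (\<lambda>y. ennreal (\<gamma> * critical_profile y)) (ereal T) U"
      using solvable_real_time[OF sol] by blast
    define R where "R = T / 4"
    have R: "0 < R" "2 * R < T" using T by (auto simp: R_def)
    \<comment> \<open>\<open>ln 3 \<le> \<Lambda>\<close> puts the ball of radius
      \<open>r = exp (- \<Lambda>)\<close> where the profile is bounded below by
      \<open>log_weight\<close>; the other bound gives \<open>\<rho> < R\<close> and lets half of
      \<open>\<theta> * \<Lambda>\<close> absorb \<open>ln R\<close>.\<close>
    define \<Lambda> where "\<Lambda> = max (ln 3) ((2 * \<bar>ln R\<bar> + 1) / \<theta>)"
    have \<Lambda>3: "ln 3 \<le> \<Lambda>" by (simp add: \<Lambda>_def)
    have "(2 * \<bar>ln R\<bar> + 1) / \<theta> \<le> \<Lambda>" by (simp add: \<Lambda>_def)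
    then have \<Lambda>R: "2 * \<bar>ln R\<bar> + 1 \<le> \<theta> * \<Lambda>" using \<theta>_pos by (simp add: pos_divide_le_eq mult.commute)
    have "0 < ln (3::real)" by simp
    with \<Lambda>3 have \<Lambda>0: "0 < \<Lambda>" by linarith
    define \<rho> where "\<rho> = exp (- \<theta> * \<Lambda>)"
    define r where "r = exp (- \<Lambda>)"
    have \<rho>r: "\<rho> powr (1 / \<theta>) = r" using \<theta>_pos by (simp add: \<rho>_def r_def powr_def)
    have r: "0 < r" "r < 1" "- ln r = \<Lambda>" using \<Lambda>0 by (auto simp: r_def)
    have r3: "r \<le> 1 / 3"
    proof -
      have "exp (- \<Lambda>) \<le> exp (- ln (3::real))" using \<Lambda>3 by simp
      then show ?thesis by (simp add: r_def exp_minus inverse_eq_divide)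
    qed
    have \<rho>: "0 < \<rho>" "\<rho> < R"
    proof -
      have "- \<theta> * \<Lambda> < ln R" using \<Lambda>R by linarith
      then have "\<rho> < exp (ln R)" unfolding \<rho>_def by (rule exp_less_mono)
      then show "\<rho> < R" using R by simp
    qed (simp add: \<rho>_def)
    have lnR: "\<theta> * \<Lambda> / 2 \<le> ln (R / \<rho>)"
    proof -
      have "ln (R / \<rho>) = ln R + \<theta> * \<Lambda>" using R by (simp add: ln_div \<rho>_def)
      then show ?thesis using \<Lambda>R by linarith
    qed
    define m where "m = \<gamma> * (c * \<Lambda> powr (- q))"
    have m: "0 < m" using \<gamma> c \<Lambda>0 by (simp add: m_def)
    have "ennreal m = ennreal (\<gamma> * 2 powr (- q - 1)) * ennreal (real DIM('a) * unit_ball_vol DIM('a) * ((- ln r) powr (- q) / q))"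
      unfolding m_def c_def r(3) using \<gamma> q_pos by (subst ennreal_mult[symmetric]) (auto simp: mult_ac)
    also have "\<dots> = ennreal (\<gamma> * 2 powr (- q - 1)) * (\<integral>\<^sup>+(y::'a). indicator (ball 0 r) y * ennreal (log_weight (q + 1) y) \<partial>lborel)"
      by (simp only: nn_integral_log_weight_ball[OF q_pos r(1,2)])
    also have "\<dots> = (\<integral>\<^sup>+(y::'a). ennreal (\<gamma> * 2 powr (- q - 1)) * (indicator (ball 0 r) y * ennreal (log_weight (q + 1) y)) \<partial>lborel)"
    proof (rule nn_integral_cmult[symmetric])
      note borel_open[OF open_ball, measurable]
      show "(\<lambda>y::'a. indicator (ball 0 r) y * ennreal (log_weight (q + 1) y)) \<in> borel_measurable lborel" by measurable
    qed
    also have "\<dots> \<le> (\<integral>\<^sup>+(y::'a). indicator (ball 0 (\<rho> powr (1 / \<theta>))) y * ennreal (\<gamma> * critical_profile y) \<partial>lborel)"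
    proof (intro nn_integral_mono)
      fix y :: 'a
      show "ennreal (\<gamma> * 2 powr (- q - 1)) * (indicator (ball 0 r) y * ennreal (log_weight (q + 1) y)) \<le> indicator (ball 0 (\<rho> powr (1 / \<theta>))) y * ennreal (\<gamma> * critical_profile y)"
      proof (cases "y \<in> ball 0 r")
        case True
        then have "2 powr (- q - 1) * log_weight (q + 1) y \<le> critical_profile y"
          using r3 by (intro critical_profile_ge) auto
        from mult_left_mono[OF this less_imp_le[OF \<gamma>]]
        have "ennreal (\<gamma> * 2 powr (- q - 1) * log_weight (q + 1) y) \<le> ennreal (\<gamma> * critical_profile y)"
          by (intro ennreal_leI) (simp add: mult.assoc)
        also have "ennreal (\<gamma> * 2 powr (- q - 1) * log_weight (q + 1) y) = ennreal (\<gamma> * 2 powr (- q - 1)) * ennreal (log_weight (q + 1) y)"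
          using \<gamma> by (intro ennreal_mult log_weight_nonneg) auto
        finally show ?thesis using True \<rho>r by simp
      qed simp
    qed
    finally have M: "ennreal m \<le> (\<integral>\<^sup>+(y::'a). indicator (ball 0 (\<rho> powr (1 / \<theta>))) y * ennreal (\<gamma> * critical_profile y) \<partial>lborel)" .
    have I: "(2 powr - q * K e 1 * m) powr (p - 1) * (2 powr - q * R powr (1 - q * (p - 1))) * ln (R / \<rho>) \<le> 1 / (1 - 2 powr (1 - p))"
      by (rule necessary_condition[OF p1(1) _ _ U \<rho> R(2) e M m]) (use p1 in auto)
    have eq: "(2 powr - q * K e 1 * m) powr (p - 1) * (2 powr - q * R powr (1 - q * (p - 1))) = (a * \<gamma>) powr (1 / q) / \<Lambda> * 2 powr - q"
    proof -
      have "2 powr - q * K e 1 * m = (a * \<gamma>) * \<Lambda> powr (- q)" by (simp add: a_def m_def)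
      moreover have "(\<Lambda> powr (- q)) powr (1 / q) = 1 / \<Lambda>"
      proof -
        have "(\<Lambda> powr (- q)) powr (1 / q) = \<Lambda> powr (- 1)" unfolding powr_powr using q_pos by simp
        then show ?thesis using \<Lambda>0 by (simp add: powr_minus inverse_eq_divide)
      qed
      ultimately have "(2 powr - q * K e 1 * m) powr (p - 1) = (a * \<gamma>) powr (1 / q) / \<Lambda>"
        using a \<gamma> p by (simp add: powr_mult)
      then show ?thesis using R p1 by simp
    qed
    have lower: "(a * \<gamma>) powr (1 / q) / \<Lambda> * 2 powr - q * (\<theta> * \<Lambda> / 2) \<le> (a * \<gamma>) powr (1 / q) / \<Lambda> * 2 powr - q * ln (R / \<rho>)"
      using \<Lambda>0 by (intro mult_left_mono lnR) auto
    have simplify: "(a * \<gamma>) powr (1 / q) / \<Lambda> * 2 powr - q * (\<theta> * \<Lambda> / 2) = (a * \<gamma>) powr (1 / q) * D"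
      using \<Lambda>0 by (simp add: D_def)
    have "(a * \<gamma>) powr (1 / q) * D \<le> 1 / (1 - 2 powr (1 - p))"
      using order_trans[OF lower I[unfolded eq]] unfolding simplify .
    then have "(a * \<gamma>) powr (1 / q) \<le> Z" using D by (simp only: Z_def pos_le_divide_eq)
    then have "((a * \<gamma>) powr (1 / q)) powr q \<le> Z powr q"
      using q_pos by (intro powr_mono2) auto
    then have "a * \<gamma> \<le> Z powr q" using q_pos a \<gamma> by (simp add: powr_powr)
    then show ?thesis using a by (simp add: pos_le_divide_eq mult.commute)
  qed
  then show ?thesis by blast
qed

end

section \<open>Transfer to the fractional heat kernel\<close>

lemma heat_semigroup_stable_density:
  assumes \<theta>: "0 < \<theta>" "\<theta> \<le> 2"
  shows "heat_semigroup (stable_density \<theta> :: 'a::euclidean_space \<Rightarrow> real \<Rightarrow> real) \<theta> (real DIM('a) / \<theta>)"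
proof
  fix t s :: real and x y :: 'a
  show "(\<integral>\<^sup>+(x::'a). ennreal (stable_density \<theta> x t) \<partial>lborel) = 1" if "0 < t"
    using has_bochner_integral_stable_density[OF \<theta> that]
    by (subst nn_integral_eq_integral) (auto simp: has_bochner_integral_iff stable_density_nonneg[OF \<theta>])
  show "(\<lambda>(x, t). stable_density \<theta> (x::'a) t) \<in> borel_measurable borel"
    by (rule stable_density_measurable_pair[OF \<theta>])
  show "0 < stable_density \<theta> x t" if "0 < t"
    by (rule stable_density_pos[OF \<theta> that])
  show "stable_density \<theta> x t = 0" if "t \<le> 0"
    using that by (simp add: stable_density_def)
  show "(\<integral>\<^sup>+y. ennreal (stable_density \<theta> (x - y) t) * ennreal (stable_density \<theta> y s) \<partial>lborel) = ennreal (stable_density \<theta> x (t + s))"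
    if "0 < t" "0 < s"
    by (rule stable_density_semigroup[OF \<theta> that])
  show "stable_density \<theta> x t = t powr - (real DIM('a) / \<theta>) * stable_density \<theta> (t powr (- (1 / \<theta>)) *\<^sub>R x) 1" if "0 < t"
    by (rule stable_density_scale[OF \<theta>(1) that])
  show "stable_density \<theta> y t \<le> stable_density \<theta> x t" if "norm x \<le> norm y"
    by (rule stable_density_antimono[OF \<theta> that])
qed (use \<theta> in auto)

context
  fixes \<theta> :: real
  assumes \<theta>: "0 < \<theta>" "\<theta> \<le> 2"
begin

interpretation heat_semigroup "stable_density \<theta> :: real ^ 'n \<Rightarrow> real \<Rightarrow> real" \<theta> "real CARD('n) / \<theta>"
  using heat_semigroup_stable_density[OF \<theta>, where 'a = "real ^ 'n"] by simp

lemma fun_measure_heat: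
  fixes f :: "real ^ 'n \<Rightarrow> real"
  assumes [measurable]: "f \<in> borel_measurable borel" and t: "0 < t"
  shows "(\<integral>\<^sup>+y. ennreal (frac_heat_kernel \<theta> (x - y) t) \<partial>fun_measure f) = heat t (\<lambda>y. ennreal (f y)) x"
proof -
  have "(\<integral>\<^sup>+y. ennreal (frac_heat_kernel \<theta> (x - y) t) \<partial>fun_measure f) = (\<integral>\<^sup>+y. ennreal (stable_density \<theta> (x - y) t) \<partial>fun_measure f)"
    by (simp add: frac_heat_kernel_eq[OF \<theta> t])
  also have "\<dots> = heat t (\<lambda>y. ennreal (f y)) x"
    unfolding fun_measure_def heat_def by (subst nn_integral_density) (auto simp: mult.commute)
  finally show ?thesis .
qed

text \<open>Agreement of \<open>u\<close> and \<open>U\<close> almost everywhere on almost every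
  time slice is enough: the inner integral ignores null sets in \<open>y\<close>, the outer one null
  sets in \<open>s\<close>.\<close>

lemma duhamel_integral:
  fixes u :: "real ^ 'n \<Rightarrow> real \<Rightarrow> real" and U :: "real ^ 'n \<Rightarrow> real \<Rightarrow> ennreal"
  assumes eq: "AE s in lborel. 0 < s \<and> s < t \<longrightarrow> (AE y in lborel. U y s = ennreal (u y s) \<and> 0 \<le> u y s)"
  shows "(\<integral>\<^sup>+s\<in>{0<..<t}. (\<integral>\<^sup>+y. ennreal (frac_heat_kernel \<theta> (x - y) (t - s) * u y s powr p) \<partial>lborel) \<partial>lborel) = duhamel p U x t"
  unfolding duhamel_def
proof (intro nn_integral_cong_AE)
  show "AE s in lborel. (\<integral>\<^sup>+y. ennreal (frac_heat_kernel \<theta> (x - y) (t - s) * u y s powr p) \<partial>lborel) * indicator {0<..<t} s =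
       indicator {0<..<t} s * heat (t - s) (\<lambda>y. epow p (U y s)) x"
    using eq
  proof eventually_elim
    case (elim s)
    show ?case
    proof (cases "s \<in> {0<..<t}")
      case True
      then have "AE y in lborel. U y s = ennreal (u y s) \<and> 0 \<le> u y s" and ts: "0 < t - s" using elim by auto
      then have "AE y in lborel. ennreal (frac_heat_kernel \<theta> (x - y) (t - s) * u y s powr p) = ennreal (stable_density \<theta> (x - y) (t - s)) * epow p (U y s)"
        by (elim eventually_mono) (simp add: frac_heat_kernel_eq[OF \<theta> ts] ennreal_mult stable_density_nonneg[OF \<theta>])
      then show ?thesis using True unfolding heat_def by (simp cong: nn_integral_cong_AE)
    qed simp
  qed
qed

lemma solution_imp_supersolution:
  fixes f :: "real ^ 'n \<Rightarrow> real"
  assumes [measurable]: "f \<in> borel_measurable borel" and u: "is_solution \<theta> p (fun_measure f) T u"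
  obtains U where "supersolution p (\<lambda>y. ennreal (f y)) T U"
proof -
  let ?S = "UNIV \<times> {t. 0 < t \<and> ereal t < T} :: ((real ^ 'n) \<times> real) set"
  \<comment> \<open>\<open>u\<close> is known to be measurable and nonnegative on the strip only,
    hence the extension by 0.\<close>
  define U where "U x t = (if 0 < t \<and> ereal t < T then ennreal (u x t) else 0)" for x t
  have um: "(\<lambda>(x, t). u x t) \<in> borel_measurable (restrict_space borel ?S)"
    and u0: "\<And>x t. 0 < t \<Longrightarrow> ereal t < T \<Longrightarrow> 0 \<le> u x t"
    and eq: "AE (x, t) in lborel. 0 < t \<and> ereal t < T \<longrightarrow> ennreal (u x t) =
          (\<integral>\<^sup>+y. ennreal (frac_heat_kernel \<theta> (x - y) t) \<partial>fun_measure f) +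
          (\<integral>\<^sup>+s\<in>{0<..<t}. (\<integral>\<^sup>+y. ennreal (frac_heat_kernel \<theta> (x - y) (t - s) * u y s powr p) \<partial>lborel) \<partial>lborel)"
    using u unfolding is_solution_def by auto
  have "{t. 0 < t \<and> ereal t < T} = {0<..} \<inter> {t. ereal t < T}" by auto
  moreover have "open {t. ereal t < T}" by (intro open_Collect_less continuous_intros)
  ultimately have "open {t. 0 < t \<and> ereal t < T}" by (simp add: open_Int)
  then have S: "?S \<in> sets borel" by (intro borel_open open_Times) auto
  have "(\<lambda>(x, t). ennreal (u x t)) \<in> borel_measurable (restrict_space borel ?S)"
    using measurable_compose[OF um measurable_ennreal] by (simp add: case_prod_beta)
  then have "(\<lambda>z. (case z of (x, t) \<Rightarrow> ennreal (u x t)) * indicator ?S z) \<in> borel_measurable borel"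
    using S by (subst (asm) borel_measurable_restrict_space_iff_ennreal) auto
  moreover have "(\<lambda>z. (case z of (x, t) \<Rightarrow> ennreal (u x t)) * indicator ?S z) = (\<lambda>(x, t). U x t)"
    by (auto simp: U_def split: split_indicator)
  ultimately have Um: "(\<lambda>(x, t). U x t) \<in> borel_measurable (borel \<Otimes>\<^sub>M borel)" by (simp add: borel_prod)
  have "AE (x, t) in lborel. 0 < t \<and> ereal t < T \<longrightarrow> U x t < top \<and> heat t (\<lambda>y. ennreal (f y)) x + duhamel p U x t \<le> U x t"
    using eq
  proof eventually_elim
    case (elim z)
    obtain x t where z: "z = (x, t)" by (cases z) auto
    have "U x t < top \<and> heat t (\<lambda>y. ennreal (f y)) x + duhamel p U x t \<le> U x t" if t: "0 < t" "ereal t < T"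
    proof -
      have "ereal s < T" if "s < t" for s using less_trans[of "ereal s" "ereal t" T] that t by simp
      then have "(\<integral>\<^sup>+s\<in>{0<..<t}. (\<integral>\<^sup>+y. ennreal (frac_heat_kernel \<theta> (x - y) (t - s) * u y s powr p) \<partial>lborel) \<partial>lborel) = duhamel p U x t"
        by (intro duhamel_integral) (auto simp: U_def u0)
      then have "U x t = heat t (\<lambda>y. ennreal (f y)) x + duhamel p U x t"
        using elim t by (simp add: z U_def fun_measure_heat)
      moreover have "U x t < top" using t by (simp add: U_def)
      ultimately show ?thesis by simp
    qed
    then show ?case by (simp add: z)
  qed
  then show ?thesis using that Um unfolding supersolution_def by blast
qed

lemma supersolution_imp_solution:
  fixes f :: "real ^ 'n \<Rightarrow> real"
  assumes p: "0 < p" and [measurable]: "f \<in> borel_measurable borel" and U: "supersolution p (\<lambda>y. ennreal (f y)) T U"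
  obtains u where "is_solution \<theta> p (fun_measure f) T u"
proof -
  obtain v where vm: "(\<lambda>(x, t). v x t) \<in> borel_measurable (borel \<Otimes>\<^sub>M borel)"
    and fin: "AE (x, t) in lborel. 0 < t \<and> ereal t < T \<longrightarrow> v x t < top"
    and v: "\<And>x t. v x t = heat t (\<lambda>y. ennreal (f y)) x + duhamel p v x t"
    using solution_of_supersolution[OF p _ U] by auto
  \<comment> \<open>\<open>enn2real\<close> sends \<infinity> to 0, which on the strip changes
    \<open>v\<close> only on a null set; that this set is also null in almost every time slice is
    \<open>fin'\<close> below.\<close>
  define u where "u x t = enn2real (v x t)" for x t
  have "(\<lambda>z. enn2real ((\<lambda>(x, t). v x t) z)) \<in> borel_measurable (borel \<Otimes>\<^sub>M borel)"
    by (intro borel_measurable_enn2real vm)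
  then have um: "(\<lambda>(x, t). u x t) \<in> borel_measurable borel"
    by (simp add: u_def case_prod_beta borel_prod)
  have u0: "0 \<le> u x t" for x t by (simp add: u_def)
  have fin': "AE s in lborel. AE y in lborel. 0 < s \<and> ereal s < T \<longrightarrow> v y s < top"
    by (rule AE_lborel_swap[OF fin])
  have "AE (x, t) in lborel. 0 < t \<and> ereal t < T \<longrightarrow> ennreal (u x t) =
          (\<integral>\<^sup>+y. ennreal (frac_heat_kernel \<theta> (x - y) t) \<partial>fun_measure f) +
          (\<integral>\<^sup>+s\<in>{0<..<t}. (\<integral>\<^sup>+y. ennreal (frac_heat_kernel \<theta> (x - y) (t - s) * u y s powr p) \<partial>lborel) \<partial>lborel)"
    using fin
  proof eventually_elim
    case (elim z)
    obtain x t where z: "z = (x, t)" by (cases z) auto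
    have "ennreal (u x t) = (\<integral>\<^sup>+y. ennreal (frac_heat_kernel \<theta> (x - y) t) \<partial>fun_measure f) +
          (\<integral>\<^sup>+s\<in>{0<..<t}. (\<integral>\<^sup>+y. ennreal (frac_heat_kernel \<theta> (x - y) (t - s) * u y s powr p) \<partial>lborel) \<partial>lborel)"
      if t: "0 < t" "ereal t < T"
    proof -
      have T: "ereal s < T" if "s < t" for s using less_trans[of "ereal s" "ereal t" T] that t by simp
      have "(\<integral>\<^sup>+s\<in>{0<..<t}. (\<integral>\<^sup>+y. ennreal (frac_heat_kernel \<theta> (x - y) (t - s) * u y s powr p) \<partial>lborel) \<partial>lborel) = duhamel p v x t"
      proof (rule duhamel_integral)
        show "AE s in lborel. 0 < s \<and> s < t \<longrightarrow> (AE y in lborel. v y s = ennreal (u y s) \<and> 0 \<le> u y s)"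
          using fin' by eventually_elim (use T in \<open>auto simp: u_def elim!: eventually_mono\<close>)
      qed
      moreover have "ennreal (u x t) = v x t" using elim t by (simp add: z u_def)
      ultimately show ?thesis using v[of x t] t by (simp add: fun_measure_heat)
    qed
    then show ?case by (simp add: z)
  qed
  then have "is_solution \<theta> p (fun_measure f) T u"
    unfolding is_solution_def using um u0 by (intro conjI measurable_restrict_space1) auto
  then show ?thesis using that by blast
qed

lemma has_local_solution_iff_solvable:
  fixes f :: "real ^ 'n \<Rightarrow> real"
  assumes "0 < p" and "f \<in> borel_measurable borel"
  shows "has_local_solution \<theta> p (fun_measure f) \<longleftrightarrow> solvable p (\<lambda>y. ennreal (f y))"
  unfolding has_local_solution_def solvable_def
  using solution_imp_supersolution[OF assms(2)] supersolution_imp_solution[OF assms] by metis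

lemma critical_threshold:
  assumes p: "p = 1 + \<theta> / real CARD('n)"
  shows "\<exists>\<gamma>\<^sub>s>0. \<forall>\<gamma>\<ge>0. \<forall>C\<ge>0.
    (\<gamma> < \<gamma>\<^sub>s \<longrightarrow> has_local_solution \<theta> p (fun_measure (critical_data \<theta> \<gamma> C :: real ^ 'n \<Rightarrow> real))) \<and>
    (\<gamma> > \<gamma>\<^sub>s \<longrightarrow> \<not> has_local_solution \<theta> p (fun_measure (critical_data \<theta> \<gamma> C :: real ^ 'n \<Rightarrow> real)))"
proof -
  have p1: "1 < p" using p \<theta> by simp
  have pq: "p = 1 + 1 / (real CARD('n) / \<theta>)" using p by simp
  obtain \<gamma>0 where ex: "0 < \<gamma>0" "solvable p (\<lambda>y :: real ^ 'n. ennreal (\<gamma>0 * critical_profile y))"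
    by (rule critical_solvable[OF pq])
  obtain \<Gamma> where bd: "\<forall>\<gamma>>0. solvable p (\<lambda>y :: real ^ 'n. ennreal (\<gamma> * critical_profile y)) \<longrightarrow> \<gamma> \<le> \<Gamma>"
    using critical_bound[OF pq] by blast
  have data: "critical_data \<theta> \<gamma> C = (\<lambda>y :: real ^ 'n. \<gamma> * critical_profile y + C)" for \<gamma> C
    by (intro ext) (simp add: critical_data_def critical_profile_def mult.assoc)
  have "has_local_solution \<theta> p (fun_measure (critical_data \<theta> \<gamma> C :: real ^ 'n \<Rightarrow> real)) \<longleftrightarrow> solvable p (\<lambda>y :: real ^ 'n. ennreal (\<gamma> * critical_profile y + C))" for \<gamma> C
    unfolding data using p1 by (intro has_local_solution_iff_solvable) auto
  then show ?thesis
    using solvability_threshold[OF p1 critical_profile_measurable critical_profile_nonneg ex bd[rule_format]] by simp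
qed

lemma supercritical_threshold:
  assumes p: "p > 1 + \<theta> / real CARD('n)"
  shows "\<exists>\<gamma>\<^sub>s>0. \<forall>\<gamma>\<ge>0. \<forall>C\<ge>0.
    (\<gamma> < \<gamma>\<^sub>s \<longrightarrow> has_local_solution \<theta> p (fun_measure (supercritical_data \<theta> p \<gamma> C :: real ^ 'n \<Rightarrow> real))) \<and>
    (\<gamma> > \<gamma>\<^sub>s \<longrightarrow> \<not> has_local_solution \<theta> p (fun_measure (supercritical_data \<theta> p \<gamma> C :: real ^ 'n \<Rightarrow> real)))"
    (is ?threshold)
  and "\<exists>\<epsilon>>0. \<forall>\<gamma>. 0 \<le> \<gamma> \<and> \<gamma> < \<epsilon> \<longrightarrow> has_global_solution \<theta> p (fun_measure (supercritical_data \<theta> p \<gamma> 0 :: real ^ 'n \<Rightarrow> real))"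
    (is ?global)
proof -
  let ?g = "\<lambda>y :: real ^ 'n. norm y powr (- (\<theta> / (p - 1)))"
  have "0 < \<theta> / real CARD('n)" using \<theta> by simp
  then have p1: "1 < p" using p by linarith
  have b: "\<theta> / (p - 1) < real DIM(real ^ 'n)"
    using p p1 \<theta> by (simp add: field_simps)
  obtain \<gamma>0 U where \<gamma>0: "0 < \<gamma>0" and U: "supersolution p (\<lambda>y. ennreal (\<gamma>0 * ?g y)) \<infinity> U"
    by (rule supercritical_supersolution[OF p1 b])
  then have sol: "solvable p (\<lambda>y. ennreal (\<gamma>0 * ?g y))" unfolding solvable_def by (intro exI[of _ \<infinity>]) auto
  obtain \<Gamma> where bd: "\<forall>\<gamma>>0. solvable p (\<lambda>y. ennreal (\<gamma> * ?g y)) \<longrightarrow> \<gamma> \<le> \<Gamma>"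
    using supercritical_bound[OF p1 b] by blast
  have data: "supercritical_data \<theta> p \<gamma> C = (\<lambda>y. \<gamma> * ?g y + C)" for \<gamma> C
    by (intro ext) (simp add: supercritical_data_def)
  have "has_local_solution \<theta> p (fun_measure (supercritical_data \<theta> p \<gamma> C :: real ^ 'n \<Rightarrow> real)) \<longleftrightarrow> solvable p (\<lambda>y. ennreal (\<gamma> * ?g y + C))" for \<gamma> C
    unfolding data using p1 by (intro has_local_solution_iff_solvable) auto
  then show ?threshold
    using solvability_threshold[OF p1 _ _ \<gamma>0 sol bd[rule_format]] by simp
  \<comment> \<open>The supersolution for \<open>\<gamma>0\<close> exists for all times and serves
    every smaller coefficient as well.\<close>
  have "has_global_solution \<theta> p (fun_measure (supercritical_data \<theta> p \<gamma> 0 :: real ^ 'n \<Rightarrow> real))" if \<gamma>: "0 \<le> \<gamma>" "\<gamma> < \<gamma>0" for \<gamma>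
  proof -
    have "supersolution p (\<lambda>y. ennreal (\<gamma> * ?g y + 0)) \<infinity> U"
      by (rule supersolution_mono[OF U]) (use \<gamma> in \<open>auto intro!: always_eventually ennreal_leI mult_right_mono\<close>)
    then show ?thesis
      using supersolution_imp_solution[of p "\<lambda>y. \<gamma> * ?g y + 0" \<infinity> U] p1
      unfolding data has_global_solution_def by auto
  qed
  then show ?global using \<gamma>0 by blast
qed

end

theorem corollary1p2:
  fixes \<theta> p :: real
  assumes "0 < \<theta>" and "\<theta> \<le> 2"
    and "p \<ge> 1 + \<theta> / real CARD('n::finite)"
  shows "\<exists>\<gamma>\<^sub>s>0.
    (p = 1 + \<theta> / real CARD('n) \<longrightarrow>
      (\<forall>\<gamma>\<ge>0. \<forall>C\<ge>0.
        (\<gamma> < \<gamma>\<^sub>s \<longrightarrow>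
          has_local_solution \<theta> p (fun_measure (critical_data \<theta> \<gamma> C :: real ^ 'n \<Rightarrow> real))) \<and>
        (\<gamma> > \<gamma>\<^sub>s \<longrightarrow>
          \<not> has_local_solution \<theta> p (fun_measure (critical_data \<theta> \<gamma> C :: real ^ 'n \<Rightarrow> real))))) \<and>
    (p > 1 + \<theta> / real CARD('n) \<longrightarrow>
      (\<forall>\<gamma>\<ge>0. \<forall>C\<ge>0.
        (\<gamma> < \<gamma>\<^sub>s \<longrightarrow>
          has_local_solution \<theta> p (fun_measure (supercritical_data \<theta> p \<gamma> C :: real ^ 'n \<Rightarrow> real))) \<and>
        (\<gamma> > \<gamma>\<^sub>s \<longrightarrow>
          \<not> has_local_solution \<theta> p (fun_measure (supercritical_data \<theta> p \<gamma> C :: real ^ 'n \<Rightarrow> real)))) \<and>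
      (\<exists>\<epsilon>>0. \<forall>\<gamma>. 0 \<le> \<gamma> \<and> \<gamma> < \<epsilon> \<longrightarrow>
        has_global_solution \<theta> p (fun_measure (supercritical_data \<theta> p \<gamma> 0 :: real ^ 'n \<Rightarrow> real))))"
\<comment> \<open>The threshold may depend on \<open>p\<close>, so each case supplies its own, and
  the other implication is vacuous.\<close>
proof (cases "p = 1 + \<theta> / real CARD('n)")
  case True
  then show ?thesis using critical_threshold[OF assms(1,2) True] by simp
next
  case False
  then have p: "p > 1 + \<theta> / real CARD('n)" using assms(3) by simp
  show ?thesis using supercritical_threshold[OF assms(1,2) p] p False by simp
qed

end
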